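(* Let $n\ge 2$, $n<p<\infty$, and let $\rho$ be an admissible measure on $\mathbb{R}^n$. Suppose $v\in\mathcal{D}^{1,p}(\mathbb{R}^n)$ is an extremal with $$[v]_\rho=\frac{\left|\int_{\mathbb{R}^n}v(y)\,d\rho(y)\right|}{\left|\int_{\mathbb{R}^n}y\,d\rho(y)\right|^{1-n/p}}.$$ If $T_\#\rho=-\rho$ for some $T\in\mathcal{S}(n)$, then $$v(x)+v(T(x))=v(y)+v(T(y))$$ for all $x,y\in\mathbb{R}^n$. Moreover, $$\lim_{|x|\to\infty}v(x)=\frac{v(y)+v(T(y))}{2}$$ for each $y\in\mathbb{R}^n$.
   Context: $\mathcal{D}^{1,p}(\mathbb{R}^n)$ is the space of $u\in L^1_{\rm loc}(\mathbb{R}^n)$ whose weak partial derivatives $u_{x_i}$, $i=1,\dots,n$, all belong to $L^p(\mathbb{R}^n)$. Since $p>n$, each $u$ is identified with its $(1-n/p)$-Hölder continuous representative. $\|Du\|_p:=\left(\int_{\mathbb{R}^n}|Du|^p\,dx\right)^{1/p}$. An admissible measure is a signed Borel measure $\rho$ on $\mathbb{R}^n$ with compact support, $\rho(\mathbb{R}^n)=0$, and $\int_{\mathbb{R}^n}y\,d\rho(y)\ne 0$. $\mathcal{S}(n)$ is the set of similarity transformations $S(y)=\lambda Oy+z$ of $\mathbb{R}^n$ with $\lambda>0$, $O\in\mathrm{O}(n)$, $z\in\mathbb{R}^n$. The push forward is $(S_\#\rho)(A)=\rho(S^{-1}(A))$ for Borel $A\subset\mathbb{R}^n$. For $u\in\mathcal{D}^{1,p}(\mathbb{R}^n)$,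 $$[u]_\rho:=\sup\left\{\frac{\left|\int u\,d\mu\right|}{\left|\int x\,d\mu(x)\right|^{1-n/p}}:\ \mu=S_\#\rho,\ S\in\mathcal{S}(n)\right\}.$$ $C_*$ is the smallest constant $C$ such that the generalized Morrey inequality $[u]_\rho\le C\|Du\|_p$ holds for all $u\in\mathcal{D}^{1,p}(\mathbb{R}^n)$. An extremal is a $u\in\mathcal{D}^{1,p}(\mathbb{R}^n)$ with $[u]_\rho=C_*\|Du\|_p$. *)

theory Defs
  imports "HOL-Analysis.Analysis"
begin

section \<open>The space of functions with p-integrable weak gradient\<close>

definition partial :: "'n::finite \<Rightarrow> (real ^ 'n \<Rightarrow> real) \<Rightarrow> real ^ 'n \<Rightarrow> real" where
  "partial i f x = frechet_derivative f (at x) (axis i 1)"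

primrec C_k :: "nat \<Rightarrow> (real ^ 'n::finite \<Rightarrow> real) \<Rightarrow> bool" where
  "C_k 0 f \<longleftrightarrow> continuous_on UNIV f"
| "C_k (Suc k) f \<longleftrightarrow> (\<forall>x. f differentiable (at x)) \<and> (\<forall>i. C_k k (partial i f))"

definition test_function :: "(real ^ 'n::finite \<Rightarrow> real) \<Rightarrow> bool" where
  "test_function \<phi> \<longleftrightarrow> (\<forall>k. C_k k \<phi>) \<and> compact (closure {x. \<phi> x \<noteq> 0})"

definition locally_integrable :: "(real ^ 'n::finite \<Rightarrow> real) \<Rightarrow> bool" where
  "locally_integrable f \<longleftrightarrow>
     f \<in> borel_measurable lborel \<and> (\<forall>K. compact K \<longrightarrow> set_integrable lborel K f)"

definition is_weak_partial ::
  "'n::finite \<Rightarrow> (real ^ 'n \<Rightarrow> real) \<Rightarrow> (real ^ 'n \<Rightarrow> real) \<Rightarrow> bool" where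
  "is_weak_partial i u g \<longleftrightarrow> locally_integrable g \<and>
     (\<forall>\<phi>. test_function \<phi> \<longrightarrow>
        (LINT x|lborel. u x * partial i \<phi> x) = - (LINT x|lborel. g x * \<phi> x))"

text \<open>Weak partial derivatives are unique up to null sets, and every class of Lebesgue measurable
  functions has a Borel representative, so the choice of a Borel function below is immaterial.\<close>

definition weak_partial :: "'n::finite \<Rightarrow> (real ^ 'n \<Rightarrow> real) \<Rightarrow> real ^ 'n \<Rightarrow> real" where
  "weak_partial i u = (SOME g. is_weak_partial i u g)"

definition weak_gradient :: "(real ^ 'n::finite \<Rightarrow> real) \<Rightarrow> real ^ 'n \<Rightarrow> real ^ 'n" where
  "weak_gradient u x = (\<chi> i. weak_partial i u x)"

definition in_Lp :: "real \<Rightarrow> (real ^ 'n::finite \<Rightarrow> real) \<Rightarrow> bool" where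
  "in_Lp p g \<longleftrightarrow> g \<in> borel_measurable lborel \<and> integrable lborel (\<lambda>x. \<bar>g x\<bar> powr p)"

definition holder_continuous :: "real \<Rightarrow> (real ^ 'n::finite \<Rightarrow> real) \<Rightarrow> bool" where
  "holder_continuous \<alpha> u \<longleftrightarrow> (\<exists>H. \<forall>x y. \<bar>u x - u y\<bar> \<le> H * dist x y powr \<alpha>)"

abbreviation holder_exponent :: "'n::finite itself \<Rightarrow> real \<Rightarrow> real" where
  "holder_exponent _ p \<equiv> 1 - real CARD('n) / p"

text \<open>For \<open>p > n\<close> every class in the space has a unique continuous representative, and it is
  Hoelder continuous with exponent \<open>1 - n / p\<close>. The elements of the set below are these
  representatives, as pointwise values matter.\<close>

definition D1p :: "real \<Rightarrow> (real ^ 'n::finite \<Rightarrow> real) set" where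
  "D1p p = {u. locally_integrable u \<and> (\<forall>i. \<exists>g. is_weak_partial i u g \<and> in_Lp p g) \<and>
     holder_continuous (holder_exponent TYPE('n) p) u}"

definition grad_norm :: "real \<Rightarrow> (real ^ 'n::finite \<Rightarrow> real) \<Rightarrow> real" where
  "grad_norm p u = (LINT x|lborel. norm (weak_gradient u x) powr p) powr (1 / p)"

section \<open>Signed measures\<close>

text \<open>A signed Borel measure is a countably additive real-valued function on the Borel sets; its
  values on other sets are irrelevant. Infinite values need not be considered: a signed measure
  of finite total mass is finite on all Borel sets.\<close>

type_synonym 'n set_function = "(real ^ 'n) set \<Rightarrow> real"

definition signed_borel_measure :: "'n::finite set_function \<Rightarrow> bool" where
  "signed_borel_measure \<rho> \<longleftrightarrow> \<rho> {} = 0 \<and>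
     (\<forall>A :: nat \<Rightarrow> (real ^ 'n) set. range A \<subseteq> sets borel \<longrightarrow> disjoint_family A \<longrightarrow>
        (\<lambda>i. \<rho> (A i)) sums \<rho> (\<Union>i. A i))"

text \<open>The positive part in the Jordan decomposition. As \<open>\<rho> {} = 0\<close>, it does no harm that
  \<^const>\<open>ennreal\<close> maps negative numbers to \<open>0\<close>.\<close>

definition positive_part :: "'n::finite set_function \<Rightarrow> (real ^ 'n) measure" where
  "positive_part \<rho> = measure_of UNIV (sets borel)
     (\<lambda>A. SUP B\<in>{B \<in> sets borel. B \<subseteq> A}. ennreal (\<rho> B))"

definition negative_part :: "'n::finite set_function \<Rightarrow> (real ^ 'n) measure" where
  "negative_part \<rho> = positive_part (\<lambda>A. - \<rho> A)"

definition signed_integral ::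
  "'n::finite set_function \<Rightarrow> (real ^ 'n \<Rightarrow> 'b) \<Rightarrow> 'b::{banach, second_countable_topology}" where
  "signed_integral \<rho> f = (LINT x|positive_part \<rho>. f x) - (LINT x|negative_part \<rho>. f x)"

definition signed_support :: "'n::finite set_function \<Rightarrow> (real ^ 'n) set" where
  "signed_support \<rho> =
     {x. \<forall>U. open U \<longrightarrow> x \<in> U \<longrightarrow> (\<exists>A \<in> sets borel. A \<subseteq> U \<and> \<rho> A \<noteq> 0)}"

definition admissible :: "'n::finite set_function \<Rightarrow> bool" where
  "admissible \<rho> \<longleftrightarrow> signed_borel_measure \<rho> \<and> compact (signed_support \<rho>) \<and>
     \<rho> UNIV = 0 \<and> signed_integral \<rho> (\<lambda>y. y) \<noteq> 0"

definition push_forward ::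
  "(real ^ 'n \<Rightarrow> real ^ 'n) \<Rightarrow> 'n::finite set_function \<Rightarrow> 'n set_function" where
  "push_forward S \<rho> A = \<rho> (S -` A)"

section \<open>The generalized Morrey inequality\<close>

definition similarities :: "(real ^ 'n::finite \<Rightarrow> real ^ 'n) set" where
  "similarities = {S. \<exists>c Q z. c > 0 \<and> orthogonal_matrix Q \<and> S = (\<lambda>y. c *\<^sub>R (Q *v y) + z)}"

definition morrey_ratio :: "real \<Rightarrow> 'n::finite set_function \<Rightarrow> (real ^ 'n \<Rightarrow> real) \<Rightarrow> real" where
  "morrey_ratio p \<mu> u = \<bar>signed_integral \<mu> u\<bar> /
     norm (signed_integral \<mu> (\<lambda>x. x)) powr holder_exponent TYPE('n) p"

definition morrey_seminorm :: "real \<Rightarrow> 'n::finite set_function \<Rightarrow> (real ^ 'n \<Rightarrow> real) \<Rightarrow> ereal" where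
  "morrey_seminorm p \<rho> u = (SUP S\<in>similarities. ereal (morrey_ratio p (push_forward S \<rho>) u))"

text \<open>The constants valid in the generalized Morrey inequality form a closed set bounded below,
  nonempty by that inequality, so the infimum is the smallest one and is finite.\<close>

definition morrey_constant :: "real \<Rightarrow> 'n::finite set_function \<Rightarrow> ereal" where
  "morrey_constant p \<rho> =
     Inf {ereal C | C. \<forall>u \<in> D1p p. morrey_seminorm p \<rho> u \<le> ereal (C * grad_norm p u)}"

definition extremal :: "real \<Rightarrow> 'n::finite set_function \<Rightarrow> (real ^ 'n \<Rightarrow> real) \<Rightarrow> bool" where
  "extremal p \<rho> v \<longleftrightarrow> v \<in> D1p p \<and>
     morrey_seminorm p \<rho> v = morrey_constant p \<rho> * ereal (grad_norm p v)"

end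

theory Submission
  imports Defs
begin

text \<open>Since \<open>T\<^sub># \<rho> = - \<rho>\<close>, the map \<open>T\<close> is an isometry, and \<open>w = - v \<circ> T\<close> has the same energy and the
  same integral against \<open>\<rho>\<close> as the extremal \<open>v\<close>. Among functions with a prescribed integral against
  \<open>\<rho>\<close> an extremal minimizes the energy, so the midpoint \<open>(v + w) / 2\<close> and strict convexity give
  \<open>Dv = Dw\<close>, that is, \<open>v + v \<circ> T\<close> is constant.

  For the limit, normalize this constant to \<open>0\<close>. The isometry \<open>T\<close> fixes the barycenter \<open>b\<close> of
  \<open>\<bar>\<rho>\<bar>\<close>, so \<open>v\<close> is odd on each sphere around \<open>b\<close>. Comparing \<open>v\<close> with a truncation shows
  that it is bounded. If \<open>\<bar>v\<bar> \<le> M\<close> outside a ball containing the support of \<open>\<rho>\<close>, then a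
  logarithmic energy estimate for \<open>M - v\<close>, combined with Morrey's inequality (\<open>p > n\<close>), gives a
  Harnack inequality on the spheres around \<open>b\<close>; by oddness it improves \<open>M\<close> by a fixed factor
  whenever the radius is multiplied by \<open>4\<close>.

  Sobolev functions are handled through absolute continuity along almost every line in each
  direction, which is equivalent to the weak formulation for continuous functions and makes the
  chain rule, the product rule and the invariance under isometries one-dimensional facts.\<close>

section \<open>Test functions\<close>

text \<open>The constant in Harnack's inequality has to be the same at all radii, and this comes
  from scaling: the logarithmic estimate bounds the p-energy of
  \<open>ln (M + \<epsilon> - v)\<close> at distance comparable to r by a constant times r^(n-p),
  and Morrey's inequality on a ball of radius 6r raises this to the power 1/p and multiplies it by a
  constant times r^(1-n/p), so that the powers of r cancel. Oddness turns comparability into decay: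
  x and T x lie on the same sphere and carry opposite values, so M - v x and M + v x are comparable,
  which keeps v x away from -M by a fixed proportion of M.

  Minimality enters only through explicit competitors. For the symmetry this is the midpoint; for
  the limit they are perturbations vanishing on a ball that contains the support of \<rho>, which
  leave the integral against \<rho> unchanged.

  That T is an isometry is read off the first moment of \<rho>: the push forward multiplies its
  length by the factor of the similarity, the change of sign preserves the length, and admissibility
  makes it nonzero.\<close>

lemma has_derivative_partial:
  fixes f :: "real ^ 'n::finite \<Rightarrow> real"
  assumes "f differentiable (at x)"
  shows "(f has_derivative (\<lambda>h. (\<chi> i. partial i f x) \<bullet> h)) (at x)"
proof -
  let ?D = "frechet_derivative f (at x)"
  have D: "(f has_derivative ?D) (at x)"
    using assms by (simp add: frechet_derivative_works)
  then have lin: "linear ?D" by (rule has_derivative_linear)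
  have "?D = (\<lambda>h. (\<chi> i. partial i f x) \<bullet> h)"
  proof
    fix h :: "real ^ 'n"
    have "?D h = ?D (\<Sum>i\<in>UNIV. (h $ i) *\<^sub>R axis i 1)"
      using basis_expansion[of h] by (simp add: scalar_mult_eq_scaleR)
    also have "\<dots> = (\<Sum>i\<in>UNIV. h $ i * partial i f x)"
      by (simp add: linear_sum[OF lin] linear_scale[OF lin] partial_def)
    finally show "?D h = (\<chi> i. partial i f x) \<bullet> h"
      by (simp add: inner_vec_def mult.commute)
  qed
  with D show ?thesis by simp
qed

lemma partial_eqI:
  "(f has_derivative f') (at x) \<Longrightarrow> partial i f x = f' (axis i 1)"
  using frechet_derivative_at[of f f' x] by (simp add: partial_def)

lemma C_k_Suc: "C_k (Suc k) f \<Longrightarrow> C_k k f"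
proof (induction k arbitrary: f)
  case 0
  then show ?case
    by (auto simp: differentiable_imp_continuous_within continuous_on_eq_continuous_at)
qed simp

lemma C_k_add: "C_k k f \<Longrightarrow> C_k k g \<Longrightarrow> C_k k (\<lambda>x. f x + g x)"
proof (induction k arbitrary: f g)
  case (Suc k)
  have "partial i (\<lambda>x. f x + g x) = (\<lambda>x. partial i f x + partial i g x)" for i
  proof
    fix x
    have "((\<lambda>x. f x + g x) has_derivative
        (\<lambda>h. frechet_derivative f (at x) h + frechet_derivative g (at x) h)) (at x)"
      using Suc.prems by (intro has_derivative_add) (simp_all add: frechet_derivative_works)
    then show "partial i (\<lambda>x. f x + g x) x = partial i f x + partial i g x"
      by (subst partial_eqI) (auto simp: partial_def)
  qed
  with Suc show ?case by simp
qed (simp add: continuous_on_add)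

lemma C_k_mult: "C_k k f \<Longrightarrow> C_k k g \<Longrightarrow> C_k k (\<lambda>x. f x * g x)"
proof (induction k arbitrary: f g)
  case (Suc k)
  have "partial i (\<lambda>x. f x * g x) = (\<lambda>x. f x * partial i g x + partial i f x * g x)" for i
  proof
    fix x
    have "((\<lambda>x. f x * g x) has_derivative
        (\<lambda>h. f x * frechet_derivative g (at x) h + frechet_derivative f (at x) h * g x)) (at x)"
      using Suc.prems by (intro has_derivative_mult) (simp_all add: frechet_derivative_works)
    then show "partial i (\<lambda>x. f x * g x) x = f x * partial i g x + partial i f x * g x"
      by (subst partial_eqI) (auto simp: partial_def)
  qed
  moreover have "C_k k f" "C_k k g" using Suc.prems C_k_Suc by blast+
  ultimately show ?case using Suc by (simp add: C_k_add)
qed (simp add: continuous_on_mult)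

lemma C_k_const: "C_k k (\<lambda>x :: real ^ 'n::finite. c)"
proof (induction k arbitrary: c)
  case (Suc k)
  have "partial i (\<lambda>x. c) = (\<lambda>x. 0)" for i :: 'n
    by (rule ext, subst partial_eqI[where f' = "\<lambda>h. 0"]) auto
  with Suc show ?case by simp
qed simp

lemma C_k_prod:
  assumes "finite I" "\<And>i. i \<in> I \<Longrightarrow> C_k k (f i)"
  shows "C_k k (\<lambda>x. \<Prod>i\<in>I. f i x)"
  using assms by (induction I rule: finite_induct) (auto simp: C_k_const intro!: C_k_mult)

text \<open>Smooth functions of one variable enter as a tower \<open>D 0\<close>,
  \<open>D 1\<close>, ... of successive derivatives. A free index \<open>m\<close> and a free factor
  \<open>c\<close> absorb the inner derivative, so that the induction on \<open>k\<close>
  closes.\<close>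

lemma C_k_coordinate:
  assumes "\<And>m t. (D m has_real_derivative D (Suc m) t) (at t)"
  shows "C_k k (\<lambda>x :: real ^ 'n::finite. c * D m (\<alpha> * x $ j + \<beta>))"
proof (induction k arbitrary: m c)
  case 0
  have "continuous_on UNIV (D m)"
    using assms by (auto intro!: continuous_at_imp_continuous_on DERIV_isCont)
  then have "continuous_on UNIV (\<lambda>x :: real ^ 'n. D m (\<alpha> * x $ j + \<beta>))"
    by (rule continuous_on_compose2) (auto intro!: continuous_intros)
  then show ?case by (auto intro!: continuous_intros)
next
  case (Suc k)
  let ?f = "\<lambda>x :: real ^ 'n. c * D m (\<alpha> * x $ j + \<beta>)"
  have der: "(?f has_derivative (\<lambda>h. c * (D (Suc m) (\<alpha> * x $ j + \<beta>) * (\<alpha> * h $ j)))) (at x)" for x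
  proof -
    have 1: "((\<lambda>x :: real ^ 'n. \<alpha> * x $ j + \<beta>) has_derivative (\<lambda>h. \<alpha> * h $ j)) (at x)"
      by (intro has_derivative_add_const has_derivative_mult_right
          bounded_linear_imp_has_derivative bounded_linear_vec_nth)
    show ?thesis
      using has_derivative_mult_right[OF has_derivative_compose[OF 1
        assms[of m "\<alpha> * x $ j + \<beta>", unfolded has_field_derivative_def]], of c]
      by simp
  qed
  have "partial i ?f = (\<lambda>x. (c * (\<alpha> * axis i 1 $ j)) * D (Suc m) (\<alpha> * x $ j + \<beta>))" for i
    by (rule ext, subst partial_eqI[OF der]) (simp add: mult_ac)
  moreover have "?f differentiable (at x)" for x
    using der[of x] by (rule differentiableI)
  ultimately show ?case using Suc by simp
qed

lemma partial_translate:
  fixes f :: "real ^ 'n::finite \<Rightarrow> real"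
  assumes "f differentiable (at (x + a))"
  shows "partial i (\<lambda>x. f (x + a)) x = partial i f (x + a)"
    and "(\<lambda>x. f (x + a)) differentiable (at x)"
proof -
  have 1: "((\<lambda>x. x + a) has_derivative (\<lambda>h. h)) (at x)" by (auto intro!: derivative_eq_intros)
  have 2: "((\<lambda>x. f (x + a)) has_derivative frechet_derivative f (at (x + a))) (at x)"
    using has_derivative_compose[OF 1] assms by (simp add: frechet_derivative_works)
  show "partial i (\<lambda>x. f (x + a)) x = partial i f (x + a)"
    by (subst partial_eqI[OF 2]) (simp add: partial_def)
  show "(\<lambda>x. f (x + a)) differentiable (at x)"
    using 2 by (auto simp: differentiable_def)
qed

lemma C_k_translate: "C_k k f \<Longrightarrow> C_k k (\<lambda>x. f (x + a))"
proof (induction k arbitrary: f)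
  case 0
  then have "continuous_on UNIV f" by simp
  then have "continuous_on UNIV (\<lambda>x. f (x + a))"
    by (rule continuous_on_compose2) (auto intro!: continuous_intros)
  then show ?case by simp
next
  case (Suc k)
  then have "partial i (\<lambda>x. f (x + a)) = (\<lambda>x. partial i f (x + a))" for i
    by (intro ext partial_translate) auto
  with Suc show ?case by (auto intro: partial_translate)
qed

lemma bounded_vanish_outside_imp_compact_closure:
  fixes \<phi> :: "'a::euclidean_space \<Rightarrow> real"
  shows "(\<And>x. \<phi> x \<noteq> 0 \<Longrightarrow> x \<in> cball 0 R) \<Longrightarrow> compact (closure {x. \<phi> x \<noteq> 0})"
  by (rule compact_closure[THEN iffD2], rule bounded_subset[OF bounded_cball[of 0 R]]) auto

lemma test_functionE:
  assumes "test_function \<phi>"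
  obtains R where "R > 0" "\<And>x. R < norm x \<Longrightarrow> \<phi> x = 0"
proof -
  have "bounded {x. \<phi> x \<noteq> 0}"
    using assms bounded_subset[OF compact_imp_bounded closure_subset]
    by (auto simp: test_function_def)
  then obtain R where "R > 0" "\<And>x. \<phi> x \<noteq> 0 \<Longrightarrow> norm x \<le> R"
    by (auto simp: bounded_pos)
  with that show thesis by (meson not_le)
qed

lemma test_function_translate:
  assumes "test_function \<phi>"
  shows "test_function (\<lambda>x. \<phi> (x + a))"
proof -
  obtain R where R: "R > 0" "\<And>x. R < norm x \<Longrightarrow> \<phi> x = 0"
    using test_functionE[OF assms] by blast
  have "compact (closure {x. \<phi> (x + a) \<noteq> 0})"
  proof (rule bounded_vanish_outside_imp_compact_closure[of _ "R + norm a"])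
    fix x assume "\<phi> (x + a) \<noteq> 0"
    then have "norm (x + a) \<le> R" using R(2) by (meson not_le)
    then show "x \<in> cball 0 (R + norm a)" using norm_triangle_ineq4[of "x + a" a] by auto
  qed
  with assms show ?thesis by (auto simp: test_function_def C_k_translate)
qed

section \<open>Smooth bumps and the fundamental lemma of the calculus of variations\<close>

primrec bump_poly :: "nat \<Rightarrow> real poly" where
  "bump_poly 0 = 1"
| "bump_poly (Suc k) = [:0, 0, 1:] * (bump_poly k - pderiv (bump_poly k))"

text \<open>The k-th derivative of exp(-1/t), extended by 0 to t \<le> 0. With s = 1/t one has d/dt
  = -s^2 d/ds, so P(s) exp(-s) has the derivative s^2 (P(s) - P'(s)) exp(-s); this is the recursion
  of \<open>bump_poly\<close>.\<close>

definition flat_exp :: "nat \<Rightarrow> real \<Rightarrow> real" where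
  "flat_exp k t = (if t > 0 then poly (bump_poly k) (1 / t) * exp (- 1 / t) else 0)"
  
lemma poly_div_exp_tendsto_0: "((\<lambda>x :: real. poly P x / exp x) \<longlongrightarrow> 0) at_top"
proof -
  have "((\<lambda>x. \<Sum>i\<le>degree P. coeff P i * (x ^ i / exp x)) \<longlongrightarrow> (\<Sum>i\<le>degree P. coeff P i * 0)) at_top"
    by (intro tendsto_intros tendsto_power_div_exp_0)
  then show ?thesis by (simp add: poly_altdef sum_divide_distrib)
qed

lemma flat_exp_has_derivative: "(flat_exp k has_real_derivative flat_exp (Suc k) t) (at t)"
proof -
  consider "t > 0" | "t < 0" | "t = 0" by linarith
  then show ?thesis
  proof cases
    case 1
    have "((\<lambda>t. poly (bump_poly k) (1 / t) * exp (- 1 / t)) has_real_derivative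
        flat_exp (Suc k) t) (at t)"
      using 1 by (auto intro!: derivative_eq_intros DERIV_chain2[OF poly_DERIV]
          simp: flat_exp_def field_simps power2_eq_square)
    then show ?thesis
      by (rule has_field_derivative_transform_within_open[where S = "{0<..}"])
        (use 1 in \<open>auto simp: flat_exp_def\<close>)
  next
    case 2
    have "((\<lambda>t. 0) has_real_derivative flat_exp (Suc k) t) (at t)"
      using 2 by (auto simp: flat_exp_def)
    then show ?thesis
      by (rule has_field_derivative_transform_within_open[where S = "{..<0}"])
        (use 2 in \<open>auto simp: flat_exp_def\<close>)
  next
    case 3
    \<comment> \<open>In terms of 1/h the difference quotient at 0 is a polynomial divided by the
      exponential; the extra factor \<open>[:0, 1:]\<close> accounts for the division by h.\<close>
    have "((\<lambda>h. flat_exp k h / h) \<longlongrightarrow> 0) (at_right 0)"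
    proof (rule Lim_transform_eventually)
      show "((\<lambda>h :: real. poly ([:0, 1:] * bump_poly k) (inverse h) / exp (inverse h)) \<longlongrightarrow> 0)
          (at_right 0)"
        by (rule filterlim_compose[OF poly_div_exp_tendsto_0 filterlim_inverse_at_top_right])
      show "\<forall>\<^sub>F h in at_right 0. poly ([:0, 1:] * bump_poly k) (inverse h) / exp (inverse h)
          = flat_exp k h / h"
        using eventually_at_right_less[of 0]
        by eventually_elim (simp add: flat_exp_def field_simps exp_minus)
    qed
    moreover have "((\<lambda>h. flat_exp k h / h) \<longlongrightarrow> 0) (at_left 0)"
      by (rule Lim_transform_eventually[OF tendsto_const])
        (auto simp: flat_exp_def eventually_at_left_field intro!: exI[of _ "-1"])
    ultimately have "((\<lambda>h. flat_exp k h / h) \<longlongrightarrow> 0) (at 0)"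
      using filterlim_split_at by blast
    then show ?thesis
      using 3 by (simp add: DERIV_def flat_exp_def)
  qed
qed

text \<open>Each coordinate contributes one flat factor per face of the box. Multiplying the
  distances to the faces by \<open>Suc m\<close> drives the factors to 1 inside, while the function
  keeps vanishing outside the box.\<close>

definition box_bump :: "real ^ 'n::finite \<Rightarrow> real ^ 'n \<Rightarrow> nat \<Rightarrow> real ^ 'n \<Rightarrow> real" where
  "box_bump a b m x =
     (\<Prod>j\<in>UNIV. flat_exp 0 (real (Suc m) * (x $ j - a $ j)) * flat_exp 0 (real (Suc m) * (b $ j - x $ j)))"

lemma flat_exp_0_bounds: "0 \<le> flat_exp 0 t" "flat_exp 0 t \<le> 1"
  by (auto simp: flat_exp_def)

lemma box_bump_bounds: "0 \<le> box_bump a b m x" "box_bump a b m x \<le> 1"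
  unfolding box_bump_def by (auto intro!: prod_nonneg prod_le_1 mult_le_one flat_exp_0_bounds mult_nonneg_nonneg)

lemma box_bump_outside: "x \<notin> box a b \<Longrightarrow> box_bump a b m x = 0"
proof -
  assume "x \<notin> box a b"
  then obtain j where "x $ j \<le> a $ j \<or> b $ j \<le> x $ j" by (auto simp: mem_box_cart not_less)
  then have "flat_exp 0 (real (Suc m) * (x $ j - a $ j)) * flat_exp 0 (real (Suc m) * (b $ j - x $ j)) = 0"
    by (auto simp: flat_exp_def zero_less_mult_iff)
  then show ?thesis unfolding box_bump_def by (intro prod_zero) auto
qed

lemma test_function_box_bump: "test_function (box_bump a b m)"
proof -
  let ?c = "real (Suc m)"
  have "C_k k (\<lambda>x :: real ^ 'a. \<Prod>j\<in>UNIV.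
      (1 * flat_exp 0 (?c * x $ j + - ?c * a $ j)) * (1 * flat_exp 0 (- ?c * x $ j + ?c * b $ j)))" for k
    by (intro C_k_prod C_k_mult C_k_coordinate flat_exp_has_derivative) auto
  then have "C_k k (box_bump a b m)" for k
    by (simp add: box_bump_def[abs_def] algebra_simps del: of_nat_Suc)
  moreover have "compact (closure {x. box_bump a b m x \<noteq> 0})"
  proof -
    have "{x. box_bump a b m x \<noteq> 0} \<subseteq> box a b" using box_bump_outside by blast
    then show ?thesis using bounded_subset[OF bounded_box] by (auto simp: compact_closure)
  qed
  ultimately show ?thesis by (auto simp: test_function_def)
qed

lemma flat_exp_0_tendsto_1:
  assumes "t > 0" shows "(\<lambda>m. flat_exp 0 (real (Suc m) * t)) \<longlonglongrightarrow> 1"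
proof -
  have "(\<lambda>m. exp (- (1 / t) * inverse (real (Suc m)))) \<longlonglongrightarrow> exp (- (1 / t) * 0)"
    by (intro tendsto_intros LIMSEQ_inverse_real_of_nat)
  then show ?thesis using assms by (simp add: flat_exp_def field_simps del: of_nat_Suc)
qed

lemma box_bump_tendsto_indicator: "(\<lambda>m. box_bump a b m x) \<longlonglongrightarrow> indicator (box a b) x"
proof (cases "x \<in> box a b")
  case True
  have "(\<lambda>m. box_bump a b m x) \<longlonglongrightarrow> (\<Prod>j\<in>(UNIV::'a set). 1 * 1)"
    unfolding box_bump_def using True
    by (intro tendsto_prod tendsto_mult flat_exp_0_tendsto_1) (auto simp: mem_box_cart)
  with True show ?thesis by simp
qed (simp add: box_bump_outside)

lemma test_function_continuous: "test_function \<phi> \<Longrightarrow> continuous_on UNIV \<phi>"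
  using C_k.simps(1) by (auto simp: test_function_def simp del: C_k.simps)

text \<open>The bumps \<^const>\<open>box_bump\<close> increase to the indicator function of the open box, so that
  \<open>f\<close> has integral zero over all boxes.\<close>

lemma AE_zero_if_integral_test_function_zero:
  fixes f :: "real ^ 'n::finite \<Rightarrow> real"
  assumes [measurable]: "f \<in> borel_measurable borel"
    and loc: "\<And>R. set_integrable lborel (cball 0 R) f"
    and zero: "\<And>\<phi>. test_function \<phi> \<Longrightarrow> (LINT x|lborel. f x * \<phi> x) = 0"
  shows "AE x in lborel. f x = 0"
proof -
  have int_bounded: "set_integrable lborel A f" if "bounded A" "A \<in> sets borel" for A
  proof -
    obtain R where "A \<subseteq> cball 0 R" using \<open>bounded A\<close> by (auto simp: bounded_iff subset_iff)
    then show ?thesis using set_integrable_subset[OF loc] that by simp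
  qed
  have box_zero: "set_lebesgue_integral lborel (box a b) f = 0" for a b
  proof -
    have "(\<lambda>m. LINT x|lborel. f x * box_bump a b m x) \<longlonglongrightarrow> (LINT x|lborel. indicator (box a b) x *\<^sub>R f x)"
    proof (rule integral_dominated_convergence[where w = "\<lambda>x. norm (indicator (box a b) x *\<^sub>R f x)"])
      show "integrable lborel (\<lambda>x. norm (indicat_real (box a b) x *\<^sub>R f x))"
        using int_bounded[of "box a b"] by (intro integrable_norm) (auto simp: set_integrable_def bounded_box)
      show "(\<lambda>x. f x * box_bump a b i x) \<in> borel_measurable lborel" for i
        using borel_measurable_continuous_onI[OF test_function_continuous[OF test_function_box_bump[of a b i]]]
        by (simp add: borel_measurable_times)
      show "AE x in lborel. (\<lambda>i. f x * box_bump a b i x) \<longlonglongrightarrow> indicat_real (box a b) x *\<^sub>R f x"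
        by (intro always_eventually allI) (auto simp: mult.commute intro!: tendsto_mult_left box_bump_tendsto_indicator)
      show "AE x in lborel. norm (f x * box_bump a b i x) \<le> norm (indicat_real (box a b) x *\<^sub>R f x)" for i
        using box_bump_bounds[of a b i]
        by (intro always_eventually allI)
          (auto simp: abs_mult box_bump_outside indicator_def intro!: mult_left_le)
    qed simp
    then show ?thesis
      using zero[OF test_function_box_bump] LIMSEQ_unique[OF _ tendsto_const]
      by (simp add: set_lebesgue_integral_def)
  qed
  have on_box: "AE x in lborel. x \<in> box a b \<longrightarrow> f x = 0" for a b
  proof -
    \<comment> \<open>Cutting \<open>f\<close> off to one box makes it integrable. The boxes form a
      generator stable under intersection, so a Dynkin argument extends vanishing integrals to all
      Borel sets; its complement step uses that \<open>g\<close> has total integral 0.\<close>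
    define g where "g = (\<lambda>x. indicat_real (box a b) x *\<^sub>R f x)"
    have g: "integrable lborel g"
      using int_bounded[of "box a b"] by (simp add: g_def set_integrable_def bounded_box)
    have gset: "set_integrable lborel A g" if "A \<in> sets borel" for A
      unfolding set_integrable_def using g that by (intro integrable_mult_indicator) auto
    have g0: "integral\<^sup>L lborel g = 0"
      using box_zero[of a b] by (simp add: g_def set_lebesgue_integral_def)
    have "set_lebesgue_integral lborel A g = 0" if "A \<in> sets lborel" for A
    proof -
      have A: "A \<in> sigma_sets UNIV (range (\<lambda>(a, b). box a b))"
        using that by (simp add: borel_eq_box)
      have sets: "B \<in> sets borel" if "B \<in> sigma_sets UNIV (range (\<lambda>(a, b). box a b))" for B :: "(real ^ 'n) set"
        using that by (simp add: borel_eq_box)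
      have "Int_stable (range (\<lambda>(a, b). box a b :: (real ^ 'n) set))"
        by (auto simp: Int_stable_def box_Int_box)
      moreover have "range (\<lambda>(a, b). box a b :: (real ^ 'n) set) \<subseteq> Pow UNIV" by simp
      ultimately show ?thesis using A
      proof (induction rule: sigma_sets_induct_disjoint)
        case (basic B)
        then obtain c d where B: "B = box c d" by auto
        obtain c' d' where "box c d \<inter> box a b = box c' d'" by (auto simp: box_Int_box)
        then have "indicat_real B x *\<^sub>R g x = indicat_real (box c' d') x *\<^sub>R f x" for x
          unfolding g_def B by (auto simp: indicator_def)
        then show ?case using box_zero[of c' d'] by (simp add: set_lebesgue_integral_def)
      next
        case (compl B)
        have "set_lebesgue_integral lborel (B \<union> (UNIV - B)) g =
            set_lebesgue_integral lborel B g + set_lebesgue_integral lborel (UNIV - B) g"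
          using sets[OF compl(1)] by (intro set_integral_Un gset) auto
        moreover have "B \<union> (UNIV - B) = UNIV" by blast
        ultimately show ?case using compl(2) g0 by (simp add: set_lebesgue_integral_def)
      next
        case (union B)
        have "set_lebesgue_integral lborel (\<Union>i. B i) g = (\<Sum>i. set_lebesgue_integral lborel (B i) g)"
        proof (rule lebesgue_integral_countable_add)
          show "B i \<in> sets lborel" for i using union(2) sets by auto
          show "i \<noteq> j \<Longrightarrow> B i \<inter> B j = {}" for i j using union(1) by (auto simp: disjoint_family_on_def)
          show "set_integrable lborel (\<Union>i. B i) g" using union(2) sets by (intro gset) auto
        qed
        then show ?case using union(3) by simp
      qed (auto simp: set_lebesgue_integral_def)
    qed
    then have "AE x in lborel. g x = 0" using g by (intro density_unique_real) (auto simp: set_lebesgue_integral_def)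
    then show ?thesis by eventually_elim (auto simp: g_def)
  qed
  have "AE x in lborel. \<forall>N::nat. x \<in> box (- real N *\<^sub>R One) (real N *\<^sub>R One) \<longrightarrow> f x = 0"
    by (intro AE_all_countable[THEN iffD2] allI on_box)
  then show ?thesis
  proof eventually_elim
    case (elim x)
    have "x \<in> (\<Union>i::nat. box (- (real i *\<^sub>R One)) (real i *\<^sub>R One))"
      using UN_box_eq_UNIV by blast
    with elim show ?case by auto
  qed
qed

section \<open>Gradients along lines\<close>

text \<open>Absolute continuity in integrated form. The unit interval suffices because
  \<open>line_gradient\<close> ranges over vectors \<open>h\<close> of every length.\<close>

definition ac_deriv :: "(real \<Rightarrow> real) \<Rightarrow> (real \<Rightarrow> real) \<Rightarrow> bool" where
  "ac_deriv f a \<longleftrightarrow> set_integrable lborel {0..1} a \<and>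
     (\<forall>s\<in>{0..1}. f s - f 0 = (LINT t:{0..s}|lborel. a t))"

lemma ac_derivD:
  assumes "ac_deriv f a" "0 \<le> \<alpha>" "\<alpha> \<le> \<beta>" "\<beta> \<le> 1"
  shows "f \<beta> - f \<alpha> = (LINT t:{\<alpha><..\<beta>}|lborel. a t)"
proof -
  have int: "set_integrable lborel A a" if "A \<subseteq> {0..1}" "A \<in> sets lborel" for A
    using assms(1) that by (auto simp: ac_deriv_def intro: set_integrable_subset)
  have "(LINT t:{0..\<alpha>} \<union> {\<alpha><..\<beta>}|lborel. a t) =
      (LINT t:{0..\<alpha>}|lborel. a t) + (LINT t:{\<alpha><..\<beta>}|lborel. a t)"
    using assms by (intro set_integral_Un int) auto
  moreover have "{0..\<alpha>} \<union> {\<alpha><..\<beta>} = {0..\<beta>}" using assms by auto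
  moreover have "f \<alpha> - f 0 = (LINT t:{0..\<alpha>}|lborel. a t)" "f \<beta> - f 0 = (LINT t:{0..\<beta>}|lborel. a t)"
    using assms by (auto simp: ac_deriv_def)
  ultimately show ?thesis by simp
qed

lemma ac_deriv_add:
  assumes "ac_deriv f a" "ac_deriv g b"
  shows "ac_deriv (\<lambda>s. f s + g s) (\<lambda>s. a s + b s)"
proof -
  have int: "set_integrable lborel {0..s} a" "set_integrable lborel {0..s} b" if "s \<in> {0..1}" for s
    using assms that by (auto simp: ac_deriv_def intro: set_integrable_subset[of _ "{0..1}"])
  show ?thesis using assms
    by (auto simp: ac_deriv_def set_integral_add(2)[OF int] intro: set_integral_add(1))
      (metis add_diff_add atLeastAtMost_iff)
qed

lemma ac_deriv_scale:
  assumes "ac_deriv f a" shows "ac_deriv (\<lambda>s. c * f s) (\<lambda>s. c * a s)"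
  using assms by (auto simp: ac_deriv_def set_integral_mult_right right_diff_distrib[symmetric])

lemma bounded_scaleR_set_integrable:
  fixes a :: "'a \<Rightarrow> 'b::{banach, second_countable_topology}"
  assumes "set_integrable M A a" "b \<in> borel_measurable M" "\<And>t. t \<in> A \<Longrightarrow> \<bar>b t\<bar> \<le> B"
  shows "set_integrable M A (\<lambda>t. b t *\<^sub>R a t)"
  unfolding set_integrable_def
proof (rule Bochner_Integration.integrable_bound[where f = "\<lambda>t. B * norm (indicator A t *\<^sub>R a t)"])
  show "integrable M (\<lambda>t. B * norm (indicat_real A t *\<^sub>R a t))"
    using assms(1) unfolding set_integrable_def by (intro integrable_mult_right integrable_norm)
  have "(\<lambda>x. indicat_real A x *\<^sub>R a x) \<in> borel_measurable M"
    using assms(1) unfolding set_integrable_def by (rule borel_measurable_integrable)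
  then have "(\<lambda>x. b x *\<^sub>R (indicat_real A x *\<^sub>R a x)) \<in> borel_measurable M"
    by (rule borel_measurable_scaleR[OF assms(2)])
  moreover have "(\<lambda>x. b x *\<^sub>R (indicat_real A x *\<^sub>R a x)) = (\<lambda>x. indicat_real A x *\<^sub>R b x *\<^sub>R a x)"
    by (simp add: fun_eq_iff mult_ac)
  ultimately show "(\<lambda>x. indicat_real A x *\<^sub>R b x *\<^sub>R a x) \<in> borel_measurable M"
    by (simp only:)
  show "AE x in M. norm (indicat_real A x *\<^sub>R (b x *\<^sub>R a x)) \<le> norm (B * norm (indicat_real A x *\<^sub>R a x))"
  proof (intro always_eventually allI)
    fix x show "norm (indicat_real A x *\<^sub>R (b x *\<^sub>R a x)) \<le> norm (B * norm (indicat_real A x *\<^sub>R a x))"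
      using assms(3)[of x]
      by (cases "x \<in> A") (auto simp: abs_mult intro!: mult_right_mono)
  qed
qed

text \<open>The defect of the chain rule over \<open>[\<alpha>, \<beta>]\<close> is at most \<open>\<epsilon>\<close> times the integral of \<open>\<bar>a\<bar>\<close> if the
  interval is short, and both sides are additive in the interval.\<close>

lemma ac_deriv_chain:
  assumes f: "ac_deriv f a" and cf: "continuous_on UNIV f"
    and F: "\<And>y. (F has_real_derivative F' y) (at y)" and cF': "continuous_on UNIV F'"
  shows "ac_deriv (\<lambda>s. F (f s)) (\<lambda>s. F' (f s) * a s)"
proof -
  have cF'f: "continuous_on UNIV (\<lambda>s. F' (f s))"
    using cF' cf by (rule continuous_on_compose2) auto
  have int: "set_integrable lborel A a" if "A \<subseteq> {0..1}" "A \<in> sets lborel" for A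
    using f that by (auto simp: ac_deriv_def intro: set_integrable_subset)
  have "compact ((\<lambda>s. F' (f s)) ` {0..1})"
    by (intro compact_continuous_image continuous_on_subset[OF cF'f]) auto
  then obtain B where B: "\<And>s. s \<in> {0..1} \<Longrightarrow> \<bar>F' (f s)\<bar> \<le> B"
    using compact_imp_bounded bounded_iff by (metis image_eqI real_norm_def)
  have int': "set_integrable lborel A (\<lambda>s. F' (f s) * a s)" if "A \<subseteq> {0..1}" "A \<in> sets lborel" for A
  proof -
    have "set_integrable lborel A (\<lambda>s. F' (f s) *\<^sub>R a s)"
    proof (rule bounded_scaleR_set_integrable[OF int[OF that]])
      show "(\<lambda>s. F' (f s)) \<in> borel_measurable lborel" using borel_measurable_continuous_onI[OF cF'f] by simp
      show "\<bar>F' (f s)\<bar> \<le> B" if "s \<in> A" for s using B that \<open>A \<subseteq> {0..1}\<close> by blast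
    qed
    then show ?thesis by simp
  qed
  define defect where
    "defect \<alpha> \<beta> = F (f \<beta>) - F (f \<alpha>) - (LINT t:{\<alpha><..\<beta>}|lborel. F' (f t) * a t)" for \<alpha> \<beta>
  define var where "var \<alpha> \<beta> = (LINT t:{\<alpha><..\<beta>}|lborel. \<bar>a t\<bar>)" for \<alpha> \<beta>
  have small: "\<bar>defect 0 s\<bar> \<le> \<epsilon> * var 0 s" if s: "s \<in> {0..1}" and "\<epsilon> > 0" for s \<epsilon>
  proof -
    \<comment> \<open>The form required by the bisection principle \<open>Bolzano\<close>: it is
      inherited from adjacent intervals and holds for all short intervals around each point.\<close>
    define P where "P \<alpha> \<beta> \<longleftrightarrow> (0 \<le> \<alpha> \<and> \<beta> \<le> s \<longrightarrow> \<bar>defect \<alpha> \<beta>\<bar> \<le> \<epsilon> * var \<alpha> \<beta>)" for \<alpha> \<beta>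
    have "0 \<le> s" using s by simp
    then have "P 0 s"
    proof (induction rule: Bolzano)
      case (trans \<alpha> \<beta> \<gamma>)
      show ?case unfolding P_def
      proof
        assume b: "0 \<le> \<alpha> \<and> \<gamma> \<le> s"
        have U: "{\<alpha><..\<beta>} \<union> {\<beta><..\<gamma>} = {\<alpha><..\<gamma>}" using trans by auto
        have "(LINT t:{\<alpha><..\<beta>} \<union> {\<beta><..\<gamma>}|lborel. F' (f t) * a t) =
            (LINT t:{\<alpha><..\<beta>}|lborel. F' (f t) * a t) + (LINT t:{\<beta><..\<gamma>}|lborel. F' (f t) * a t)"
          using b s trans by (intro set_integral_Un int') auto
        moreover have "(LINT t:{\<alpha><..\<beta>} \<union> {\<beta><..\<gamma>}|lborel. \<bar>a t\<bar>) =
            (LINT t:{\<alpha><..\<beta>}|lborel. \<bar>a t\<bar>) + (LINT t:{\<beta><..\<gamma>}|lborel. \<bar>a t\<bar>)"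
          using b s trans by (intro set_integral_Un set_integrable_abs int) auto
        ultimately have "defect \<alpha> \<gamma> = defect \<alpha> \<beta> + defect \<beta> \<gamma>" "var \<alpha> \<gamma> = var \<alpha> \<beta> + var \<beta> \<gamma>"
          by (simp_all add: defect_def var_def U)
        moreover have "\<bar>defect \<alpha> \<beta>\<bar> \<le> \<epsilon> * var \<alpha> \<beta>" "\<bar>defect \<beta> \<gamma>\<bar> \<le> \<epsilon> * var \<beta> \<gamma>"
          using trans b by (auto simp: P_def)
        ultimately show "\<bar>defect \<alpha> \<gamma>\<bar> \<le> \<epsilon> * var \<alpha> \<gamma>" by (simp add: distrib_left)
      qed
    next
      case (local x)
      have "isCont (\<lambda>s. F' (f s)) x"
        using cF'f by (simp add: continuous_on_eq_continuous_at)
      then obtain d0 where d0: "d0 > 0" "\<And>t. \<bar>t - x\<bar> < d0 \<Longrightarrow> \<bar>F' (f t) - F' (f x)\<bar> < \<epsilon> / 2"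
        using \<open>\<epsilon> > 0\<close> unfolding continuous_at_eps_delta dist_real_def by (metis half_gt_zero)
      have "\<bar>defect \<alpha> \<beta>\<bar> \<le> \<epsilon> * var \<alpha> \<beta>"
        if ab: "\<alpha> \<le> x" "x \<le> \<beta>" "\<beta> - \<alpha> < d0" "0 \<le> \<alpha>" "\<beta> \<le> s" for \<alpha> \<beta>
      proof -
        have ab01: "{\<alpha><..\<beta>} \<subseteq> {0..1}" using ab s by auto
        have near: "\<bar>F' (f t) - F' (f x)\<bar> < \<epsilon> / 2" if "t \<in> {\<alpha>..\<beta>}" for t
          using that ab by (intro d0) auto
        \<comment> \<open>The mean value theorem gives a point between \<open>f \<alpha>\<close> and
          \<open>f \<beta>\<close>; by the intermediate value theorem it is a value
          \<open>f \<xi>\<close> with \<open>\<xi>\<close> in the short interval, where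
          \<open>F' (f t)\<close> varies by at most \<open>\<epsilon>\<close>.\<close>
        obtain \<xi> where \<xi>: "\<xi> \<in> {\<alpha>..\<beta>}" "F (f \<beta>) - F (f \<alpha>) = F' (f \<xi>) * (f \<beta> - f \<alpha>)"
        proof -
          obtain z where z: "z \<in> closed_segment (f \<alpha>) (f \<beta>)" "F (f \<beta>) - F (f \<alpha>) = F' z * (f \<beta> - f \<alpha>)"
          proof (cases "f \<alpha>" "f \<beta>" rule: linorder_cases)
            case less
            obtain z where "f \<alpha> < z" "z < f \<beta>" "F (f \<beta>) - F (f \<alpha>) = (f \<beta> - f \<alpha>) * F' z"
              using MVT2[OF less, of F F'] F by blast
            then show thesis by (intro that[of z]) (auto simp: closed_segment_eq_real_ivl mult.commute)
          next
            case greater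
            obtain z where "f \<beta> < z" "z < f \<alpha>" "F (f \<alpha>) - F (f \<beta>) = (f \<alpha> - f \<beta>) * F' z"
              using MVT2[OF greater, of F F'] F by blast
            then show thesis
              by (intro that[of z]) (auto simp: closed_segment_eq_real_ivl algebra_simps)
          qed (auto intro: that[of "f \<alpha>"])
          have "connected (f ` {\<alpha>..\<beta>})"
            by (intro connected_continuous_image continuous_on_subset[OF cf]) auto
          then have "closed_segment (f \<alpha>) (f \<beta>) \<subseteq> f ` {\<alpha>..\<beta>}"
            using ab by (intro closed_segment_subset) (auto simp: connected_convex_1)
          with z that show thesis by blast
        qed
        have "defect \<alpha> \<beta> = (LINT t:{\<alpha><..\<beta>}|lborel. F' (f \<xi>) * a t) - (LINT t:{\<alpha><..\<beta>}|lborel. F' (f t) * a t)"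
          unfolding defect_def \<xi>(2) using ab s ac_derivD[OF f, of \<alpha> \<beta>] by (simp add: set_integral_mult_right)
        also have "\<dots> = (LINT t:{\<alpha><..\<beta>}|lborel. F' (f \<xi>) * a t - F' (f t) * a t)"
          using ab01 by (intro set_integral_diff(2)[symmetric] set_integrable_mult_right int int') auto
        finally have "\<bar>defect \<alpha> \<beta>\<bar> \<le> (LINT t:{\<alpha><..\<beta>}|lborel. \<bar>F' (f \<xi>) * a t - F' (f t) * a t\<bar>)"
          using set_integral_norm_bound[of lborel "{\<alpha><..\<beta>}" "\<lambda>t. F' (f \<xi>) * a t - F' (f t) * a t"] ab01
          by (simp add: set_integral_diff(1) set_integrable_mult_right int int')
        also have "\<dots> \<le> (LINT t:{\<alpha><..\<beta>}|lborel. \<epsilon> * \<bar>a t\<bar>)"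
        proof (rule set_integral_mono)
          show "set_integrable lborel {\<alpha><..\<beta>} (\<lambda>t. \<bar>F' (f \<xi>) * a t - F' (f t) * a t\<bar>)"
            "set_integrable lborel {\<alpha><..\<beta>} (\<lambda>t. \<epsilon> * \<bar>a t\<bar>)"
            using ab01 by (auto intro!: set_integrable_abs set_integral_diff(1) set_integrable_mult_right int int')
          fix t assume "t \<in> {\<alpha><..\<beta>}"
          then have "\<bar>F' (f t) - F' (f x)\<bar> < \<epsilon> / 2" "\<bar>F' (f \<xi>) - F' (f x)\<bar> < \<epsilon> / 2"
            using near[of t] near[of \<xi>] \<xi>(1) by auto
          then have "\<bar>F' (f \<xi>) - F' (f t)\<bar> \<le> \<epsilon>" by arith
          then show "\<bar>F' (f \<xi>) * a t - F' (f t) * a t\<bar> \<le> \<epsilon> * \<bar>a t\<bar>"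
            by (simp add: left_diff_distrib[symmetric] abs_mult mult_right_mono)
        qed
        finally show ?thesis by (simp add: var_def set_integral_mult_right)
      qed
      with d0(1) show ?case by (intro exI[of _ d0]) (auto simp: P_def)
    qed
    then show ?thesis by (simp add: P_def)
  qed
  have "defect 0 s = 0" if s: "s \<in> {0..1}" for s
  proof -
    have "var 0 s \<ge> 0" unfolding var_def set_lebesgue_integral_def by (intro integral_nonneg_AE) auto
    have "\<bar>defect 0 s\<bar> \<le> 0"
    proof (rule field_le_epsilon)
      fix e :: real assume "e > 0"
      then have "\<bar>defect 0 s\<bar> \<le> e / (var 0 s + 1) * var 0 s"
        using small[OF s, of "e / (var 0 s + 1)"] \<open>var 0 s \<ge> 0\<close> by simp
      also have "\<dots> \<le> e"
        using \<open>e > 0\<close> \<open>var 0 s \<ge> 0\<close> by (simp add: divide_simps)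
      finally show "\<bar>defect 0 s\<bar> \<le> 0 + e" by simp
    qed
    then show ?thesis by simp
  qed
  \<comment> \<open>Half-open intervals made the defect additive, whereas \<open>ac_deriv\<close>
    uses closed ones; they differ by the null set {0}.\<close>
  moreover have "(LINT t:{0<..s}|lborel. g t) = (LINT t:{0..s}|lborel. g t)"
    if "set_integrable lborel {0..1} g" "s \<in> {0..1}" for g :: "real \<Rightarrow> real" and s
  proof (rule set_integral_cong_set)
    have "set_integrable lborel {0..s} g" "set_integrable lborel {0<..s} g"
      using that by (auto intro: set_integrable_subset)
    then show "set_borel_measurable lborel {0..s} g" "set_borel_measurable lborel {0<..s} g"
      by (auto simp: set_integrable_def set_borel_measurable_def)
    show "AE t in lborel. (t \<in> {0..s}) = (t \<in> {0<..s})"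
      using AE_lborel_singleton[of 0] by eventually_elim auto
  qed
  ultimately show ?thesis
    using int'[of "{0..1}"] by (simp add: ac_deriv_def defect_def)
qed

text \<open>Polarization, f g = ((f + g)^2 - f^2 - g^2) / 2, reduces the product rule to the chain
  rule for squares.\<close>

lemma ac_deriv_mult:
  assumes f: "ac_deriv f a" "continuous_on UNIV f" and g: "ac_deriv g b" "continuous_on UNIV g"
  shows "ac_deriv (\<lambda>s. f s * g s) (\<lambda>s. f s * b s + g s * a s)"
proof -
  have sq: "ac_deriv (\<lambda>s. (h s)\<^sup>2) (\<lambda>s. 2 * h s * c s)" if "ac_deriv h c" "continuous_on UNIV h" for h c
    by (rule ac_deriv_chain[OF that, of "\<lambda>y. y\<^sup>2" "\<lambda>y. 2 * y"])
      (auto intro!: derivative_eq_intros continuous_intros)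
  have "ac_deriv (\<lambda>s. 1/2 * (f s + g s)\<^sup>2 + (-1/2 * (f s)\<^sup>2 + -1/2 * (g s)\<^sup>2))
     (\<lambda>s. 1/2 * (2 * (f s + g s) * (a s + b s)) + (-1/2 * (2 * f s * a s) + -1/2 * (2 * g s * b s)))"
    using f g by (intro ac_deriv_add ac_deriv_scale sq continuous_on_add)
  moreover have "(\<lambda>s. 1/2 * (f s + g s)\<^sup>2 + (-1/2 * (f s)\<^sup>2 + -1/2 * (g s)\<^sup>2)) = (\<lambda>s. f s * g s)"
    "(\<lambda>s. 1/2 * (2 * (f s + g s) * (a s + b s)) + (-1/2 * (2 * f s * a s) + -1/2 * (2 * g s * b s))) =
      (\<lambda>s. f s * b s + g s * a s)"
    by (auto simp: fun_eq_iff algebra_simps power2_eq_square)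
  ultimately show ?thesis by simp
qed

section \<open>Invariance of Lebesgue measure under isometries\<close>

lemma distr_lborel_translate: "distr lborel borel (\<lambda>x :: 'a::euclidean_space. x + a) = lborel"
proof -
  have "(\<lambda>x. x + a) = (+) a" by (simp add: fun_eq_iff add.commute)
  then show ?thesis by (simp only: lborel_distr_plus)
qed

lemma integrable_translate:
  fixes g :: "'a::euclidean_space \<Rightarrow> 'b::{banach, second_countable_topology}"
  assumes "integrable lborel g" shows "integrable lborel (\<lambda>x. g (x + a))"
proof -
  have "integrable (distr lborel borel (\<lambda>x. x + a)) g" using assms by (simp add: distr_lborel_translate)
  then show ?thesis by (subst (asm) integrable_distr_eq) (use assms in auto)
qed

lemma integral_translate:
  fixes g :: "'a::euclidean_space \<Rightarrow> 'b::{banach, second_countable_topology}"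
  assumes "g \<in> borel_measurable borel" shows "(LINT x|lborel. g (x + a)) = (LINT x|lborel. g x)"
  using integral_distr[of "\<lambda>x. x + a" lborel borel g] assms by (simp add: distr_lborel_translate)

lemma nn_integral_translate:
  fixes g :: "'a::euclidean_space \<Rightarrow> ennreal"
  assumes "g \<in> borel_measurable borel" shows "(\<integral>\<^sup>+x. g (x + a) \<partial>lborel) = (\<integral>\<^sup>+x. g x \<partial>lborel)"
  using nn_integral_distr[of "\<lambda>x. x + a" lborel borel g] assms by (simp add: distr_lborel_translate)

text \<open>Uniqueness of Haar measure: both sides are translation invariant, and they agree on the
  unit ball.\<close>

lemma distr_lborel_orthogonal:
  fixes f :: "'a::euclidean_space \<Rightarrow> 'a"
  assumes f: "orthogonal_transformation f"
  shows "distr lborel borel f = lborel"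
proof (rule measure_eqI)
  have lin: "linear f" using f by (rule orthogonal_transformation_linear)
  have fm [measurable]: "f \<in> borel \<rightarrow>\<^sub>M borel"
    by (intro borel_measurable_continuous_onI linear_continuous_on) (simp add: lin linear_conv_bounded_linear[symmetric])
  fix A assume "A \<in> sets (distr lborel borel f)"
  then have A [measurable]: "A \<in> sets borel" by simp
  define h :: "'a \<Rightarrow> ennreal" where "h = indicator (ball 0 1)"
  have h [measurable]: "h \<in> borel_measurable borel" unfolding h_def by (intro borel_measurable_indicator) simp
  define \<omega> where "\<omega> = emeasure lborel (ball (0::'a) 1)"
  have "\<omega> \<noteq> 0" "\<omega> \<noteq> \<infinity>"
    using content_ball_pos[of 1 "0::'a"] emeasure_lborel_ball_finite[of "0::'a" 1]
    by (auto simp: \<omega>_def measure_def)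
  have ball: "emeasure lborel (ball (c::'a) 1) = \<omega>" for c
    using emeasure_ball[of 1 c] emeasure_ball[of 1 "0::'a"] by (simp add: \<omega>_def)
  have shift: "(\<integral>\<^sup>+x. indicator A (f x + y) \<partial>lborel) = emeasure (distr lborel borel f) A" for y
  proof -
    obtain y' where y': "y = f y'" using orthogonal_transformation_surj[OF f] by (metis surjD)
    have "(\<integral>\<^sup>+x. indicator A (f x + y) \<partial>lborel) = (\<integral>\<^sup>+x. indicator A (f (x + y')) \<partial>lborel)"
      by (simp add: y' linear_add[OF lin])
    also have "\<dots> = (\<integral>\<^sup>+x. indicator A (f x) \<partial>lborel)"
      by (rule nn_integral_translate) simp
    also have "\<dots> = (\<integral>\<^sup>+x. indicator A x \<partial>distr lborel borel f)"
      by (subst nn_integral_distr) auto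
    also have "\<dots> = emeasure (distr lborel borel f) A"
      by (rule nn_integral_indicator) simp
    finally show ?thesis .
  qed
  have inner: "(\<integral>\<^sup>+x. h (y - f x) \<partial>lborel) = \<omega>" for y
  proof -
    obtain y' where y': "y = f y'" using orthogonal_transformation_surj[OF f] by (metis surjD)
    have "h (y - f x) = indicator (ball y' 1) x" for x
      using orthogonal_transformation_norm[OF f, of "y' - x"] norm_minus_commute[of "f x" "f y'"]
      by (auto simp: h_def indicator_def dist_norm y' linear_diff[OF lin])
    then show ?thesis using ball[of y'] by simp
  qed
  \<comment> \<open>A double integral is evaluated twice. Integrating over \<open>x\<close> first
    gives the image measure by \<open>shift\<close>; translating in \<open>y\<close> by
    \<open>f x\<close> and then integrating over \<open>x\<close> first gives Lebesgue measure by
    \<open>inner\<close>.\<close>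
  have "emeasure (distr lborel borel f) A * \<omega> =
      (\<integral>\<^sup>+y. (\<integral>\<^sup>+x. indicator A (f x + y) * h y \<partial>lborel) \<partial>lborel)"
    by (simp add: nn_integral_multc nn_integral_cmult shift) (simp add: h_def \<omega>_def)
  also have "\<dots> = (\<integral>\<^sup>+x. (\<integral>\<^sup>+y. indicator A (f x + y) * h y \<partial>lborel) \<partial>lborel)"
    by (rule lborel_pair.Fubini') measurable
  also have "\<dots> = (\<integral>\<^sup>+x. (\<integral>\<^sup>+y. indicator A y * h (y - f x) \<partial>lborel) \<partial>lborel)"
  proof (rule nn_integral_cong)
    fix x
    show "(\<integral>\<^sup>+y. indicator A (f x + y) * h y \<partial>lborel) = (\<integral>\<^sup>+y. indicator A y * h (y - f x) \<partial>lborel)"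
      using nn_integral_translate[of "\<lambda>y. indicator A y * h (y - f x)" "f x"] by (simp add: add.commute)
  qed
  also have "\<dots> = (\<integral>\<^sup>+y. (\<integral>\<^sup>+x. indicator A y * h (y - f x) \<partial>lborel) \<partial>lborel)"
    by (rule lborel_pair.Fubini') measurable
  also have "\<dots> = emeasure lborel A * \<omega>"
    by (simp add: nn_integral_cmult inner nn_integral_multc)
  finally show "emeasure (distr lborel borel f) A = emeasure lborel A"
    using \<open>\<omega> \<noteq> 0\<close> \<open>\<omega> \<noteq> \<infinity>\<close> by (auto simp: ennreal_mult_cancel_left mult.commute[of _ \<omega>])
qed simp

lemma distr_lborel_isometry:
  fixes f :: "'a::euclidean_space \<Rightarrow> 'a"
  assumes f: "orthogonal_transformation f"
  shows "distr lborel borel (\<lambda>x. f x + z) = lborel"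
proof -
  have "linear f" using f by (rule orthogonal_transformation_linear)
  then have [measurable]: "f \<in> borel \<rightarrow>\<^sub>M borel"
    using borel_measurable_continuous_onI linear_continuous_on linear_conv_bounded_linear by blast
  show ?thesis
    using distr_distr[of "\<lambda>x. x + z" borel borel f lborel, symmetric]
    by (simp add: distr_lborel_orthogonal[OF f] distr_lborel_translate comp_def)
qed

section \<open>Integration along lines and the calculus of line gradients\<close>

lemma integrable_along_lines:
  fixes g :: "'a::euclidean_space \<Rightarrow> real"
  assumes g: "integrable lborel g" and "0 \<le> t"
  shows "integrable (lborel \<Otimes>\<^sub>M lborel) (\<lambda>(s, x). indicator {0..t} s * g (x + s *\<^sub>R h))"
proof (rule lborel_pair.Fubini_integrable)
  have [measurable]: "g \<in> borel_measurable borel" using g by auto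
  show "(\<lambda>(s, x). indicator {0..t} s * g (x + s *\<^sub>R h)) \<in> borel_measurable (lborel \<Otimes>\<^sub>M lborel)"
    by measurable
  have "(LINT x|lborel. \<bar>g (x + s *\<^sub>R h)\<bar>) = (LINT x|lborel. \<bar>g x\<bar>)" for s
    by (rule integral_translate) simp
  then have "(\<lambda>s. LINT x|lborel. norm (case (s, x) of (s, x) \<Rightarrow> indicator {0..t} s * g (x + s *\<^sub>R h))) =
      (\<lambda>s. indicator {0..t} s * (LINT x|lborel. \<bar>g x\<bar>))"
    by (auto simp: fun_eq_iff abs_mult)
  then show "integrable lborel (\<lambda>s. LINT x|lborel. norm (case (s, x) of (s, x) \<Rightarrow> indicator {0..t} s * g (x + s *\<^sub>R h)))"
    by (auto intro!: integrable_mult_left integrable_real_indicator simp: assms)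
  show "AE s in lborel. integrable lborel (\<lambda>x. case (s, x) of (s, x) \<Rightarrow> indicator {0..t} s * g (x + s *\<^sub>R h))"
    using integrable_translate[OF g] by simp
qed

lemma integral_along_lines:
  fixes g :: "'a::euclidean_space \<Rightarrow> real"
  assumes g: "integrable lborel g" and "0 \<le> t"
  shows "(LINT x|lborel. (LINT s:{0..t}|lborel. g (x + s *\<^sub>R h))) = t * (LINT x|lborel. g x)"
    and "AE x in lborel. set_integrable lborel {0..t} (\<lambda>s. g (x + s *\<^sub>R h))"
    and "integrable lborel (\<lambda>x. LINT s:{0..t}|lborel. g (x + s *\<^sub>R h))"
proof -
  note int = integrable_along_lines[OF assms, of h]
  have [measurable]: "g \<in> borel_measurable borel" using g by auto
  show "AE x in lborel. set_integrable lborel {0..t} (\<lambda>s. g (x + s *\<^sub>R h))"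
    using lborel_pair.AE_integrable_snd[OF int] by (simp add: set_integrable_def)
  show "integrable lborel (\<lambda>x. LINT s:{0..t}|lborel. g (x + s *\<^sub>R h))"
    using lborel_pair.integrable_snd[OF int] by (simp add: set_lebesgue_integral_def)
  have "(LINT x|lborel. (LINT s:{0..t}|lborel. g (x + s *\<^sub>R h))) =
      (LINT s|lborel. (LINT x|lborel. indicator {0..t} s * g (x + s *\<^sub>R h)))"
    using lborel_pair.integral_snd[OF int] lborel_pair.integral_fst[OF int]
    by (simp add: set_lebesgue_integral_def)
  also have "\<dots> = (LINT s|lborel. indicator {0..t} s * (LINT x|lborel. g x))"
    using integral_translate[of g] by simp
  also have "\<dots> = t * (LINT x|lborel. g x)" using \<open>0 \<le> t\<close> by simp
  finally show "(LINT x|lborel. (LINT s:{0..t}|lborel. g (x + s *\<^sub>R h))) = t * (LINT x|lborel. g x)" .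
qed

text \<open>The exceptional set consists of base points in the whole space, so Fubini's theorem
  applies without choosing cross sections, and it may depend on \<open>h\<close>. Admitting every
  vector \<open>h\<close>, not only coordinate directions, makes the notion invariant under
  isometries.\<close>

definition line_gradient :: "('a::euclidean_space \<Rightarrow> real) \<Rightarrow> ('a \<Rightarrow> 'a) \<Rightarrow> bool" where
  "line_gradient u G \<longleftrightarrow> continuous_on UNIV u \<and> G \<in> borel_measurable borel \<and>
     (\<forall>R. set_integrable lborel (cball 0 R) G) \<and>
     (\<forall>h. AE x in lborel. ac_deriv (\<lambda>s. u (x + s *\<^sub>R h)) (\<lambda>s. G (x + s *\<^sub>R h) \<bullet> h))"

lemma line_gradientD:
  assumes "line_gradient u G"
  shows "continuous_on UNIV u" "G \<in> borel_measurable borel" "set_integrable lborel (cball 0 R) G"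
    "AE x in lborel. ac_deriv (\<lambda>s. u (x + s *\<^sub>R h)) (\<lambda>s. G (x + s *\<^sub>R h) \<bullet> h)"
  using assms by (auto simp: line_gradient_def)

lemma continuous_on_line:
  fixes u :: "'a::real_normed_vector \<Rightarrow> 'b::topological_space"
  shows "continuous_on UNIV u \<Longrightarrow> continuous_on UNIV (\<lambda>s. u (x + s *\<^sub>R h))"
proof -
  assume u: "continuous_on UNIV u"
  have "continuous_on UNIV (\<lambda>s. x + s *\<^sub>R h)" by (intro continuous_intros)
  then show ?thesis by (rule continuous_on_compose2[OF u]) simp
qed

lemma continuous_scaleR_set_integrable_cball:
  fixes G :: "'a::euclidean_space \<Rightarrow> 'b::{banach, second_countable_topology}"
  assumes "set_integrable lborel (cball 0 R) G" "continuous_on UNIV b"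
  shows "set_integrable lborel (cball 0 R) (\<lambda>x. b x *\<^sub>R G x)"
proof -
  have "compact (b ` cball 0 R)"
    by (intro compact_continuous_image continuous_on_subset[OF assms(2)]) auto
  then have "bounded (b ` cball 0 R)" by (rule compact_imp_bounded)
  then obtain B where "\<forall>y\<in>b ` cball 0 R. norm y \<le> B"
    by (auto simp only: bounded_iff)
  then have "\<And>x. x \<in> cball 0 R \<Longrightarrow> \<bar>b x\<bar> \<le> B" by auto
  then show ?thesis
    using assms by (intro bounded_scaleR_set_integrable) (auto intro: borel_measurable_continuous_onI)
qed

lemma line_gradient_add:
  assumes "line_gradient u G" "line_gradient w H"
  shows "line_gradient (\<lambda>x. u x + w x) (\<lambda>x. G x + H x)"
  unfolding line_gradient_def
proof (intro conjI allI)
  fix h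
  show "AE x in lborel. ac_deriv (\<lambda>s. u (x + s *\<^sub>R h) + w (x + s *\<^sub>R h))
      (\<lambda>s. (G (x + s *\<^sub>R h) + H (x + s *\<^sub>R h)) \<bullet> h)"
    using line_gradientD(4)[OF assms(1), of h] line_gradientD(4)[OF assms(2), of h]
    by eventually_elim (auto dest: ac_deriv_add simp: inner_add_left)
qed (use line_gradientD[OF assms(1)] line_gradientD[OF assms(2)] in \<open>auto intro: continuous_on_add\<close>)

lemma line_gradient_chain:
  assumes "line_gradient u G" "\<And>y. (F has_real_derivative F' y) (at y)" "continuous_on UNIV F'"
  shows "line_gradient (\<lambda>x. F (u x)) (\<lambda>x. F' (u x) *\<^sub>R G x)"
  unfolding line_gradient_def
proof (intro conjI allI)
  note u = line_gradientD[OF assms(1)]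
  have cF: "continuous_on UNIV F"
    using assms(2) by (auto intro!: continuous_at_imp_continuous_on DERIV_isCont)
  have cF'u: "continuous_on UNIV (\<lambda>x. F' (u x))" "continuous_on UNIV (\<lambda>x. F (u x))"
    using assms(3) cF u(1) by (auto intro: continuous_on_compose2)
  then show "continuous_on UNIV (\<lambda>x. F (u x))" by simp
  show "(\<lambda>x. F' (u x) *\<^sub>R G x) \<in> borel_measurable borel"
    using borel_measurable_continuous_onI[OF cF'u(1)] u(2) by (rule borel_measurable_scaleR)
  show "set_integrable lborel (cball 0 R) (\<lambda>x. F' (u x) *\<^sub>R G x)" for R
    using u cF'u by (intro continuous_scaleR_set_integrable_cball) auto
  show "AE x in lborel. ac_deriv (\<lambda>s. F (u (x + s *\<^sub>R h)))
      (\<lambda>s. F' (u (x + s *\<^sub>R h)) *\<^sub>R G (x + s *\<^sub>R h) \<bullet> h)" for h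
    using u(4)[of h]
  proof eventually_elim
    case (elim x)
    show ?case
      using ac_deriv_chain[OF elim continuous_on_line[OF u(1)] assms(2,3)] by simp
  qed
qed

lemma line_gradient_scale:
  "line_gradient u G \<Longrightarrow> line_gradient (\<lambda>x. c * u x) (\<lambda>x. c *\<^sub>R G x)"
  by (rule line_gradient_chain[of u G "\<lambda>y. c * y" "\<lambda>_. c"]) (auto intro!: derivative_eq_intros)

lemma line_gradient_mult:
  assumes "line_gradient u G" "line_gradient w H"
  shows "line_gradient (\<lambda>x. u x * w x) (\<lambda>x. u x *\<^sub>R H x + w x *\<^sub>R G x)"
  unfolding line_gradient_def
proof (intro conjI allI)
  note u = line_gradientD[OF assms(1)] and w = line_gradientD[OF assms(2)]
  show "continuous_on UNIV (\<lambda>x. u x * w x)" using u w by (intro continuous_on_mult)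
  show "(\<lambda>x. u x *\<^sub>R H x + w x *\<^sub>R G x) \<in> borel_measurable borel"
    by (intro borel_measurable_add borel_measurable_scaleR u(2) w(2)
        borel_measurable_continuous_onI[OF u(1)] borel_measurable_continuous_onI[OF w(1)])
  show "set_integrable lborel (cball 0 R) (\<lambda>x. u x *\<^sub>R H x + w x *\<^sub>R G x)" for R
    using u w by (intro set_integral_add continuous_scaleR_set_integrable_cball) auto
  show "AE x in lborel. ac_deriv (\<lambda>s. u (x + s *\<^sub>R h) * w (x + s *\<^sub>R h))
      (\<lambda>s. (u (x + s *\<^sub>R h) *\<^sub>R H (x + s *\<^sub>R h) + w (x + s *\<^sub>R h) *\<^sub>R G (x + s *\<^sub>R h)) \<bullet> h)" for h
    using u(4)[of h] w(4)[of h]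
  proof eventually_elim
    case (elim x)
    show ?case
      using ac_deriv_mult[OF elim(1) continuous_on_line[OF u(1)] elim(2) continuous_on_line[OF w(1)]]
      by (simp add: inner_add_left)
  qed
qed

lemma line_gradient_C1:
  assumes u: "\<And>x. (u has_derivative (\<lambda>h. G x \<bullet> h)) (at x)" and G: "continuous_on UNIV G"
  shows "line_gradient u G"
  unfolding line_gradient_def
proof (intro conjI allI)
  show "continuous_on UNIV u"
    using u by (auto intro!: continuous_at_imp_continuous_on has_derivative_continuous)
  show "G \<in> borel_measurable borel" using G by (rule borel_measurable_continuous_onI)
  show "set_integrable lborel (cball 0 R) G" for R
    unfolding set_integrable_def
    by (intro borel_integrable_compact continuous_on_subset[OF G]) auto
  show "AE x in lborel. ac_deriv (\<lambda>s. u (x + s *\<^sub>R h)) (\<lambda>s. G (x + s *\<^sub>R h) \<bullet> h)" for h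
  proof (intro always_eventually allI)
    fix x
    have c: "continuous_on UNIV (\<lambda>s. G (x + s *\<^sub>R h) \<bullet> h)"
      by (intro continuous_intros continuous_on_compose2[OF G]) auto
    have der: "((\<lambda>s. u (x + s *\<^sub>R h)) has_real_derivative G (x + s *\<^sub>R h) \<bullet> h) (at s)" for s
    proof -
      have "((\<lambda>s. x + s *\<^sub>R h) has_derivative (\<lambda>r. r *\<^sub>R h)) (at s)"
        by (auto intro!: derivative_eq_intros)
      from has_derivative_compose[OF this u] show ?thesis
        by (simp add: has_field_derivative_def mult_commute_abs)
    qed
    have "u (x + s *\<^sub>R h) - u (x + 0 *\<^sub>R h) = (LINT t:{0..s}|lborel. G (x + t *\<^sub>R h) \<bullet> h)" if "s \<in> {0..1}" for s
      unfolding set_lebesgue_integral_def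
      using that integral_FTC_Icc_real[of 0 s "\<lambda>s. u (x + s *\<^sub>R h)" "\<lambda>s. G (x + s *\<^sub>R h) \<bullet> h"] der
        continuous_on_eq_continuous_at[THEN iffD1, OF open_UNIV c]
      by (simp add: mult.commute)
    moreover have "set_integrable lborel {0..1} (\<lambda>s. G (x + s *\<^sub>R h) \<bullet> h)"
      unfolding set_integrable_def by (intro borel_integrable_compact continuous_on_subset[OF c]) auto
    ultimately show "ac_deriv (\<lambda>s. u (x + s *\<^sub>R h)) (\<lambda>s. G (x + s *\<^sub>R h) \<bullet> h)"
      by (simp add: ac_deriv_def)
  qed
qed

text \<open>An isometry carries the line from \<open>x\<close> in direction \<open>h\<close> to the
  line from \<open>f x + z\<close> in direction \<open>f h\<close>, and it preserves Lebesgue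
  measure, so exceptional null sets pull back to null sets. Moving \<open>f\<close> across the inner
  product produces the adjoint.\<close>

lemma line_gradient_isometry:
  fixes u :: "'a::euclidean_space \<Rightarrow> real" and f :: "'a \<Rightarrow> 'a"
  assumes u: "line_gradient u G" and f: "orthogonal_transformation f"
  shows "line_gradient (\<lambda>x. u (f x + z)) (\<lambda>x. adjoint f (G (f x + z)))"
proof -
  note u' = line_gradientD[OF u]
  have lin: "linear f" using f by (rule orthogonal_transformation_linear)
  have adj: "adjoint f w \<bullet> h = w \<bullet> f h" for w h
    using adjoint_works[OF lin, of h w] by (simp add: inner_commute)
  have linadj: "linear (adjoint f)" using lin by (rule adjoint_linear)
  have cont: "continuous_on UNIV (\<lambda>x. f x + z)"
    by (intro continuous_intros linear_continuous_on) (simp add: lin linear_conv_bounded_linear[symmetric])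
  then have m [measurable]: "(\<lambda>x. f x + z) \<in> borel \<rightarrow>\<^sub>M borel" by (rule borel_measurable_continuous_onI)
  note distr = distr_lborel_isometry[OF f, of z]
  have madj [measurable]: "adjoint f \<in> borel \<rightarrow>\<^sub>M borel"
    using borel_measurable_continuous_onI linear_continuous_on linadj linear_conv_bounded_linear by blast
  show ?thesis
    unfolding line_gradient_def
  proof (intro conjI allI)
    show "continuous_on UNIV (\<lambda>x. u (f x + z))" using u'(1) cont by (rule continuous_on_compose2) auto
    show "(\<lambda>x. adjoint f (G (f x + z))) \<in> borel_measurable borel" using u'(2) by measurable
    fix R
    have "integrable (distr lborel borel (\<lambda>x. f x + z)) (\<lambda>x. indicator (cball 0 (R + norm z)) x *\<^sub>R G x)"
      using u'(3)[of "R + norm z"] by (simp add: distr set_integrable_def)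
    then have "integrable lborel (\<lambda>x. indicator (cball 0 (R + norm z)) (f x + z) *\<^sub>R G (f x + z))"
      by (subst (asm) integrable_distr_eq)
        (auto intro!: borel_measurable_scaleR borel_measurable_indicator u'(2))
    then have "set_integrable lborel ((\<lambda>x. f x + z) -` cball 0 (R + norm z)) (\<lambda>x. G (f x + z))"
      by (simp add: set_integrable_def indicator_vimage[symmetric] comp_def indicator_def)
    then have "set_integrable lborel (cball 0 R) (\<lambda>x. G (f x + z))"
    proof (rule set_integrable_subset)
      show "cball 0 R \<subseteq> (\<lambda>x. f x + z) -` cball 0 (R + norm z)"
      proof
        fix x :: 'a assume "x \<in> cball 0 R"
        then show "x \<in> (\<lambda>x. f x + z) -` cball 0 (R + norm z)"
          using orthogonal_transformation_norm[OF f, of x] norm_triangle_ineq[of "f x" z] by auto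
      qed
    qed simp
    then have "integrable lborel (\<lambda>x. adjoint f (indicator (cball 0 R) x *\<^sub>R G (f x + z)))"
      unfolding set_integrable_def
      using linadj linear_conv_bounded_linear integrable_bounded_linear by blast
    then show "set_integrable lborel (cball 0 R) (\<lambda>x. adjoint f (G (f x + z)))"
      by (simp add: set_integrable_def linear_scale[OF linadj])
    fix h
    have "AE y in distr lborel borel (\<lambda>x. f x + z). ac_deriv (\<lambda>s. u (y + s *\<^sub>R f h)) (\<lambda>s. G (y + s *\<^sub>R f h) \<bullet> f h)"
      using u'(4)[of "f h"] unfolding distr .
    then have "AE x in lborel. ac_deriv (\<lambda>s. u (f x + z + s *\<^sub>R f h)) (\<lambda>s. G (f x + z + s *\<^sub>R f h) \<bullet> f h)"
      by (rule AE_distrD[rotated]) simp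
    then show "AE x in lborel. ac_deriv (\<lambda>s. u (f (x + s *\<^sub>R h) + z))
        (\<lambda>s. adjoint f (G (f (x + s *\<^sub>R h) + z)) \<bullet> h)"
      by (simp add: adj linear_add[OF lin] linear_scale[OF lin] add_ac)
  qed
qed

section \<open>Morrey's inequality\<close>

text \<open>Points of \<open>S\<close> violating the bound form an open set, and a nonempty open set
  is not null. In this way the averaged estimates below become pointwise.\<close>

lemma AE_imp_all_le_on_open:
  fixes f :: "'a::euclidean_space \<Rightarrow> real"
  assumes "continuous_on UNIV f" "open S" "AE x in lborel. x \<in> S \<longrightarrow> f x \<le> K" "x \<in> S"
  shows "f x \<le> K"
proof (rule ccontr)
  assume "\<not> f x \<le> K"
  define A where "A = S \<inter> f -` {K<..}"
  have "open A" unfolding A_def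
    using assms(1,2) by (intro open_Int) (auto simp: open_vimage)
  have "x \<in> A" using assms(4) \<open>\<not> f x \<le> K\<close> by (auto simp: A_def)
  have "AE x in lborel. x \<notin> A"
    using assms(3) by eventually_elim (auto simp: A_def)
  then have "A \<in> null_sets lborel"
    using \<open>open A\<close> by (subst AE_iff_null_sets) auto
  then have "negligible A"
    by (simp add: negligible_iff_null_sets null_sets_completionI)
  then show False using open_not_negligible[OF \<open>open A\<close>] \<open>x \<in> A\<close> by blast
qed

lemma nn_integral_affine:
  fixes f :: "'a::euclidean_space \<Rightarrow> ennreal"
  assumes [measurable]: "f \<in> borel_measurable borel" and "s > 0"
  shows "(\<integral>\<^sup>+y. f (t + s *\<^sub>R y) \<partial>lborel) = ennreal (s powr - real DIM('a)) * (\<integral>\<^sup>+y. f y \<partial>lborel)"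
proof -
  have [measurable]: "(\<lambda>x. t + s *\<^sub>R x :: 'a) \<in> borel \<rightarrow>\<^sub>M borel"
    by (intro borel_measurable_continuous_onI continuous_intros)
  have "(\<integral>\<^sup>+y. f y \<partial>lborel) = ennreal (s ^ DIM('a)) * (\<integral>\<^sup>+y. f (t + s *\<^sub>R y) \<partial>lborel)"
    using \<open>s > 0\<close> by (subst lborel_affine[of s t]) (simp_all add: nn_integral_density nn_integral_distr nn_integral_cmult)
  moreover have "ennreal (s powr - real DIM('a)) * ennreal (s ^ DIM('a)) = 1"
    using \<open>s > 0\<close> by (simp add: ennreal_mult[symmetric] powr_minus powr_realpow)
  ultimately show ?thesis by (simp add: mult.assoc[symmetric])
qed

text \<open>For each \<open>h\<close> the bound holds at almost every \<open>x\<close>. Fubini's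
  theorem exchanges the two quantifiers, and for fixed \<open>x\<close> the translation h = y - x
  turns directions into end points.\<close>

lemma AE_line_difference_le:
  fixes u :: "'a::euclidean_space \<Rightarrow> real"
  assumes "line_gradient u G"
  shows "AE x in lborel. AE y in lborel. ennreal \<bar>u y - u x\<bar> \<le>
    (\<integral>\<^sup>+s. indicator {0..1} s * ennreal (norm (G (x + s *\<^sub>R (y - x))) * norm (y - x)) \<partial>lborel)"
proof -
  note u = line_gradientD[OF assms]
  have [measurable]: "u \<in> borel_measurable borel" using u(1) by (rule borel_measurable_continuous_onI)
  have [measurable]: "G \<in> borel_measurable borel" by (rule u(2))
  let ?I = "\<lambda>x h. (\<integral>\<^sup>+s. indicator {0..1::real} s * ennreal (norm (G (x + s *\<^sub>R h)) * norm h) \<partial>lborel)"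
  have "AE h in lborel. AE x in lborel. ennreal \<bar>u (x + h) - u x\<bar> \<le> ?I x h"
  proof (rule always_eventually, rule allI)
    fix h show "AE x in lborel. ennreal \<bar>u (x + h) - u x\<bar> \<le> ?I x h"
      using u(4)[of h]
    proof eventually_elim
      case (elim x)
      have eq: "u (x + h) - u x = (LINT s|lborel. indicator {0..1} s *\<^sub>R (G (x + s *\<^sub>R h) \<bullet> h))"
        using elim by (auto simp: ac_deriv_def set_lebesgue_integral_def dest!: bspec[of _ _ 1])
      have "ennreal \<bar>u (x + h) - u x\<bar> \<le> (\<integral>\<^sup>+s. norm (indicator {0..1} s *\<^sub>R (G (x + s *\<^sub>R h) \<bullet> h)) \<partial>lborel)"
        unfolding eq real_norm_def[symmetric]
        using elim by (intro integral_norm_bound_ennreal) (auto simp: ac_deriv_def set_integrable_def)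
      also have "\<dots> \<le> ?I x h"
        by (intro nn_integral_mono)
          (auto simp: indicator_def intro!: ennreal_leI Cauchy_Schwarz_ineq2)
      finally show ?case .
    qed
  qed
  then have "AE x in lborel. AE h in lborel. ennreal \<bar>u (x + h) - u x\<bar> \<le> ?I x h"
    by (subst (asm) lborel_pair.AE_commute) measurable
  then show ?thesis
  proof eventually_elim
    case (elim x)
    then have "AE h in distr lborel borel (\<lambda>y. y + - x). ennreal \<bar>u (x + h) - u x\<bar> \<le> ?I x h"
      unfolding distr_lborel_translate .
    then have "AE y in lborel. ennreal \<bar>u (x + (y + - x)) - u x\<bar> \<le> ?I x (y + - x)"
      by (rule AE_distrD[rotated]) simp
    then show ?case by simp
  qed
qed

text \<open>A pointwise substitute for Hoelder's inequality: if c^p bounds the mean of a^p,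
  integration gives a bound of twice c times the measure of the set.\<close>

lemma le_powr_plus:
  fixes a c p :: real assumes "a \<ge> 0" "c > 0" "p > 1"
  shows "a \<le> c powr (1 - p) * a powr p + c"
proof (cases "a \<le> c")
  case True
  then show ?thesis by (simp add: add_increasing)
next
  case False
  then have "a = a powr (1 - p) * a powr p"
    using assms by (simp add: powr_add[symmetric])
  also have "\<dots> \<le> c powr (1 - p) * a powr p"
    using assms False by (intro mult_right_mono powr_mono2') auto
  finally show ?thesis using assms by simp
qed

text \<open>Substituting \<open>z = x + s (y - x)\<close> in the inner integral costs a factor \<open>s powr - n / p\<close> by
  Hoelder's inequality, and this is integrable over \<open>[0, 1]\<close> since \<open>n < p\<close>.\<close>

lemma average_difference_le:
  fixes u :: "'a::euclidean_space \<Rightarrow> real"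
  assumes p: "real DIM('a) < p" and G [measurable]: "G \<in> borel_measurable borel" and "r > 0" "E > 0"
    and E: "(\<integral>\<^sup>+z. ennreal (norm (G z) powr p) * indicator (ball c r) z \<partial>lborel) \<le> ennreal E"
    and x: "x \<in> ball c r"
    and ae: "AE y in lborel. ennreal \<bar>u y - u x\<bar> \<le>
      (\<integral>\<^sup>+s. indicator {0..1} s * ennreal (norm (G (x + s *\<^sub>R (y - x))) * norm (y - x)) \<partial>lborel)"
  defines "b \<equiv> measure lborel (ball c r)"
  shows "(\<integral>\<^sup>+y. indicator (ball c r) y * ennreal \<bar>u y - u x\<bar> \<partial>lborel) \<le>
    ennreal (4 * r * b * (E / b) powr (1 / p) / (1 - real DIM('a) / p))"
proof -
  let ?n = "real DIM('a)" and ?B = "ball c r"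
  have n: "?n \<ge> 1" using DIM_positive[where 'a = 'a] by linarith
  have p1: "p > 1" using p n by linarith
  have b0: "b > 0" using \<open>r > 0\<close> by (simp add: b_def content_ball_pos)
  have eb: "emeasure lborel ?B = ennreal b"
    unfolding b_def using emeasure_lborel_ball_finite[of c r] by (intro emeasure_eq_ennreal_measure) auto
  have [measurable, simp]: "(indicator ?B :: 'a \<Rightarrow> ennreal) \<in> borel_measurable borel"
    by (intro borel_measurable_indicator) simp
  \<comment> \<open>The p-th root of s^(-n) E / b, which bounds the mean over the ball of the p-th
    power of the rescaled gradient. With this choice both terms of \<open>le_powr_plus\<close>
    contribute b \<kappa>.\<close>
  define \<kappa> where "\<kappa> s = s powr (- ?n / p) * (E / b) powr (1 / p)" for s
  have inner: "(\<integral>\<^sup>+y. indicator ?B y * ennreal (norm (G (x + s *\<^sub>R (y - x)))) \<partial>lborel) \<le> ennreal (2 * b * \<kappa> s)"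
    if s: "0 < s" "s \<le> 1" for s
  proof -
    have \<kappa>: "\<kappa> s > 0" using s \<open>E > 0\<close> b0 by (simp add: \<kappa>_def)
    have \<kappa>p: "\<kappa> s powr (1 - p) * (s powr - ?n * E) = b * \<kappa> s"
    proof -
      have "\<kappa> s powr p = s powr (- ?n) * (E / b)"
        using s \<open>E > 0\<close> b0 p1 by (simp add: \<kappa>_def powr_mult powr_powr)
      then have "s powr - ?n * E = b * \<kappa> s powr p" using b0 by (simp add: field_simps)
      then have "\<kappa> s powr (1 - p) * (s powr - ?n * E) = b * (\<kappa> s powr (1 - p) * \<kappa> s powr p)" by simp
      then show ?thesis using \<kappa> by (simp add: powr_add[symmetric])
    qed
    let ?f = "\<lambda>z. ennreal (norm (G z) powr p) * indicator ?B z"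
    have fm: "?f \<in> borel_measurable borel" by simp
    have "(\<lambda>y. (1 - s) *\<^sub>R x + s *\<^sub>R y) \<in> borel \<rightarrow>\<^sub>M borel"
      by (intro borel_measurable_continuous_onI continuous_intros)
    then have fm': "(\<lambda>y. ?f ((1 - s) *\<^sub>R x + s *\<^sub>R y)) \<in> borel_measurable lborel"
      using measurable_compose[OF _ fm] by simp
    have "(\<integral>\<^sup>+y. indicator ?B y * ennreal (norm (G (x + s *\<^sub>R (y - x)))) \<partial>lborel) \<le>
        (\<integral>\<^sup>+y. ennreal (\<kappa> s powr (1 - p)) * ?f ((1 - s) *\<^sub>R x + s *\<^sub>R y) + ennreal (\<kappa> s) * indicator ?B y \<partial>lborel)"
    proof (intro nn_integral_mono)
      fix y
      show "indicator ?B y * ennreal (norm (G (x + s *\<^sub>R (y - x)))) \<le>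
          ennreal (\<kappa> s powr (1 - p)) * ?f ((1 - s) *\<^sub>R x + s *\<^sub>R y) + ennreal (\<kappa> s) * indicator ?B y"
      proof (cases "y \<in> ?B")
        case True
        have "(1 - s) *\<^sub>R x + s *\<^sub>R y \<in> ?B"
          using True x s by (intro convexD_alt[OF convex_ball]) auto
        moreover have "x + s *\<^sub>R (y - x) = (1 - s) *\<^sub>R x + s *\<^sub>R y" by (simp add: algebra_simps)
        moreover have "ennreal (norm (G z)) \<le>
            ennreal (\<kappa> s powr (1 - p)) * ennreal (norm (G z) powr p) + ennreal (\<kappa> s)" for z
          using ennreal_leI[OF le_powr_plus[OF norm_ge_zero \<kappa> p1, of "G z"]] \<kappa>
          by (simp add: ennreal_mult)
        ultimately show ?thesis using True by simp
      qed simp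
    qed
    also have "\<dots> = ennreal (\<kappa> s powr (1 - p)) * (\<integral>\<^sup>+y. ?f ((1 - s) *\<^sub>R x + s *\<^sub>R y) \<partial>lborel) + ennreal (\<kappa> s) * ennreal b"
      using fm' by (subst nn_integral_add) (simp_all only: nn_integral_cmult borel_measurable_indicator
        borel_measurable_times_ennreal borel_measurable_const eb nn_integral_indicator sets_lborel borel_open open_ball measurable_lborel1)
    also have "(\<integral>\<^sup>+y. ?f ((1 - s) *\<^sub>R x + s *\<^sub>R y) \<partial>lborel) = ennreal (s powr - ?n) * (\<integral>\<^sup>+y. ?f y \<partial>lborel)"
      using s by (intro nn_integral_affine) auto
    also have "ennreal (\<kappa> s powr (1 - p)) * \<dots> + ennreal (\<kappa> s) * ennreal b \<le>
        ennreal (\<kappa> s powr (1 - p)) * (ennreal (s powr - ?n) * ennreal E) + ennreal (\<kappa> s) * ennreal b"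
      using E by (intro add_mono mult_left_mono) auto
    also have "\<dots> = ennreal (\<kappa> s powr (1 - p) * (s powr - ?n * E) + \<kappa> s * b)"
      using \<kappa> \<open>E > 0\<close> b0 by (simp add: ennreal_mult[symmetric] ennreal_plus[symmetric] del: ennreal_plus)
    also have "\<dots> = ennreal (2 * b * \<kappa> s)" unfolding \<kappa>p by (simp add: mult_ac)
    finally show ?thesis .
  qed
  have "(\<integral>\<^sup>+y. indicator ?B y * ennreal \<bar>u y - u x\<bar> \<partial>lborel) \<le>
      (\<integral>\<^sup>+y. (\<integral>\<^sup>+s. ennreal (2 * r) * (indicator {0<..1} s * (indicator ?B y * ennreal (norm (G (x + s *\<^sub>R (y - x)))))) \<partial>lborel) \<partial>lborel)"
    using ae
  proof (intro nn_integral_mono_AE, eventually_elim)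
    case (elim y)
    show ?case
    proof (cases "y \<in> ?B")
      case True
      have "norm (y - x) \<le> 2 * r"
        using True x norm_triangle_ineq4[of "c - x" "c - y"] by (simp add: dist_norm)
      note elim(2)
      also have "(\<integral>\<^sup>+s. indicator {0..1} s * ennreal (norm (G (x + s *\<^sub>R (y - x))) * norm (y - x)) \<partial>lborel) \<le>
          (\<integral>\<^sup>+s. ennreal (2 * r) * (indicator {0<..1} s * (indicator ?B y * ennreal (norm (G (x + s *\<^sub>R (y - x)))))) \<partial>lborel)"
      proof (rule nn_integral_mono_AE)
        show "AE s in lborel. indicator {0..1} s * ennreal (norm (G (x + s *\<^sub>R (y - x))) * norm (y - x)) \<le>
           ennreal (2 * r) * (indicator {0<..1} s * (indicator ?B y * ennreal (norm (G (x + s *\<^sub>R (y - x))))))"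
          using AE_lborel_singleton[of "0::real"]
        proof eventually_elim
          case (elim s)
          show ?case
            using True elim \<open>norm (y - x) \<le> 2 * r\<close> \<open>r > 0\<close>
            by (auto simp: indicator_def ennreal_mult[symmetric] mult.commute[of "norm (G _)"]
                intro!: ennreal_leI mult_right_mono)
        qed
      qed
      finally show ?thesis using True by simp
    qed simp
  qed
  also have "\<dots> = (\<integral>\<^sup>+s. (\<integral>\<^sup>+y. ennreal (2 * r) * (indicator {0<..1} s * (indicator ?B y * ennreal (norm (G (x + s *\<^sub>R (y - x)))))) \<partial>lborel) \<partial>lborel)"
    by (rule lborel_pair.Fubini') measurable
  also have "\<dots> = (\<integral>\<^sup>+s. ennreal (2 * r) * (indicator {0<..1} s * (\<integral>\<^sup>+y. indicator ?B y * ennreal (norm (G (x + s *\<^sub>R (y - x)))) \<partial>lborel)) \<partial>lborel)"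
    by (simp add: nn_integral_cmult)
  \<comment> \<open>The 4 is the product of the 2 from the diameter 2r of the ball and the 2 in
    \<open>inner\<close>.\<close>
  also have "\<dots> \<le> (\<integral>\<^sup>+s. ennreal (4 * r * b * (E / b) powr (1 / p)) * ennreal (s powr (- ?n / p) * indicator {0..1} s) \<partial>lborel)"
  proof (rule nn_integral_mono)
    fix s :: real
    show "ennreal (2 * r) * (indicator {0<..1} s * (\<integral>\<^sup>+y. indicator ?B y * ennreal (norm (G (x + s *\<^sub>R (y - x)))) \<partial>lborel))
        \<le> ennreal (4 * r * b * (E / b) powr (1 / p)) * ennreal (s powr (- ?n / p) * indicator {0..1} s)"
    proof (cases "0 < s \<and> s \<le> 1")
      case True
      have "ennreal (2 * r) * (\<integral>\<^sup>+y. indicator ?B y * ennreal (norm (G (x + s *\<^sub>R (y - x)))) \<partial>lborel)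
          \<le> ennreal (2 * r) * ennreal (2 * b * \<kappa> s)"
        using True by (intro mult_left_mono inner) auto
      also have "\<dots> = ennreal (4 * r * b * (E / b) powr (1 / p)) * ennreal (s powr (- ?n / p))"
        using \<open>r > 0\<close> b0 by (simp add: ennreal_mult[symmetric] \<kappa>_def mult_ac)
      finally show ?thesis using True by simp
    qed simp
  qed
  also have "\<dots> = ennreal (4 * r * b * (E / b) powr (1 / p)) * ennreal (1 / (1 - ?n / p))"
  proof -
    have "- ?n / p > -1" using p p1 by (simp add: field_simps)
    from has_integral_powr_from_0[OF this, of 1]
    have "((\<lambda>s. s powr (- ?n / p)) has_integral (1 / (1 - ?n / p))) {0..1}" by simp
    then have "((\<lambda>s. if s \<in> {0..1} then s powr (- ?n / p) else 0) has_integral (1 / (1 - ?n / p))) UNIV"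
      by (simp only: has_integral_restrict_UNIV)
    moreover have "(\<lambda>s. if s \<in> {0..1} then s powr (- ?n / p) else 0) = (\<lambda>s. s powr (- ?n / p) * indicator {0..1} s)"
      by (auto simp: fun_eq_iff indicator_def)
    ultimately have "((\<lambda>s. s powr (- ?n / p) * indicator {0..1} s) has_integral (1 / (1 - ?n / p))) UNIV"
      by (simp only:)
    then have "(\<integral>\<^sup>+s. ennreal (s powr (- ?n / p) * indicator {0..1} s) \<partial>lborel) = ennreal (1 / (1 - ?n / p))"
      by (intro nn_integral_has_integral_lborel) auto
    then show ?thesis by (simp add: nn_integral_cmult)
  qed
  also have "\<dots> = ennreal (4 * r * b * (E / b) powr (1 / p) / (1 - ?n / p))"
    using p p1 b0 \<open>r > 0\<close> by (subst ennreal_mult[symmetric]) (auto simp: field_simps)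
  finally show ?thesis .
qed

text \<open>The 8 is twice the 4 of \<open>average_difference_le\<close>, since two points are
  compared through the average over a ball; the power of the unit ball's volume comes from (E /
  b)^(1/p).\<close>

definition morrey_factor :: "'a::euclidean_space itself \<Rightarrow> real \<Rightarrow> real" where
  "morrey_factor _ p =
     8 / (1 - real DIM('a) / p) * measure lborel (ball (0::'a) 1) powr (- 1 / p)"

proposition morrey_ball:
  fixes u :: "'a::euclidean_space \<Rightarrow> real"
  assumes p: "real DIM('a) < p" and u: "line_gradient u G" and "r > 0" "E > 0"
    and E: "(\<integral>\<^sup>+z. ennreal (norm (G z) powr p) * indicator (ball c r) z \<partial>lborel) \<le> ennreal E"
    and "x \<in> ball c r" "y \<in> ball c r"
  shows "\<bar>u x - u y\<bar> \<le> morrey_factor TYPE('a) p * r powr (1 - real DIM('a) / p) * E powr (1 / p)"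
proof -
  let ?n = "real DIM('a)" and ?B = "ball c r"
  define b where "b = measure lborel ?B"
  have n: "?n \<ge> 1" using DIM_positive[where 'a = 'a] by linarith
  have p1: "p > 1" using p n by linarith
  have b0: "b > 0" using \<open>r > 0\<close> by (simp add: b_def content_ball_pos)
  have eb: "emeasure lborel ?B = ennreal b"
    unfolding b_def using emeasure_lborel_ball_finite[of c r] by (intro emeasure_eq_ennreal_measure) auto
  have [measurable, simp]: "(indicator ?B :: 'a \<Rightarrow> ennreal) \<in> borel_measurable borel"
    by (intro borel_measurable_indicator) simp
  define K where "K = 4 * r * (E / b) powr (1 / p) / (1 - ?n / p)"
  have K0: "K \<ge> 0" using \<open>r > 0\<close> p p1 by (simp add: K_def)
  define good where "good x \<longleftrightarrow> (\<integral>\<^sup>+y. indicator ?B y * ennreal \<bar>u y - u x\<bar> \<partial>lborel) \<le> ennreal (K * b)" for x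
  have [measurable]: "u \<in> borel_measurable borel"
    using line_gradientD(1)[OF u] by (rule borel_measurable_continuous_onI)
  have ae: "AE x in lborel. x \<in> ?B \<longrightarrow> good x"
    using AE_line_difference_le[OF u]
  proof eventually_elim
    case (elim x)
    then show ?case
      using average_difference_le[OF p line_gradientD(2)[OF u] \<open>r > 0\<close> \<open>E > 0\<close> E _ elim]
      by (auto simp: good_def K_def b_def mult_ac)
  qed
  \<comment> \<open>The triangle inequality through \<open>z\<close>, averaged over all
    \<open>z\<close> in the ball.\<close>
  have two: "\<bar>u x - u y\<bar> \<le> 2 * K" if "good x" "good y" for x y
  proof -
    have "ennreal (b * \<bar>u x - u y\<bar>) = (\<integral>\<^sup>+z. indicator ?B z * ennreal \<bar>u x - u y\<bar> \<partial>lborel)"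
      using b0 by (subst nn_integral_multc) (simp_all add: eb ennreal_mult)
    also have "\<dots> \<le> (\<integral>\<^sup>+z. indicator ?B z * ennreal \<bar>u z - u x\<bar> + indicator ?B z * ennreal \<bar>u z - u y\<bar> \<partial>lborel)"
      by (intro nn_integral_mono)
        (auto simp: indicator_def ennreal_plus[symmetric] simp del: ennreal_plus intro!: ennreal_leI)
    also have "\<dots> \<le> ennreal (K * b) + ennreal (K * b)"
      using that by (subst nn_integral_add) (auto simp: good_def intro!: add_mono)
    also have "\<dots> = ennreal (b * (2 * K))"
      using K0 b0 by (simp add: ennreal_plus[symmetric] del: ennreal_plus)
    finally show ?thesis using b0 K0 by simp
  qed
  have cont: "continuous_on UNIV (\<lambda>z. \<bar>u z - a\<bar>)" for a
    using line_gradientD(1)[OF u] by (intro continuous_intros)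
  \<comment> \<open>Almost every point of the ball is good. Continuity removes this restriction one
    variable at a time, first for \<open>y\<close> and then for \<open>x\<close>.\<close>
  have "\<bar>u w - u y\<bar> \<le> 2 * K" if "good w" for w
  proof (rule AE_imp_all_le_on_open[OF continuous_on_cong[THEN iffD1, OF refl _ cont] open_ball _ \<open>y \<in> ?B\<close>])
    show "AE y in lborel. y \<in> ?B \<longrightarrow> \<bar>u w - u y\<bar> \<le> 2 * K"
      using ae by eventually_elim (auto intro: two that)
  qed (rule abs_minus_commute)
  then have "\<bar>u x - u y\<bar> \<le> 2 * K"
    using ae by (intro AE_imp_all_le_on_open[OF cont open_ball _ \<open>x \<in> ?B\<close>]) auto
  also have "2 * K = morrey_factor TYPE('a) p * r powr (1 - ?n / p) * E powr (1 / p)"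
  proof -
    define \<omega> where "\<omega> = measure lborel (ball (0::'a) 1)"
    have \<omega>: "\<omega> > 0" by (simp add: \<omega>_def content_ball_pos)
    have "b = \<omega> * r powr ?n"
      using content_ball[of r c] content_ball[of 1 "0::'a"] \<open>r > 0\<close>
      by (simp add: b_def \<omega>_def powr_realpow)
    then have "(E / b) powr (1 / p) = E powr (1 / p) * \<omega> powr (- 1 / p) * r powr (- ?n / p)"
      using \<omega> \<open>r > 0\<close> \<open>E > 0\<close> by (simp add: powr_divide powr_mult powr_powr powr_minus field_simps)
    moreover have "r powr (1 - ?n / p) = r * r powr (- ?n / p)"
      using \<open>r > 0\<close> powr_add[of r 1 "- ?n / p"] by simp
    ultimately show ?thesis by (simp add: K_def morrey_factor_def \<omega>_def mult_ac)
  qed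
  finally show ?thesis .
qed

section \<open>Weak partial derivatives\<close>

lemma integral_along_lines_weighted:
  fixes g :: "'a::euclidean_space \<Rightarrow> real"
  assumes g: "integrable lborel g" and [measurable]: "w \<in> borel_measurable borel"
    and B: "\<And>x. \<bar>w x\<bar> \<le> B" and t: "0 \<le> t"
  shows "(LINT x|lborel. w x * (LINT s:{0..t}|lborel. g (x + s *\<^sub>R h))) =
    (LINT s:{0..t}|lborel. (LINT x|lborel. w x * g (x + s *\<^sub>R h)))"
proof -
  have [measurable]: "g \<in> borel_measurable borel" using g by auto
  have "integrable (lborel \<Otimes>\<^sub>M lborel) (\<lambda>(s, x). indicator {0..t} s * w x * g (x + s *\<^sub>R h))"
  proof (rule Bochner_Integration.integrable_bound[OF integrable_mult_right[OF integrable_along_lines[OF g t, of h], of B]])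
    show "AE z in lborel \<Otimes>\<^sub>M lborel. norm (case z of (s, x) \<Rightarrow> indicator {0..t} s * w x * g (x + s *\<^sub>R h))
        \<le> norm (B * (case z of (s, x) \<Rightarrow> indicator {0..t} s * g (x + s *\<^sub>R h)))"
      using order_trans[OF B abs_ge_self] by (intro always_eventually allI)
        (auto simp: indicator_def abs_mult intro!: mult_right_mono)
  qed measurable
  note int = this
  have "(LINT x|lborel. w x * (LINT s:{0..t}|lborel. g (x + s *\<^sub>R h))) =
      (LINT x|lborel. (LINT s|lborel. indicator {0..t} s * w x * g (x + s *\<^sub>R h)))"
    by (simp add: set_lebesgue_integral_def mult_ac flip: integral_mult_right_zero)
  also have "\<dots> = (LINT s|lborel. (LINT x|lborel. indicator {0..t} s * w x * g (x + s *\<^sub>R h)))"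
    using lborel_pair.integral_snd[OF int] lborel_pair.integral_fst[OF int] by simp
  finally show ?thesis
    by (simp add: set_lebesgue_integral_def mult.assoc)
qed

lemma continuous_set_integrable_cball:
  fixes f :: "'a::euclidean_space \<Rightarrow> 'b::{banach, second_countable_topology}"
  assumes "continuous_on UNIV f"
  shows "set_integrable lborel (cball 0 R) f"
  unfolding set_integrable_def
  by (intro borel_integrable_compact continuous_on_subset[OF assms]) auto

lemma integrable_continuous_compact_support:
  fixes f :: "'a::euclidean_space \<Rightarrow> 'b::{banach, second_countable_topology}"
  assumes "continuous_on UNIV f" "\<And>x. R < norm x \<Longrightarrow> f x = 0"
  shows "integrable lborel f"
proof -
  have "integrable lborel (\<lambda>x. indicator (cball 0 R) x *\<^sub>R f x)"
    by (intro borel_integrable_compact continuous_on_subset[OF assms(1)]) auto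
  moreover have "(\<lambda>x. indicator (cball 0 R) x *\<^sub>R f x) = f"
    using assms(2) by (auto simp: fun_eq_iff indicator_def)
  ultimately show ?thesis by simp
qed

lemma bounded_continuous_compact_support:
  fixes f :: "'a::euclidean_space \<Rightarrow> real"
  assumes "continuous_on UNIV f" "\<And>x. R < norm x \<Longrightarrow> f x = 0"
  obtains B where "\<And>x. \<bar>f x\<bar> \<le> B"
proof -
  have "bounded (f ` cball 0 R)"
    by (intro compact_imp_bounded compact_continuous_image continuous_on_subset[OF assms(1)]) auto
  then obtain B where B: "\<And>x. x \<in> cball 0 R \<Longrightarrow> \<bar>f x\<bar> \<le> B"
    unfolding bounded_iff by (metis image_eqI real_norm_def)
  have "\<bar>f x\<bar> \<le> max B 0" for x
    using B[of x] assms(2)[of x] by (cases "norm x \<le> R") auto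
  then show thesis by (rule that)
qed

lemma test_function_line_gradient:
  fixes \<phi> :: "real ^ 'n::finite \<Rightarrow> real"
  assumes "test_function \<phi>"
  shows "line_gradient \<phi> (\<lambda>x. \<chi> i. partial i \<phi> x)"
    and "continuous_on UNIV (partial i \<phi>)"
    and "(\<And>x. R < norm x \<Longrightarrow> \<phi> x = 0) \<Longrightarrow> R < norm x \<Longrightarrow> partial i \<phi> x = 0"
proof -
  have C: "C_k (Suc 0) \<phi>" using assms by (auto simp: test_function_def simp del: C_k.simps)
  then show c: "continuous_on UNIV (partial i \<phi>)" for i by auto
  show "line_gradient \<phi> (\<lambda>x. \<chi> i. partial i \<phi> x)"
  proof (rule line_gradient_C1)
    show "(\<phi> has_derivative (\<bullet>) (\<chi> i. partial i \<phi> x)) (at x)" for x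
      using C by (intro has_derivative_partial) simp
    show "continuous_on UNIV (\<lambda>x. \<chi> i. partial i \<phi> x)"
      using c by (intro continuous_on_vec_lambda)
  qed
  assume z: "\<And>x. R < norm x \<Longrightarrow> \<phi> x = 0" and x: "R < norm x"
  have "((\<lambda>x. 0) has_derivative (\<lambda>h. 0)) (at x)" by simp
  moreover have "open {x :: real ^ 'n. R < norm x}"
    by (intro open_Collect_less continuous_intros)
  ultimately have "(\<phi> has_derivative (\<lambda>h. 0)) (at x)"
    by (rule has_derivative_transform_within_open) (use x z in auto)
  then show "partial i \<phi> x = 0" by (simp add: partial_eqI)
qed

lemma locally_integrable_iff:
  "locally_integrable f \<longleftrightarrow> f \<in> borel_measurable borel \<and> (\<forall>R. set_integrable lborel (cball 0 R) f)"
proof -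
  have "set_integrable lborel K f" if "\<forall>R. set_integrable lborel (cball 0 R) f" "compact K" for K
  proof -
    obtain R where "K \<subseteq> cball 0 R"
      using compact_imp_bounded[OF \<open>compact K\<close>] by (auto simp: bounded_iff subset_iff)
    moreover have "K \<in> sets lborel" using compact_imp_closed[OF \<open>compact K\<close>] by simp
    ultimately show ?thesis using that(1) set_integrable_subset by blast
  qed
  then show ?thesis by (auto simp: locally_integrable_def)
qed

lemma integrable_mult_test_function:
  assumes g: "\<And>R. set_integrable lborel (cball 0 R) g" and \<phi>: "continuous_on UNIV \<phi>"
    and R: "\<And>x. R < norm x \<Longrightarrow> \<phi> x = (0::real)"
  shows "integrable lborel (\<lambda>x :: 'a::euclidean_space. g x * \<phi> x)"
proof -
  have "set_integrable lborel (cball 0 R) (\<lambda>x. \<phi> x *\<^sub>R g x)"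
    using g \<phi> by (rule continuous_scaleR_set_integrable_cball)
  moreover have "(\<lambda>x. indicator (cball 0 R) x *\<^sub>R (\<phi> x *\<^sub>R g x)) = (\<lambda>x. g x * \<phi> x)"
    using R by (auto simp: fun_eq_iff indicator_def)
  ultimately show ?thesis by (simp add: set_integrable_def)
qed

text \<open>For the compactly supported product U = u \<phi> the integral of U(x + e) - U(x), with e
  the i-th unit vector, vanishes by translation invariance. By the product rule along lines and
  Fubini's theorem it also equals the integral of the i-th derivative of U, so this is integration
  by parts.\<close>

lemma line_gradient_imp_weak_partial:
  fixes u :: "real ^ 'n::finite \<Rightarrow> real"
  assumes u: "line_gradient u G"
  shows "is_weak_partial i u (\<lambda>x. G x $ i)"
  unfolding is_weak_partial_def locally_integrable_iff
proof (intro conjI allI impI)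
  note u' = line_gradientD[OF u]
  show m: "(\<lambda>x. G x $ i) \<in> borel_measurable borel"
    by (rule measurable_compose[OF u'(2)])
      (intro borel_measurable_continuous_onI linear_continuous_on bounded_linear_vec_nth)
  show loc: "set_integrable lborel (cball 0 R) (\<lambda>x. G x $ i)" for R
    using integrable_bounded_linear[OF bounded_linear_vec_nth u'(3)[of R, unfolded set_integrable_def], of i]
    by (simp add: set_integrable_def)
  fix \<phi> :: "real ^ 'n \<Rightarrow> real" assume \<phi>: "test_function \<phi>"
  obtain R where R: "R > 0" "\<And>x. R < norm x \<Longrightarrow> \<phi> x = 0" using test_functionE[OF \<phi>] by blast
  note \<phi>' = test_function_line_gradient[OF \<phi>]
  have cont: "continuous_on UNIV \<phi>" using \<phi> by (rule test_function_continuous)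
  define U where "U x = u x * \<phi> x" for x
  define \<gamma> where "\<gamma> x = u x * partial i \<phi> x + G x $ i * \<phi> x" for x
  have int1: "integrable lborel (\<lambda>x. u x * partial i \<phi> x)"
    using u'(1) \<phi>'(2) \<phi>'(3)[OF R(2)] by (intro integrable_continuous_compact_support[where R = R] continuous_on_mult) auto
  have int2: "integrable lborel (\<lambda>x. G x $ i * \<phi> x)"
    by (rule integrable_mult_test_function[OF loc cont R(2)])
  have \<gamma>: "integrable lborel \<gamma>" unfolding \<gamma>_def using int1 int2 by (rule Bochner_Integration.integrable_add)
  have cU: "continuous_on UNIV U" unfolding U_def using u'(1) cont by (rule continuous_on_mult)
  have U: "integrable lborel U"
    using R(2) by (intro integrable_continuous_compact_support[OF cU, where R = R]) (simp add: U_def)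
  have "AE x in lborel. U (x + axis i 1) - U x = (LINT s:{0..1}|lborel. \<gamma> (x + s *\<^sub>R axis i 1))"
    using line_gradientD(4)[OF line_gradient_mult[OF u \<phi>'(1)], of "axis i 1"]
    by eventually_elim
      (auto simp: ac_deriv_def U_def \<gamma>_def inner_axis mult.commute dest!: bspec[of _ _ 1])
  then have "(LINT x|lborel. U (x + axis i 1) - U x) =
      (LINT x|lborel. (LINT s:{0..1}|lborel. \<gamma> (x + s *\<^sub>R axis i 1)))"
    using U integral_along_lines(3)[OF \<gamma>, of 1 "axis i 1"] integrable_translate[OF U, of "axis i 1"]
    by (intro integral_cong_AE) auto
  also have "\<dots> = (LINT x|lborel. \<gamma> x)"
    using integral_along_lines(1)[OF \<gamma>, of 1 "axis i 1"] by simp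
  also have "(LINT x|lborel. U (x + axis i 1) - U x) = 0"
    using U integrable_translate[OF U] integral_translate[of U "axis i 1"] by simp
  finally show "(LINT x|lborel. u x * partial i \<phi> x) = - (LINT x|lborel. G x $ i * \<phi> x)"
    using int1 int2 by (simp add: \<gamma>_def)
qed

lemma AE_set_integrable_line:
  fixes g :: "'a::euclidean_space \<Rightarrow> real"
  assumes "\<And>R. set_integrable lborel (cball 0 R) g"
  shows "AE x in lborel. set_integrable lborel {0..1} (\<lambda>s. g (x + s *\<^sub>R h))"
proof -
  have "AE x in lborel. \<forall>N::nat. set_integrable lborel {0..1}
      (\<lambda>s. indicator (cball 0 (real N)) (x + s *\<^sub>R h) *\<^sub>R g (x + s *\<^sub>R h))"
  proof (rule AE_all_countable[THEN iffD2], rule allI)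
    fix N :: nat
    show "AE x in lborel. set_integrable lborel {0..1}
      (\<lambda>s. indicator (cball 0 (real N)) (x + s *\<^sub>R h) *\<^sub>R g (x + s *\<^sub>R h))"
      using integral_along_lines(2)[OF assms[of "real N", unfolded set_integrable_def], of 1 h] by simp
  qed
  then show ?thesis
  proof eventually_elim
    case (elim x)
    obtain N where N: "norm x + norm h \<le> real N" using real_arch_simple by blast
    have "x + s *\<^sub>R h \<in> cball 0 (real N)" if "s \<in> {0..1}" for s
    proof -
      have "norm (x + s *\<^sub>R h) \<le> norm x + s * norm h"
        using norm_triangle_ineq[of x "s *\<^sub>R h"] that by simp
      also have "\<dots> \<le> norm x + norm h" using that by (auto simp: mult_left_le_one_le)
      finally show ?thesis using N by simp
    qed
    then show ?case using elim[rule_format, of N]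
      by (subst (asm) set_integrable_cong[OF refl refl]) auto
  qed
qed

text \<open>The identity is tested against \<phi> for one fixed \<open>s\<close>. A translation
  moves the difference from u to \<phi>, where it is an integral of derivatives of \<phi> along a
  segment; the weak formulation for the translates of \<phi> moves these derivatives back to u as
  \<open>G\<close>.\<close>

lemma AE_line_identity:
  fixes u :: "real ^ 'n::finite \<Rightarrow> real"
  assumes u: "continuous_on UNIV u" and weak: "\<And>i. is_weak_partial i u (\<lambda>x. G x $ i)"
    and s: "0 \<le> s" "s \<le> 1"
  shows "AE x in lborel. u (x + s *\<^sub>R h) - u x = (LINT t:{0..s}|lborel. G (x + t *\<^sub>R h) \<bullet> h)"
proof -
  define g where "g x = G x \<bullet> h" for x
  have gsum: "g x = (\<Sum>i\<in>UNIV. h $ i * G x $ i)" for x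
    by (simp add: g_def inner_vec_def mult.commute)
  have G: "(\<lambda>x. G x $ i) \<in> borel_measurable borel" "set_integrable lborel (cball 0 R) (\<lambda>x. G x $ i)" for i R
    using weak by (auto simp: is_weak_partial_def locally_integrable_iff)
  have gm [measurable]: "g \<in> borel_measurable borel"
    unfolding gsum[abs_def] using G by (intro borel_measurable_sum borel_measurable_times) auto
  have gloc: "set_integrable lborel (cball 0 R) g" for R
    unfolding gsum[abs_def] set_integrable_def scaleR_sum_right
    using set_integrable_mult_right[OF G(2)] by (intro Bochner_Integration.integrable_sum) (simp add: set_integrable_def)
  have um [measurable]: "u \<in> borel_measurable borel" using u by (rule borel_measurable_continuous_onI)
  \<comment> \<open>Fubini's theorem over the whole space calls for an integrable function. Segments
    starting in the ball of radius \<open>R\<close> stay within radius \<open>R + norm h\<close>, so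
    there the cutoff changes nothing.\<close>
  define gR where "gR R x = indicator (cball 0 (R + norm h)) x *\<^sub>R g x" for R x
  have gRint: "integrable lborel (gR R)" for R
    using gloc by (simp add: gR_def[abs_def] set_integrable_def)
  have near: "norm (x + t *\<^sub>R h) \<le> R + norm h" if "norm x \<le> R" "t \<in> {0..s}" for x t R
  proof -
    have "norm (x + t *\<^sub>R h) \<le> norm x + t * norm h"
      using norm_triangle_ineq[of x "t *\<^sub>R h"] that by simp
    also have "\<dots> \<le> R + norm h" using that s by (intro add_mono mult_left_le_one_le) auto
    finally show ?thesis .
  qed
  have gRline: "(LINT t:{0..s}|lborel. gR R (x + t *\<^sub>R h)) = (LINT t:{0..s}|lborel. g (x + t *\<^sub>R h))"
    if "norm x \<le> R" for x R
    using near[OF that] by (intro set_lebesgue_integral_cong) (auto simp: gR_def)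
  define J where "J x = (LINT t:{0..s}|lborel. g (x + t *\<^sub>R h))" for x
  have [measurable]: "J \<in> borel_measurable borel"
    unfolding J_def set_lebesgue_integral_def by measurable
  define f where "f x = u (x + s *\<^sub>R h) - u x - J x" for x
  have fm [measurable]: "f \<in> borel_measurable borel" unfolding f_def by measurable
  have du: "continuous_on UNIV (\<lambda>x. u (x + s *\<^sub>R h) - u x)"
  proof -
    have "continuous_on UNIV (\<lambda>x. x + s *\<^sub>R h)" by (intro continuous_intros)
    then have "continuous_on UNIV (\<lambda>x. u (x + s *\<^sub>R h))"
      by (rule continuous_on_compose2[OF u]) simp
    then show ?thesis using u by (rule continuous_on_diff)
  qed
  have Jloc: "set_integrable lborel (cball 0 R) J" for R
  proof -
    have "set_integrable lborel (cball 0 R) (\<lambda>x. LINT t:{0..s}|lborel. gR R (x + t *\<^sub>R h))"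
      unfolding set_integrable_def
      using integral_along_lines(3)[OF gRint s(1), of R h] by (intro integrable_mult_indicator) auto
    then show ?thesis
      by (subst (asm) set_integrable_cong[OF refl refl]) (auto simp: gRline J_def)
  qed
  have floc: "set_integrable lborel (cball 0 R) f" for R
    unfolding f_def
  proof (intro set_integral_diff(1) Jloc)
    show "set_integrable lborel (cball 0 R) (\<lambda>x. u (x + s *\<^sub>R h))"
      "set_integrable lborel (cball 0 R) u"
      using continuous_on_add[OF du u] u by (auto intro: continuous_set_integrable_cball)
  qed
  have "(LINT x|lborel. f x * \<phi> x) = 0" if \<phi>: "test_function \<phi>" for \<phi>
  proof -
    obtain R where R: "R > 0" "\<And>x. R < norm x \<Longrightarrow> \<phi> x = 0" using test_functionE[OF \<phi>] by blast
    note \<phi>' = test_function_line_gradient[OF \<phi>]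
    have cont: "continuous_on UNIV \<phi>" using \<phi> by (rule test_function_continuous)
    obtain B where B: "\<And>x. \<bar>\<phi> x\<bar> \<le> B" using bounded_continuous_compact_support[OF cont R(2)] by blast
    define d where "d x = (\<chi> i. partial i \<phi> x) \<bullet> h" for x
    have dsum: "d x = (\<Sum>i\<in>UNIV. h $ i * partial i \<phi> x)" for x
      by (simp add: d_def inner_vec_def mult.commute)
    have dcont: "continuous_on UNIV d"
      unfolding dsum[abs_def] using \<phi>'(2) by (intro continuous_on_sum continuous_on_mult continuous_on_const)
    have dR: "R < norm x \<Longrightarrow> d x = 0" for x using \<phi>'(3)[OF R(2)] by (simp add: dsum)
    have dint: "integrable lborel d" by (rule integrable_continuous_compact_support[OF dcont dR])
    have translated: "(LINT x|lborel. u x * d (x + a)) = - (LINT x|lborel. g x * \<phi> (x + a))" for a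
    proof -
      have \<phi>a: "test_function (\<lambda>x. \<phi> (x + a))" using \<phi> by (rule test_function_translate)
      obtain R' where R': "\<And>x. R' < norm x \<Longrightarrow> \<phi> (x + a) = 0" using test_functionE[OF \<phi>a] by blast
      note \<phi>a' = test_function_line_gradient[OF \<phi>a]
      have ca: "continuous_on UNIV (\<lambda>x. \<phi> (x + a))" using \<phi>a by (rule test_function_continuous)
      have p: "partial i (\<lambda>x. \<phi> (x + a)) x = partial i \<phi> (x + a)" for i x
      proof (rule partial_translate(1))
        have "C_k (Suc 0) \<phi>" using \<phi> by (auto simp: test_function_def simp del: C_k.simps)
        then show "\<phi> differentiable (at (x + a))" by simp
      qed
      have i1: "integrable lborel (\<lambda>x. u x * partial i (\<lambda>x. \<phi> (x + a)) x)" for i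
        using u \<phi>a'(2) \<phi>a'(3)[OF R'] by (intro integrable_continuous_compact_support[where R = R'] continuous_on_mult) auto
      have i2: "integrable lborel (\<lambda>x. G x $ i * \<phi> (x + a))" for i
        by (rule integrable_mult_test_function[OF G(2) ca R'])
      have "(LINT x|lborel. u x * d (x + a)) =
          (LINT x|lborel. (\<Sum>i\<in>UNIV. h $ i * (u x * partial i (\<lambda>x. \<phi> (x + a)) x)))"
        by (simp add: dsum p sum_distrib_left mult_ac)
      also have "\<dots> = (\<Sum>i\<in>UNIV. h $ i * (LINT x|lborel. u x * partial i (\<lambda>x. \<phi> (x + a)) x))"
        using i1 by (simp add: Bochner_Integration.integral_sum)
      also have "\<dots> = (\<Sum>i\<in>UNIV. h $ i * - (LINT x|lborel. G x $ i * \<phi> (x + a)))"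
        using weak \<phi>a by (simp add: is_weak_partial_def)
      also have "\<dots> = - (LINT x|lborel. (\<Sum>i\<in>UNIV. h $ i * (G x $ i * \<phi> (x + a))))"
        using i2 by (simp add: Bochner_Integration.integral_sum sum_negf)
      also have "\<dots> = - (LINT x|lborel. g x * \<phi> (x + a))"
        by (simp add: gsum sum_distrib_right mult.assoc)
      finally show ?thesis .
    qed
    have i1: "integrable lborel (\<lambda>x. u (x + s *\<^sub>R h) * \<phi> x)"
      using u cont continuous_on_add[OF du u] R(2)
      by (intro integrable_continuous_compact_support[where R = R] continuous_on_mult) auto
    have i2: "integrable lborel (\<lambda>x. u x * \<phi> x)"
      using u cont R(2) by (intro integrable_continuous_compact_support[where R = R] continuous_on_mult) auto
    have i3: "integrable lborel (\<lambda>x. J x * \<phi> x)"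
      by (rule integrable_mult_test_function[OF Jloc cont R(2)])
    have i4: "integrable lborel (\<lambda>x. u x * \<phi> (x - s *\<^sub>R h))"
      using integrable_translate[OF i1, of "- (s *\<^sub>R h)"] by simp
    \<comment> \<open>A bounded replacement of \<open>u\<close>, as
      \<open>integral_along_lines_weighted\<close> takes a bounded weight; it agrees with
      \<open>u\<close> wherever a translate \<open>d (x - t *\<^sub>R h)\<close> is nonzero.\<close>
    define w where "w x = indicator (cball 0 (R + norm h)) x * u x" for x
    have wm: "w \<in> borel_measurable borel"
      unfolding w_def using um by (intro borel_measurable_times borel_measurable_indicator) auto
    obtain Bw where Bw: "\<And>x. \<bar>w x\<bar> \<le> Bw"
    proof -
      have "bounded (u ` cball 0 (R + norm h))"
        by (intro compact_imp_bounded compact_continuous_image continuous_on_subset[OF u]) auto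
      then obtain B where B: "\<And>x. x \<in> cball 0 (R + norm h) \<Longrightarrow> \<bar>u x\<bar> \<le> B"
        unfolding bounded_iff by (metis image_eqI real_norm_def)
      have "\<bar>w x\<bar> \<le> max B 0" for x
        using B[of x] by (cases "x \<in> cball 0 (R + norm h)") (auto simp: w_def)
      then show thesis by (rule that)
    qed
    have away: "R < norm (x - t *\<^sub>R h)" if "x \<notin> cball 0 (R + norm h)" "t \<in> {0..s}" for x t
      using near[of "x - t *\<^sub>R h" R t] that by (cases "norm (x - t *\<^sub>R h) \<le> R") auto
    have wd: "u x * d (x - t *\<^sub>R h) = w x * d (x - t *\<^sub>R h)" if "t \<in> {0..s}" for x t
      using away[OF _ that, of x] dR[of "x - t *\<^sub>R h"] by (cases "x \<in> cball 0 (R + norm h)") (auto simp: w_def)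
    have "(LINT x|lborel. (u (x + s *\<^sub>R h) - u x) * \<phi> x) =
        (LINT x|lborel. u x * (\<phi> (x - s *\<^sub>R h) - \<phi> x))"
      using integral_translate[of "\<lambda>x. u (x + s *\<^sub>R h) * \<phi> x" "- (s *\<^sub>R h)"] i1 i2 i4
      by (simp add: left_diff_distrib right_diff_distrib)
    also have "\<dots> = (LINT x|lborel. w x * (LINT t:{0..s}|lborel. - d (x + t *\<^sub>R (- h))))"
    proof (rule integral_cong_AE)
      show "(\<lambda>x. u x * (\<phi> (x - s *\<^sub>R h) - \<phi> x)) \<in> borel_measurable lborel"
        using i2 i4 by (simp add: right_diff_distrib)
      show "(\<lambda>x. w x * (LINT t:{0..s}|lborel. - d (x + t *\<^sub>R (- h)))) \<in> borel_measurable lborel"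
        using wm integral_along_lines(3)[OF Bochner_Integration.integrable_minus[OF dint] s(1), of "- h"] by simp
      show "AE x in lborel. u x * (\<phi> (x - s *\<^sub>R h) - \<phi> x) = w x * (LINT t:{0..s}|lborel. - d (x + t *\<^sub>R (- h)))"
        using line_gradientD(4)[OF \<phi>'(1), of "- h"]
      proof eventually_elim
        case (elim x)
        have "\<phi> (x - s *\<^sub>R h) - \<phi> x = (LINT t:{0..s}|lborel. - d (x + t *\<^sub>R (- h)))"
          using elim s by (auto simp: ac_deriv_def d_def dest!: bspec[of _ _ s])
        moreover have "(LINT t:{0..s}|lborel. - d (x + t *\<^sub>R (- h))) = 0" if "x \<notin> cball 0 (R + norm h)"
        proof -
          have "(LINT t:{0..s}|lborel. - d (x + t *\<^sub>R (- h))) = (LINT t:{0..s}|lborel. 0)"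
            using away[OF that] dR by (intro set_lebesgue_integral_cong) auto
          then show ?thesis by (simp add: set_lebesgue_integral_def)
        qed
        ultimately show ?case by (cases "x \<in> cball 0 (R + norm h)") (simp_all add: w_def)
      qed
    qed
    also have "\<dots> = (LINT t:{0..s}|lborel. (LINT x|lborel. w x * - d (x + t *\<^sub>R (- h))))"
      by (rule integral_along_lines_weighted[OF _ wm Bw s(1)]) (use dint in simp)
    also have "\<dots> = (LINT t:{0..s}|lborel. (LINT x|lborel. \<phi> x * gR R (x + t *\<^sub>R h)))"
    proof (intro set_lebesgue_integral_cong ballI allI impI)
      fix t assume t: "t \<in> {0..s}"
      have "(LINT x|lborel. w x * - d (x + t *\<^sub>R (- h))) = - (LINT x|lborel. u x * d (x + - (t *\<^sub>R h)))"
        by (simp add: wd[OF t, symmetric])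
      also have "\<dots> = (LINT x|lborel. g x * \<phi> (x + - (t *\<^sub>R h)))" by (simp only: translated minus_minus)
      also have "\<dots> = (LINT x|lborel. g (x + t *\<^sub>R h) * \<phi> x)"
      proof -
        have [measurable]: "\<phi> \<in> borel_measurable borel" using cont by (rule borel_measurable_continuous_onI)
        have "(\<lambda>x. g x * \<phi> (x + - (t *\<^sub>R h))) \<in> borel_measurable borel" by measurable
        from integral_translate[OF this, of "t *\<^sub>R h"] show ?thesis by simp
      qed
      also have "\<dots> = (LINT x|lborel. \<phi> x * gR R (x + t *\<^sub>R h))"
      proof (rule Bochner_Integration.integral_cong[OF refl])
        fix x show "g (x + t *\<^sub>R h) * \<phi> x = \<phi> x * gR R (x + t *\<^sub>R h)"
          using near[OF _ t, of x R] R(2)[of x] by (cases "norm x \<le> R") (auto simp: gR_def)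
      qed
      finally show "(LINT x|lborel. w x * - d (x + t *\<^sub>R (- h))) = (LINT x|lborel. \<phi> x * gR R (x + t *\<^sub>R h))" .
    qed simp
    also have "\<dots> = (LINT x|lborel. \<phi> x * (LINT t:{0..s}|lborel. gR R (x + t *\<^sub>R h)))"
      by (rule integral_along_lines_weighted[OF gRint borel_measurable_continuous_onI[OF cont] B s(1), symmetric])
    also have "\<dots> = (LINT x|lborel. J x * \<phi> x)"
    proof (rule Bochner_Integration.integral_cong[OF refl])
      fix x show "\<phi> x * (LINT t:{0..s}|lborel. gR R (x + t *\<^sub>R h)) = J x * \<phi> x"
        using gRline[of x R] R(2)[of x] by (cases "norm x \<le> R") (auto simp: J_def)
    qed
    finally show ?thesis
      using i1 i2 i3 by (simp add: f_def left_diff_distrib)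
  qed
  then have "AE x in lborel. f x = 0"
    by (rule AE_zero_if_integral_test_function_zero[OF fm floc])
  then show ?thesis by eventually_elim (simp add: f_def J_def g_def)
qed

text \<open>Almost every \<open>x\<close> satisfies the identity for all \<open>s\<close> in a
  countable dense subset of [0,1] at once. For such \<open>x\<close> with an integrable restriction,
  both sides are continuous in \<open>s\<close>, so it holds for every \<open>s\<close>.\<close>

proposition weak_partial_imp_line_gradient:
  fixes u :: "real ^ 'n::finite \<Rightarrow> real"
  assumes u: "continuous_on UNIV u" and weak: "\<And>i. is_weak_partial i u (\<lambda>x. G x $ i)"
  shows "line_gradient u G"
  unfolding line_gradient_def
proof (intro conjI allI)
  have G: "(\<lambda>x. G x $ i) \<in> borel_measurable borel" "set_integrable lborel (cball 0 R) (\<lambda>x. G x $ i)" for i R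
    using weak by (auto simp: is_weak_partial_def locally_integrable_iff)
  have Gsum: "G x = (\<Sum>i\<in>UNIV. (G x $ i) *\<^sub>R axis i 1)" for x
    using basis_expansion[of "G x"] by (simp add: scalar_mult_eq_scaleR)
  show "continuous_on UNIV u" by (rule u)
  show "G \<in> borel_measurable borel"
  proof -
    have "(\<lambda>x. \<Sum>i\<in>UNIV. (G x $ i) *\<^sub>R (axis i 1 :: real ^ 'n)) \<in> borel_measurable borel"
      by (intro borel_measurable_sum borel_measurable_scaleR G borel_measurable_const)
    then show ?thesis by (simp only: Gsum[symmetric])
  qed
  show loc: "set_integrable lborel (cball 0 R) G" for R
  proof -
    have "integrable lborel (\<lambda>x. \<Sum>i\<in>UNIV. (indicator (cball 0 R) x *\<^sub>R G x $ i) *\<^sub>R (axis i 1 :: real ^ 'n))"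
      using G(2) by (intro Bochner_Integration.integrable_sum integrable_scaleR_left) (auto simp: set_integrable_def)
    moreover have "(\<lambda>x. \<Sum>i\<in>UNIV. (indicator (cball 0 R) x *\<^sub>R G x $ i) *\<^sub>R (axis i 1 :: real ^ 'n)) =
        (\<lambda>x. indicator (cball 0 R) x *\<^sub>R (\<Sum>i\<in>UNIV. (G x $ i) *\<^sub>R axis i 1))"
      by (simp add: scaleR_sum_right)
    moreover have "\<dots> = (\<lambda>x. indicator (cball 0 R) x *\<^sub>R G x)"
      by (simp only: Gsum[symmetric])
    ultimately show ?thesis by (simp only: set_integrable_def)
  qed
  fix h :: "real ^ 'n"
  have "set_integrable lborel (cball 0 R) (\<lambda>x. G x \<bullet> h)" for R
    using integrable_inner_left[OF loc[of R, unfolded set_integrable_def], of h]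
    by (simp add: set_integrable_def)
  note line = AE_set_integrable_line[OF this, of h]
  obtain S where S: "countable S" "S \<subseteq> {0..1::real}" "{0..1} \<subseteq> closure S" using separable by blast
  have "AE x in lborel. \<forall>s\<in>S. u (x + s *\<^sub>R h) - u x = (LINT t:{0..s}|lborel. G (x + t *\<^sub>R h) \<bullet> h)"
    unfolding AE_ball_countable[OF S(1)]
  proof
    fix s assume "s \<in> S"
    then have "0 \<le> s" "s \<le> 1" using S(2) by auto
    then show "AE x in lborel. u (x + s *\<^sub>R h) - u x = (LINT t:{0..s}|lborel. G (x + t *\<^sub>R h) \<bullet> h)"
      by (rule AE_line_identity[OF u weak])
  qed
  with line show "AE x in lborel. ac_deriv (\<lambda>s. u (x + s *\<^sub>R h)) (\<lambda>s. G (x + s *\<^sub>R h) \<bullet> h)"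
  proof eventually_elim
    case (elim x)
    define a where "a t = G (x + t *\<^sub>R h) \<bullet> h" for t
    have a: "set_integrable lborel {0..1} a" using elim(1) by (simp add: a_def[abs_def])
    have eq: "(LINT t:{0..s}|lborel. a t) = integral {0..s} a" if "s \<in> {0..1}" for s
      using that by (intro set_borel_integral_eq_integral set_integrable_subset[OF a]) auto
    define f where "f s = u (x + s *\<^sub>R h) - u x - integral {0..s} a" for s
    have "a integrable_on {0..1}" using set_borel_integral_eq_integral(1)[OF a] .
    then have "continuous_on {0..1} (\<lambda>s. integral {0..s} a)" by (rule indefinite_integral_continuous_1)
    moreover have "continuous_on {0..1} (\<lambda>s. u (x + s *\<^sub>R h) - u x)"
      using continuous_on_line[OF u, of x h]
      by (intro continuous_on_diff continuous_on_const) (rule continuous_on_subset, auto)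
    ultimately have cf: "continuous_on {0..1} f"
      unfolding f_def using continuous_on_diff by blast
    have cl: "closure S = {0..1}"
      using S(3) closure_minimal[OF S(2)] by (intro equalityI) auto
    have "f s = 0" if "s \<in> S" for s
    proof -
      have "s \<in> {0..1}" using that S(2) by blast
      from eq[OF this] bspec[OF elim(2) that] show ?thesis by (simp only: f_def a_def)
    qed
    then have "f s = 0" if "s \<in> {0..1}" for s
      using continuous_constant_on_closure[of S f 0 s] cf cl that by simp
    then have "u (x + s *\<^sub>R h) - u (x + 0 *\<^sub>R h) = (LINT t:{0..s}|lborel. a t)" if "s \<in> {0..1}" for s
      using that eq[OF that] by (simp add: f_def)
    moreover have "(\<lambda>s. G (x + s *\<^sub>R h) \<bullet> h) = a" by (simp add: a_def[abs_def])
    ultimately show ?case using a by (simp only: ac_deriv_def) blast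
  qed
qed


section \<open>Uniqueness of gradients and the function space in terms of lines\<close>

lemma weak_partial_unique:
  assumes "is_weak_partial i u g" "is_weak_partial i u g'"
  shows "AE x in lborel. g x = g' x"
proof -
  note g = assms[unfolded is_weak_partial_def locally_integrable_iff]
  have "AE x in lborel. g x - g' x = 0"
  proof (rule AE_zero_if_integral_test_function_zero)
    show "(\<lambda>x. g x - g' x) \<in> borel_measurable borel" using g by auto
    show "set_integrable lborel (cball 0 R) (\<lambda>x. g x - g' x)" for R using g by auto
    fix \<phi> :: "real ^ 'a \<Rightarrow> real" assume \<phi>: "test_function \<phi>"
    obtain R where R: "\<And>x. R < norm x \<Longrightarrow> \<phi> x = 0" using test_functionE[OF \<phi>] by blast
    have "integrable lborel (\<lambda>x. g x * \<phi> x)" "integrable lborel (\<lambda>x. g' x * \<phi> x)"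
      using g integrable_mult_test_function[OF _ test_function_continuous[OF \<phi>] R] by auto
    moreover have "(LINT x|lborel. g x * \<phi> x) = (LINT x|lborel. g' x * \<phi> x)" using g \<phi> by force
    ultimately show "(LINT x|lborel. (g x - g' x) * \<phi> x) = 0" by (simp add: left_diff_distrib)
  qed
  then show ?thesis by eventually_elim simp
qed

lemma line_gradient_unique:
  fixes u :: "real ^ 'n::finite \<Rightarrow> real"
  assumes "line_gradient u G" "line_gradient u H"
  shows "AE x in lborel. G x = H x"
proof -
  have "AE x in lborel. \<forall>i\<in>UNIV. G x $ i = H x $ i"
    by (intro AE_finite_allI weak_partial_unique[OF line_gradient_imp_weak_partial[OF assms(1)]
        line_gradient_imp_weak_partial[OF assms(2)]]) auto
  then show ?thesis by eventually_elim (simp add: vec_eq_iff)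
qed

lemma weak_gradient_line_gradient:
  assumes "line_gradient u G"
  shows "line_gradient u (weak_gradient u)"
proof (rule weak_partial_imp_line_gradient)
  show "is_weak_partial i u (\<lambda>x. weak_gradient u x $ i)" for i
    using someI[of "is_weak_partial i u", OF line_gradient_imp_weak_partial[OF assms]]
    by (simp add: weak_gradient_def weak_partial_def)
qed (rule line_gradientD(1)[OF assms])

text \<open>Frees the norm from the choice operator inside \<open>weak_partial\<close>: any line
  gradient computes it.\<close>

lemma grad_norm_eq:
  assumes "line_gradient u G"
  shows "grad_norm p u = (LINT x|lborel. norm (G x) powr p) powr (1 / p)"
proof -
  note w = weak_gradient_line_gradient[OF assms]
  have "AE x in lborel. norm (weak_gradient u x) powr p = norm (G x) powr p"
    using line_gradient_unique[OF w assms] by eventually_elim simp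
  then have "(LINT x|lborel. norm (weak_gradient u x) powr p) = (LINT x|lborel. norm (G x) powr p)"
    using line_gradientD(2)[OF w] line_gradientD(2)[OF assms] by (intro integral_cong_AE) auto
  then show ?thesis by (simp add: grad_norm_def)
qed


lemma norm_powr_le_sum:
  fixes v :: "real ^ 'n::finite"
  assumes "p > 0"
  shows "norm v powr p \<le> real CARD('n) powr p * (\<Sum>i\<in>UNIV. \<bar>v $ i\<bar> powr p)"
proof -
  obtain j where j: "\<And>i. \<bar>v $ i\<bar> \<le> \<bar>v $ j\<bar>"
  proof -
    have "Max (range (\<lambda>i. \<bar>v $ i\<bar>)) \<in> range (\<lambda>i. \<bar>v $ i\<bar>)" by (intro Max_in) auto
    then obtain j where "Max (range (\<lambda>i. \<bar>v $ i\<bar>)) = \<bar>v $ j\<bar>" by blast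
    then have "\<bar>v $ i\<bar> \<le> \<bar>v $ j\<bar>" for i
      using Max_ge[of "range (\<lambda>i. \<bar>v $ i\<bar>)" "\<bar>v $ i\<bar>"] by simp
    then show thesis by (rule that)
  qed
  have "norm v \<le> (\<Sum>i\<in>UNIV. \<bar>v $ i\<bar>)" by (rule norm_le_l1_cart)
  also have "\<dots> \<le> real CARD('n) * \<bar>v $ j\<bar>" using j by (intro sum_bounded_above) auto
  finally have "norm v powr p \<le> (real CARD('n) * \<bar>v $ j\<bar>) powr p"
    using assms by (intro powr_mono2) auto
  also have "\<dots> = real CARD('n) powr p * \<bar>v $ j\<bar> powr p" by (simp add: powr_mult)
  also have "\<dots> \<le> real CARD('n) powr p * (\<Sum>i\<in>UNIV. \<bar>v $ i\<bar> powr p)"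
    by (intro mult_left_mono member_le_sum) auto
  finally show ?thesis .
qed

lemma holder_continuous_imp_continuous:
  assumes "holder_continuous \<alpha> u" "\<alpha> > 0" shows "continuous_on UNIV u"
proof -
  obtain H where H: "\<And>x y. \<bar>u x - u y\<bar> \<le> H * dist x y powr \<alpha>"
    using assms(1) by (auto simp: holder_continuous_def)
  have "u \<midarrow>x\<rightarrow> u x" for x
  proof -
    have "((\<lambda>y. dist y x) \<longlongrightarrow> 0) (at x)" by (intro tendsto_dist_iff[THEN iffD1] tendsto_ident_at)
    then have "((\<lambda>y. dist y x powr \<alpha>) \<longlongrightarrow> 0 powr \<alpha>) (at x)"
      using assms(2) by (intro tendsto_powr2 tendsto_const) auto
    then have "((\<lambda>y. H * dist y x powr \<alpha>) \<longlongrightarrow> H * 0 powr \<alpha>) (at x)"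
      by (intro tendsto_mult_left)
    then have "((\<lambda>y. H * dist y x powr \<alpha>) \<longlongrightarrow> 0) (at x)" using assms(2) by simp
    then have "((\<lambda>y. u y - u x) \<longlongrightarrow> 0) (at x)"
      by (rule Lim_null_comparison[rotated]) (use H in \<open>auto intro: always_eventually\<close>)
    then show ?thesis by (simp add: LIM_zero_iff)
  qed
  then show ?thesis by (auto simp: continuous_on_def intro: tendsto_within_subset)
qed

proposition D1p_iff:
  fixes u :: "real ^ 'n::finite \<Rightarrow> real"
  assumes p: "real CARD('n) < p"
  shows "u \<in> D1p p \<longleftrightarrow> (\<exists>G. line_gradient u G \<and> integrable lborel (\<lambda>x. norm (G x) powr p))"
proof
  have p0: "p > 0" using p by (meson le_less_trans of_nat_0_le_iff)
  have \<alpha>: "1 - real CARD('n) / p > 0" using p p0 by simp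
  {
    assume u: "u \<in> D1p p"
    then obtain g where g: "\<And>i. is_weak_partial i u (g i)" "\<And>i. in_Lp p (g i)" unfolding D1p_def by auto metis
    have "continuous_on UNIV u"
      using u \<alpha> by (auto simp: D1p_def intro: holder_continuous_imp_continuous)
    moreover define G where "G x = (\<chi> i. g i x)" for x
    ultimately have G: "line_gradient u G"
      using g(1) by (intro weak_partial_imp_line_gradient) (simp_all add: G_def)
    have "integrable lborel (\<lambda>x. norm (G x) powr p)"
    proof (rule Bochner_Integration.integrable_bound)
      show "integrable lborel (\<lambda>x. real CARD('n) powr p * (\<Sum>i\<in>UNIV. \<bar>g i x\<bar> powr p))"
        using g(2) by (intro integrable_mult_right Bochner_Integration.integrable_sum) (auto simp: in_Lp_def)
      show "(\<lambda>x. norm (G x) powr p) \<in> borel_measurable lborel"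
        using line_gradientD(2)[OF G] by simp
      show "AE x in lborel. norm (norm (G x) powr p) \<le> norm (real CARD('n) powr p * (\<Sum>i\<in>UNIV. \<bar>g i x\<bar> powr p))"
      proof (rule always_eventually, rule allI)
        fix x
        show "norm (norm (G x) powr p) \<le> norm (real CARD('n) powr p * (\<Sum>i\<in>UNIV. \<bar>g i x\<bar> powr p))"
          using norm_powr_le_sum[OF p0, of "G x"] by (simp add: G_def sum_nonneg)
      qed
    qed
    with G show "\<exists>G. line_gradient u G \<and> integrable lborel (\<lambda>x. norm (G x) powr p)" by blast
  next
    assume "\<exists>G. line_gradient u G \<and> integrable lborel (\<lambda>x. norm (G x) powr p)"
    then obtain G where G: "line_gradient u G" "integrable lborel (\<lambda>x. norm (G x) powr p)" by blast
    note u = line_gradientD[OF G(1)]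
    have weak: "is_weak_partial i u (\<lambda>x. G x $ i)" for i by (rule line_gradient_imp_weak_partial[OF G(1)])
    have "in_Lp p (\<lambda>x. G x $ i)" for i
      unfolding in_Lp_def
    proof
      show m: "(\<lambda>x. G x $ i) \<in> borel_measurable lborel"
        using weak[of i] by (auto simp: is_weak_partial_def locally_integrable_iff)
      show "integrable lborel (\<lambda>x. \<bar>G x $ i\<bar> powr p)"
      proof (rule Bochner_Integration.integrable_bound[OF G(2)])
        show "(\<lambda>x. \<bar>G x $ i\<bar> powr p) \<in> borel_measurable lborel" using m by simp
        show "AE x in lborel. norm (\<bar>G x $ i\<bar> powr p) \<le> norm (norm (G x) powr p)"
          using p0 component_le_norm_cart by (intro always_eventually allI) (auto intro!: powr_mono2)
      qed
    qed
    moreover have "locally_integrable u"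
      using u(1) by (auto simp: locally_integrable_iff intro: borel_measurable_continuous_onI continuous_set_integrable_cball)
    moreover have "holder_continuous (1 - real CARD('n) / p) u"
    proof -
      \<comment> \<open>The added 1 makes the energy bound positive, as \<open>morrey_ball\<close>
        demands. Below, the radius \<open>2 * dist x y\<close> puts \<open>y\<close> into the open
        ball around \<open>x\<close>.\<close>
      define E where "E = (LINT x|lborel. norm (G x) powr p) + 1"
      have E: "E > 0" unfolding E_def by (intro add_nonneg_pos integral_nonneg) auto
      have "\<bar>u x - u y\<bar> \<le> (morrey_factor TYPE(real ^ 'n) p * 2 powr (1 - real CARD('n) / p) * E powr (1 / p)) * dist x y powr (1 - real CARD('n) / p)" for x y
      proof (cases "x = y")
        case False
        have "(\<integral>\<^sup>+z. ennreal (norm (G z) powr p) * indicator (ball x (2 * dist x y)) z \<partial>lborel) \<le> (\<integral>\<^sup>+z. ennreal (norm (G z) powr p) \<partial>lborel)"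
          by (intro nn_integral_mono) (auto simp: indicator_def)
        also have "\<dots> = ennreal (LINT x|lborel. norm (G x) powr p)"
          using G(2) by (intro nn_integral_eq_integral) auto
        also have "\<dots> \<le> ennreal E" by (intro ennreal_leI) (simp add: E_def)
        finally have "\<bar>u x - u y\<bar> \<le> morrey_factor TYPE(real ^ 'n) p * (2 * dist x y) powr (1 - real CARD('n) / p) * E powr (1 / p)"
          using morrey_ball[OF _ G(1) _ E, of p "2 * dist x y" x x y] p False by simp
        then show ?thesis by (simp add: powr_mult mult_ac)
      qed simp
      then show ?thesis unfolding holder_continuous_def by blast
    qed
    ultimately show "u \<in> D1p p" using weak by (auto simp: D1p_def)
  }
qed

section \<open>Signed measures\<close>

lemma signed_borel_measure_empty: "signed_borel_measure \<rho> \<Longrightarrow> \<rho> {} = 0"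
  by (simp add: signed_borel_measure_def)

lemma signed_borel_measure_sums:
  assumes "signed_borel_measure \<rho>" "range A \<subseteq> sets borel" "disjoint_family A"
  shows "(\<lambda>i::nat. \<rho> (A i)) sums \<rho> (\<Union>i. A i)"
  using assms by (simp add: signed_borel_measure_def)

lemma signed_borel_measure_Un:
  assumes \<rho>: "signed_borel_measure \<rho>" and "A \<in> sets borel" "B \<in> sets borel" "A \<inter> B = {}"
  shows "\<rho> (A \<union> B) = \<rho> A + \<rho> B"
proof -
  have "(\<lambda>i. \<rho> (binaryset A B i)) sums \<rho> (\<Union>i. binaryset A B i)"
    using assms by (intro signed_borel_measure_sums)
      (auto simp: range_binaryset_eq disjoint_family_on_def binaryset_def)
  moreover have "(\<lambda>i. \<rho> (binaryset A B i)) sums (\<rho> A + \<rho> B)"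
    using signed_borel_measure_empty[OF \<rho>] by (rule binaryset_sums)
  ultimately show ?thesis by (simp add: UN_binaryset_eq sums_iff)
qed

lemma signed_borel_measure_Diff:
  assumes "signed_borel_measure \<rho>" and "A \<in> sets borel" "B \<in> sets borel" "B \<subseteq> A"
  shows "\<rho> (A - B) = \<rho> A - \<rho> B"
proof -
  have "B \<union> (A - B) = A" using assms by blast
  then show ?thesis using signed_borel_measure_Un[OF assms(1,3), of "A - B"] assms by simp
qed

lemma signed_borel_measure_uminus:
  "signed_borel_measure \<rho> \<Longrightarrow> signed_borel_measure (\<lambda>A. - \<rho> A)"
  by (auto simp: signed_borel_measure_def intro!: sums_minus)

text \<open>If \<open>\<rho>\<close> is unbounded on the subsets of \<open>A\<close>, then \<open>A\<close> splits into a part of mass larger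
  than one and a part on which \<open>\<rho>\<close> is still unbounded; iterating contradicts countable
  additivity.\<close>

lemma signed_borel_measure_bounded:
  fixes \<rho> :: "(real ^ 'n::finite) set \<Rightarrow> real"
  assumes \<rho>: "signed_borel_measure \<rho>"
  obtains C where "\<And>B. B \<in> sets borel \<Longrightarrow> \<bar>\<rho> B\<bar> \<le> C"
proof (rule ccontr)
  define unb where "unb A \<longleftrightarrow> A \<in> sets borel \<and> (\<forall>C. \<exists>B\<in>sets borel. B \<subseteq> A \<and> C < \<bar>\<rho> B\<bar>)" for A
  assume "\<not> thesis"
  have U: "unb UNIV"
  proof (rule ccontr)
    assume "\<not> unb UNIV"
    then obtain C where C: "\<And>B. B \<in> sets borel \<Longrightarrow> \<not> C < \<bar>\<rho> B\<bar>"
      unfolding unb_def using space_in_borel by blast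
    have thesis by (rule that[of C]) (use C not_less in blast)
    with \<open>\<not> thesis\<close> show False ..
  qed
  have step: "\<exists>A'. unb A' \<and> A' \<subseteq> A \<and> 1 < \<bar>\<rho> (A - A')\<bar>" if A: "unb A" for A
  proof -
    obtain B where B: "B \<in> sets borel" "B \<subseteq> A" "\<bar>\<rho> A\<bar> + 1 < \<bar>\<rho> B\<bar>"
      using A unfolding unb_def by blast
    have Ab: "A \<in> sets borel" using A by (simp add: unb_def)
    have diff: "\<rho> (A - B) = \<rho> A - \<rho> B" using \<rho> Ab B(1,2) by (rule signed_borel_measure_Diff)
    have "unb B \<or> unb (A - B)"
    proof (rule ccontr)
      assume no: "\<not> ?thesis"
      have "A - B \<in> sets borel" using Ab B(1) by (rule sets.Diff)
      with no obtain C2 where C2: "\<And>D. D \<in> sets borel \<Longrightarrow> D \<subseteq> A - B \<Longrightarrow> \<not> C2 < \<bar>\<rho> D\<bar>"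
        unfolding unb_def by blast
      from no B(1) obtain C1 where C1: "\<And>D. D \<in> sets borel \<Longrightarrow> D \<subseteq> B \<Longrightarrow> \<not> C1 < \<bar>\<rho> D\<bar>"
        unfolding unb_def by blast
      obtain D where D: "D \<in> sets borel" "D \<subseteq> A" "C1 + C2 < \<bar>\<rho> D\<bar>"
        using A unfolding unb_def by blast
      have "(D \<inter> B) \<union> (D - B) = D" by blast
      then have "\<rho> D = \<rho> (D \<inter> B) + \<rho> (D - B)"
        using signed_borel_measure_Un[OF \<rho>, of "D \<inter> B" "D - B"] D(1) B(1) by auto
      moreover have "\<not> C1 < \<bar>\<rho> (D \<inter> B)\<bar>" using D B by (intro C1) auto
      moreover have "\<not> C2 < \<bar>\<rho> (D - B)\<bar>" using D B by (intro C2) auto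
      ultimately show False using D(3) by arith
    qed
    then show ?thesis
    proof
      assume "unb B"
      moreover have "1 < \<bar>\<rho> (A - B)\<bar>" using B(3) diff by arith
      ultimately show ?thesis using B(2) by blast
    next
      assume "unb (A - B)"
      moreover have "A - (A - B) = B" using B(2) by blast
      ultimately show ?thesis using B(3) by (intro exI[of _ "A - B"]) auto
    qed
  qed
  obtain A where A: "\<And>n. unb (A n)" "\<And>n. A (Suc n) \<subseteq> A n \<and> 1 < \<bar>\<rho> (A n - A (Suc n))\<bar>"
    using dependent_nat_choice[of "\<lambda>_. unb" "\<lambda>_ B B'. B' \<subseteq> B \<and> 1 < \<bar>\<rho> (B - B')\<bar>"] U step by metis
  define D where "D n = A n - A (Suc n)" for n
  have dec: "A n \<subseteq> A m" if "m \<le> n" for m n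
    using lift_Suc_antimono_le[of A m n] A(2) that by auto
  have "disjoint_family D"
  proof -
    have "D m \<inter> D n = {}" if "m < n" for m n
      using dec[of "Suc m" n] that by (auto simp: D_def)
    then show ?thesis unfolding disjoint_family_on_def by (metis Int_commute linorder_neqE_nat)
  qed
  moreover have "range D \<subseteq> sets borel" using A(1) by (auto simp: D_def unb_def)
  ultimately have "summable (\<lambda>n. \<rho> (D n))" using signed_borel_measure_sums[OF \<rho>] by (blast intro: sums_summable)
  then have "(\<lambda>n. \<rho> (D n)) \<longlonglongrightarrow> 0" by (rule summable_LIMSEQ_zero)
  then obtain N where "\<bar>\<rho> (D N)\<bar> < 1" unfolding LIMSEQ_iff by (metis diff_zero le_refl real_norm_def zero_less_one)
  with A(2)[of N] show False by (simp add: D_def)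
qed

lemma sums_imp_ennreal_le_suminf:
  assumes "x sums s" shows "ennreal s \<le> (\<Sum>i. ennreal (x i))"
proof -
  have "(\<lambda>n. ennreal (\<Sum>i<n. x i)) \<longlonglongrightarrow> ennreal s"
    using assms by (intro tendsto_ennrealI) (simp add: sums_def)
  moreover have "ennreal (\<Sum>i<n. x i) \<le> (\<Sum>i. ennreal (x i))" for n
  proof -
    have "ennreal (\<Sum>i<n. x i) \<le> ennreal (\<Sum>i<n. max 0 (x i))"
      by (intro ennreal_leI sum_mono) auto
    also have "\<dots> = (\<Sum>i<n. ennreal (max 0 (x i)))" by (simp add: sum_ennreal)
    also have "\<dots> = (\<Sum>i<n. ennreal (x i))"
      by (intro sum.cong) (auto simp: max_def ennreal_neg)
    also have "\<dots> \<le> (\<Sum>i. ennreal (x i))" by (intro sum_le_suminf) auto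
    finally show ?thesis .
  qed
  ultimately show ?thesis by (intro LIMSEQ_le_const2) auto
qed

section \<open>The Jordan parts as finite measures\<close>

context
  fixes \<rho> :: "(real ^ 'n::finite) set \<Rightarrow> real"
  assumes \<rho>: "signed_borel_measure \<rho>"
begin

text \<open>\<open>measure_of\<close> takes the intended values only if the given set function is
  countably additive; naming the supremum inside \<open>positive_part\<close> allows this to be
  proved first.\<close>

definition upper_variation :: "(real ^ 'n) set \<Rightarrow> ennreal" where
  "upper_variation A = (SUP B\<in>{B \<in> sets borel. B \<subseteq> A}. ennreal (\<rho> B))"

lemma upper_variation_superadditive:
  assumes "A \<in> sets borel" "B \<in> sets borel" "A \<inter> B = {}"
  shows "upper_variation A + upper_variation B \<le> upper_variation (A \<union> B)"
proof -
  have pair: "ennreal (\<rho> C) + ennreal (\<rho> D) \<le> upper_variation (A \<union> B)"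
    if CD: "C \<in> sets borel" "C \<subseteq> A" "D \<in> sets borel" "D \<subseteq> B" for C D
  proof -
    \<comment> \<open>\<open>ennreal\<close> truncates negative values to 0 and is not additive on
      them, so sets of negative mass are replaced by the empty set.\<close>
    define C' where "C' = (if \<rho> C \<ge> 0 then C else {})"
    define D' where "D' = (if \<rho> D \<ge> 0 then D else {})"
    have pos: "\<rho> C' \<ge> 0" "\<rho> D' \<ge> 0" "ennreal (\<rho> C) = ennreal (\<rho> C')" "ennreal (\<rho> D) = ennreal (\<rho> D')"
      using signed_borel_measure_empty[OF \<rho>] by (auto simp: C'_def D'_def ennreal_neg)
    have sub: "C' \<in> sets borel" "C' \<subseteq> A" "D' \<in> sets borel" "D' \<subseteq> B"
      using CD by (auto simp: C'_def D'_def)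
    have "ennreal (\<rho> C) + ennreal (\<rho> D) = ennreal (\<rho> C' + \<rho> D')" using pos by simp
    also have "\<rho> C' + \<rho> D' = \<rho> (C' \<union> D')"
      using sub assms(3) by (intro signed_borel_measure_Un[OF \<rho>, symmetric]) auto
    also have "ennreal \<dots> \<le> upper_variation (A \<union> B)"
      unfolding upper_variation_def using sub by (intro SUP_upper) auto
    finally show ?thesis .
  qed
  have "upper_variation A + upper_variation B =
      (SUP C\<in>{C \<in> sets borel. C \<subseteq> A}. ennreal (\<rho> C) + upper_variation B)"
    unfolding upper_variation_def by (subst ennreal_SUP_add_left) auto
  also have "\<dots> \<le> upper_variation (A \<union> B)"
  proof (rule SUP_least)
    fix C assume C: "C \<in> {C \<in> sets borel. C \<subseteq> A}"
    have "ennreal (\<rho> C) + upper_variation B = (SUP D\<in>{D \<in> sets borel. D \<subseteq> B}. ennreal (\<rho> C) + ennreal (\<rho> D))"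
      unfolding upper_variation_def by (subst ennreal_SUP_add_right) auto
    also have "\<dots> \<le> upper_variation (A \<union> B)"
      using C by (intro SUP_least pair) auto
    finally show "ennreal (\<rho> C) + upper_variation B \<le> upper_variation (A \<union> B)" .
  qed
  finally show ?thesis .
qed

text \<open>Superadditivity on finite unions gives one inequality. For the other a subset
  \<open>B\<close> of the union is cut along the \<open>A i\<close>; truncating negative terms at 0
  only increases the sum.\<close>

lemma countably_additive_upper_variation: "countably_additive (sets borel) upper_variation"
proof (rule countably_additiveI)
  fix A :: "nat \<Rightarrow> (real ^ 'n) set"
  assume A: "range A \<subseteq> sets borel" "disjoint_family A" "(\<Union>i. A i) \<in> sets borel"
  have finite: "(\<Sum>i<n. upper_variation (A i)) \<le> upper_variation (\<Union>i<n. A i)" for n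
  proof (induction n)
    case (Suc n)
    have "(\<Sum>i<Suc n. upper_variation (A i)) \<le> upper_variation (\<Union>i<n. A i) + upper_variation (A n)"
      using Suc by (simp add: add_right_mono)
    also have "\<dots> \<le> upper_variation ((\<Union>i<n. A i) \<union> A n)"
    proof (rule upper_variation_superadditive)
      show "(\<Union>i<n. A i) \<in> sets borel" "A n \<in> sets borel" using A(1) by auto
      have "A i \<inter> A n = {}" if "i < n" for i
        using A(2) that by (auto simp: disjoint_family_on_def)
      then show "(\<Union>i<n. A i) \<inter> A n = {}" by blast
    qed
    also have "(\<Union>i<n. A i) \<union> A n = (\<Union>i<Suc n. A i)" by (auto simp: less_Suc_eq)
    finally show ?case .
  qed simp
  have "upper_variation (\<Union>i<n. A i) \<le> upper_variation (\<Union>i. A i)" for n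
    unfolding upper_variation_def by (intro SUP_subset_mono) auto
  with finite have "(\<Sum>i<n. upper_variation (A i)) \<le> upper_variation (\<Union>i. A i)" for n
    using order_trans by blast
  then have "(\<Sum>i. upper_variation (A i)) \<le> upper_variation (\<Union>i. A i)"
    unfolding suminf_eq_SUP by (rule SUP_least)
  moreover have "upper_variation (\<Union>i. A i) \<le> (\<Sum>i. upper_variation (A i))"
    unfolding upper_variation_def[of "\<Union>i. A i"]
  proof (rule SUP_least)
    fix B assume "B \<in> {B \<in> sets borel. B \<subseteq> (\<Union>i. A i)}"
    then have B: "B \<in> sets borel" "B = (\<Union>i. B \<inter> A i)" by auto
    have "(\<lambda>i. \<rho> (B \<inter> A i)) sums \<rho> (\<Union>i. B \<inter> A i)"
      using A B(1) by (intro signed_borel_measure_sums[OF \<rho>]) (auto simp: disjoint_family_on_def)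
    then have "ennreal (\<rho> B) \<le> (\<Sum>i. ennreal (\<rho> (B \<inter> A i)))"
      using B(2) sums_imp_ennreal_le_suminf by simp
    also have "\<dots> \<le> (\<Sum>i. upper_variation (A i))"
      unfolding upper_variation_def using A(1) B(1)
      by (intro suminf_le SUP_upper) auto
    finally show "ennreal (\<rho> B) \<le> (\<Sum>i. upper_variation (A i))" .
  qed
  ultimately show "(\<Sum>i. upper_variation (A i)) = upper_variation (\<Union>i. A i)" by (rule antisym)
qed

lemma sets_positive_part [simp, measurable_cong]: "sets (positive_part \<rho>) = sets borel"
  using sets.sigma_sets_eq[of borel] by (simp add: positive_part_def sets_measure_of_conv)

lemma space_positive_part [simp]: "space (positive_part \<rho>) = UNIV"
  by (simp add: positive_part_def space_measure_of_conv)

lemma emeasure_positive_part: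
  assumes "A \<in> sets borel"
  shows "emeasure (positive_part \<rho>) A = (SUP B\<in>{B \<in> sets borel. B \<subseteq> A}. ennreal (\<rho> B))"
proof -
  have "emeasure (positive_part \<rho>) A = upper_variation A"
  proof (rule emeasure_measure_of)
    show "positive_part \<rho> = measure_of UNIV (sets borel) upper_variation"
      by (simp add: positive_part_def upper_variation_def[abs_def])
    have "upper_variation {} = 0"
      using signed_borel_measure_empty[OF \<rho>] by (simp add: upper_variation_def image_def)
    then show "positive (sets (positive_part \<rho>)) upper_variation" by (simp add: positive_def)
    show "countably_additive (sets (positive_part \<rho>)) upper_variation"
      using countably_additive_upper_variation by simp
  qed (use assms in auto)
  then show ?thesis by (simp add: upper_variation_def)
qed

lemma finite_measure_positive_part: "finite_measure (positive_part \<rho>)"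
proof
  obtain C where C: "\<And>B. B \<in> sets borel \<Longrightarrow> \<bar>\<rho> B\<bar> \<le> C" using signed_borel_measure_bounded[OF \<rho>] by blast
  have "emeasure (positive_part \<rho>) UNIV \<le> ennreal C"
    using C abs_le_D1 by (subst emeasure_positive_part) (auto intro!: SUP_least ennreal_leI)
  then show "emeasure (positive_part \<rho>) (space (positive_part \<rho>)) \<noteq> \<infinity>"
    using ennreal_less_top[of C] by (auto simp: top_unique)
qed

end

section \<open>Push forwards, supports and integrability\<close>

lemma positive_part_cong:
  assumes "\<And>A. A \<in> sets borel \<Longrightarrow> \<rho> A = \<rho>' A"
  shows "positive_part \<rho> = positive_part \<rho>'"
proof -
  have "(\<lambda>B. ennreal (\<rho> B)) ` {B \<in> sets borel. B \<subseteq> A} = (\<lambda>B. ennreal (\<rho>' B)) ` {B \<in> sets borel. B \<subseteq> A}" for A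
    using assms by (intro image_cong) auto
  then show ?thesis by (simp add: positive_part_def)
qed

lemma signed_integral_cong:
  assumes "\<And>A. A \<in> sets borel \<Longrightarrow> \<rho> A = \<rho>' A"
  shows "signed_integral \<rho> f = signed_integral \<rho>' f"
  using positive_part_cong[of \<rho> \<rho>'] positive_part_cong[of "\<lambda>A. - \<rho> A" "\<lambda>A. - \<rho>' A"] assms
  by (simp add: signed_integral_def negative_part_def)

lemma signed_integral_uminus_measure:
  "signed_integral (\<lambda>A. - \<rho> A) f = - signed_integral \<rho> f"
  by (simp add: signed_integral_def negative_part_def)

lemma signed_borel_measure_push_forward:
  fixes S :: "real ^ 'n::finite \<Rightarrow> real ^ 'n"
  assumes \<rho>: "signed_borel_measure \<rho>" and S: "S \<in> borel \<rightarrow>\<^sub>M borel"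
  shows "signed_borel_measure (push_forward S \<rho>)"
  unfolding signed_borel_measure_def push_forward_def
proof (intro conjI allI impI)
  show "\<rho> (S -` {}) = 0" using \<rho> by (simp add: signed_borel_measure_empty)
  fix A :: "nat \<Rightarrow> (real ^ 'n) set" assume A: "range A \<subseteq> sets borel" "disjoint_family A"
  have "S -` A i \<in> sets borel" for i
    using measurable_sets[OF S, of "A i"] A(1) by auto
  then have "(\<lambda>i. \<rho> (S -` A i)) sums \<rho> (\<Union>i. S -` A i)"
    using A(2) by (intro signed_borel_measure_sums[OF \<rho>]) (auto simp: disjoint_family_on_def)
  then show "(\<lambda>i. \<rho> (S -` A i)) sums \<rho> (S -` (\<Union>i. A i))" by (simp add: vimage_UN)
qed

lemma positive_part_push_forward:
  assumes \<rho>: "signed_borel_measure \<rho>" and S: "S \<in> borel \<rightarrow>\<^sub>M borel" and R: "R \<in> borel \<rightarrow>\<^sub>M borel"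
    and inv: "\<And>x. S (R x) = x" "\<And>x. R (S x) = x"
  shows "positive_part (push_forward S \<rho>) = distr (positive_part \<rho>) borel S"
proof (rule measure_eqI)
  note pf = signed_borel_measure_push_forward[OF \<rho> S]
  show "sets (positive_part (push_forward S \<rho>)) = sets (distr (positive_part \<rho>) borel S)"
    using sets_positive_part[OF pf] by simp
  fix A assume "A \<in> sets (positive_part (push_forward S \<rho>))"
  then have A: "A \<in> sets borel" using sets_positive_part[OF pf] by simp
  have v: "S -` B \<in> sets borel" "R -` B \<in> sets borel" if "B \<in> sets borel" for B
    using measurable_sets[OF S that] measurable_sets[OF R that] by auto
  have Sm: "S \<in> positive_part \<rho> \<rightarrow>\<^sub>M borel"
    using S measurable_cong_sets[OF sets_positive_part[OF \<rho>] refl] by blast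
  have "(\<lambda>B. ennreal (\<rho> (S -` B))) ` {B \<in> sets borel. B \<subseteq> A} = (\<lambda>B. ennreal (\<rho> B)) ` {B \<in> sets borel. B \<subseteq> S -` A}"
  proof (intro equalityI subsetI)
    fix y assume "y \<in> (\<lambda>B. ennreal (\<rho> (S -` B))) ` {B \<in> sets borel. B \<subseteq> A}"
    then obtain B where "B \<in> sets borel" "B \<subseteq> A" "y = ennreal (\<rho> (S -` B))" by blast
    then show "y \<in> (\<lambda>B. ennreal (\<rho> B)) ` {B \<in> sets borel. B \<subseteq> S -` A}"
      using v(1) by (intro image_eqI[of _ _ "S -` B"]) auto
  next
    fix y assume "y \<in> (\<lambda>B. ennreal (\<rho> B)) ` {B \<in> sets borel. B \<subseteq> S -` A}"
    then obtain B where B: "B \<in> sets borel" "B \<subseteq> S -` A" "y = ennreal (\<rho> B)" by blast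
    have "S -` (R -` B) = B" using inv by auto
    moreover have "R -` B \<subseteq> A" using B(2) inv(1) by (metis subsetD subsetI vimageE vimageI2)
    ultimately show "y \<in> (\<lambda>B. ennreal (\<rho> (S -` B))) ` {B \<in> sets borel. B \<subseteq> A}"
      using B v(2) by (intro image_eqI[of _ _ "R -` B"]) auto
  qed
  then have "emeasure (positive_part (push_forward S \<rho>)) A = emeasure (positive_part \<rho>) (S -` A)"
    using v(1)[OF A] A by (simp add: emeasure_positive_part[OF pf] emeasure_positive_part[OF \<rho>] push_forward_def)
  then show "emeasure (positive_part (push_forward S \<rho>)) A = emeasure (distr (positive_part \<rho>) borel S) A"
    using A Sm space_positive_part[OF \<rho>] by (simp add: emeasure_distr)
qed

lemma negative_part_push_forward:
  assumes \<rho>: "signed_borel_measure \<rho>" and S: "S \<in> borel \<rightarrow>\<^sub>M borel" and R: "R \<in> borel \<rightarrow>\<^sub>M borel"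
    and inv: "\<And>x. S (R x) = x" "\<And>x. R (S x) = x"
  shows "negative_part (push_forward S \<rho>) = distr (negative_part \<rho>) borel S"
  using positive_part_push_forward[OF signed_borel_measure_uminus[OF \<rho>] S R inv]
  by (simp add: negative_part_def push_forward_def[abs_def])

lemma signed_integral_push_forward:
  fixes f :: "real ^ 'n::finite \<Rightarrow> 'b::{banach, second_countable_topology}"
  assumes \<rho>: "signed_borel_measure \<rho>" and S: "S \<in> borel \<rightarrow>\<^sub>M borel" and R: "R \<in> borel \<rightarrow>\<^sub>M borel"
    and inv: "\<And>x. S (R x) = x" "\<And>x. R (S x) = x" and f: "f \<in> borel_measurable borel"
  shows "signed_integral (push_forward S \<rho>) f = signed_integral \<rho> (\<lambda>x. f (S x))"
proof -
  have Sm: "S \<in> positive_part \<rho> \<rightarrow>\<^sub>M borel" "S \<in> negative_part \<rho> \<rightarrow>\<^sub>M borel"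
    using S measurable_cong_sets[OF sets_positive_part[OF \<rho>] refl]
      measurable_cong_sets[OF sets_positive_part[OF signed_borel_measure_uminus[OF \<rho>]] refl]
    unfolding negative_part_def by blast+
  show ?thesis
    unfolding signed_integral_def positive_part_push_forward[OF assms(1-5)] negative_part_push_forward[OF assms(1-5)]
    using Sm f by (simp add: integral_distr)
qed

text \<open>For \<open>B\<close> inside \<open>A\<close>, the mass of \<open>B\<close> is that of
  \<open>A\<close> minus that of \<open>A - B\<close>, hence at most the mass of \<open>A\<close>
  plus the negative part of \<open>A\<close>. The supremum over \<open>B\<close> gives one
  inequality, and the sign-reversed measure gives the other.\<close>

lemma measure_positive_part_minus_negative_part:
  assumes \<rho>: "signed_borel_measure \<rho>" and A: "A \<in> sets borel"
  shows "measure (positive_part \<rho>) A - measure (negative_part \<rho>) A = \<rho> A"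
proof -
  have le: "measure (positive_part \<mu>) A \<le> \<mu> A + measure (negative_part \<mu>) A"
    if \<mu>: "signed_borel_measure \<mu>" for \<mu> :: "(real ^ 'a) set \<Rightarrow> real"
  proof -
    note \<mu>' = signed_borel_measure_uminus[OF \<mu>]
    interpret P: finite_measure "positive_part \<mu>" by (rule finite_measure_positive_part[OF \<mu>])
    interpret N: finite_measure "negative_part \<mu>"
      unfolding negative_part_def by (rule finite_measure_positive_part[OF \<mu>'])
    have *: "\<mu> B \<le> \<mu> A + measure (negative_part \<mu>) A" if B: "B \<in> sets borel" "B \<subseteq> A" for B
    proof -
      have "ennreal (- \<mu> (A - B)) \<le> emeasure (negative_part \<mu>) A"
        unfolding negative_part_def emeasure_positive_part[OF \<mu>' A]
        using A B by (intro SUP_upper2[of "A - B"]) auto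
      then have "- \<mu> (A - B) \<le> measure (negative_part \<mu>) A \<or> - \<mu> (A - B) \<le> 0"
        by (auto simp: N.emeasure_eq_measure ennreal_le_iff2)
      then have "- \<mu> (A - B) \<le> measure (negative_part \<mu>) A"
        using measure_nonneg[of "negative_part \<mu>" A] by linarith
      then show ?thesis using signed_borel_measure_Diff[OF \<mu> A B] by simp
    qed
    have "emeasure (positive_part \<mu>) A \<le> ennreal (\<mu> A + measure (negative_part \<mu>) A)"
      unfolding emeasure_positive_part[OF \<mu> A] using * by (intro SUP_least ennreal_leI) auto
    moreover have "0 \<le> \<mu> A + measure (negative_part \<mu>) A"
      using *[of "{}"] signed_borel_measure_empty[OF \<mu>] by simp
    ultimately show ?thesis by (simp add: P.emeasure_eq_measure)
  qed
  show ?thesis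
    using le[OF \<rho>] le[OF signed_borel_measure_uminus[OF \<rho>]] by (simp add: negative_part_def)
qed

lemma signed_support_uminus: "signed_support (\<lambda>A. - \<rho> A) = signed_support \<rho>"
  by (simp add: signed_support_def)

text \<open>The complement of the support is a possibly uncountable union of open sets on which the
  measure vanishes; Lindelof's theorem reduces it to a countable union of null sets.\<close>

lemma AE_positive_part_support:
  assumes \<rho>: "signed_borel_measure \<rho>"
  shows "AE x in positive_part \<rho>. x \<in> signed_support \<rho>"
proof -
  define \<U> where "\<U> = {U. open U \<and> (\<forall>A\<in>sets borel. A \<subseteq> U \<longrightarrow> \<rho> A = 0)}"
  obtain \<V> where \<V>: "\<V> \<subseteq> \<U>" "countable \<V>" "\<Union>\<V> = \<Union>\<U>"
    using Lindelof[of \<U>] by (auto simp: \<U>_def)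
  have "U \<in> null_sets (positive_part \<rho>)" if "U \<in> \<U>" for U
  proof -
    have U: "U \<in> sets borel" using that by (simp add: \<U>_def)
    have "emeasure (positive_part \<rho>) U \<le> 0"
      unfolding emeasure_positive_part[OF \<rho> U] using that by (intro SUP_least) (auto simp: \<U>_def)
    then show ?thesis using U sets_positive_part[OF \<rho>] by auto
  qed
  then have "(\<Union>U\<in>\<V>. U) \<in> null_sets (positive_part \<rho>)"
    using \<V>(1,2) by (intro null_sets_UN') auto
  then have "\<Union>\<V> \<in> null_sets (positive_part \<rho>)" by simp
  moreover have "{x \<in> space (positive_part \<rho>). x \<notin> signed_support \<rho>} \<subseteq> \<Union>\<V>"
    unfolding \<V>(3) by (auto simp: \<U>_def signed_support_def)
  ultimately show ?thesis by (rule AE_I')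
qed

lemma integrable_positive_part:
  fixes f :: "real ^ 'n::finite \<Rightarrow> 'b::{banach, second_countable_topology}"
  assumes \<rho>: "signed_borel_measure \<rho>" and K: "compact (signed_support \<rho>)" and f: "continuous_on UNIV f"
  shows "integrable (positive_part \<rho>) f"
proof -
  interpret finite_measure "positive_part \<rho>" by (rule finite_measure_positive_part[OF \<rho>])
  have "bounded (f ` signed_support \<rho>)"
    using K by (intro compact_imp_bounded compact_continuous_image continuous_on_subset[OF f]) auto
  then obtain B where B: "\<forall>y\<in>f ` signed_support \<rho>. norm y \<le> B" unfolding bounded_iff by blast
  show ?thesis
  proof (rule integrable_const_bound)
    show "AE x in positive_part \<rho>. norm (f x) \<le> B"
      using AE_positive_part_support[OF \<rho>] by eventually_elim (use B in auto)
    show "f \<in> borel_measurable (positive_part \<rho>)"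
      using borel_measurable_continuous_onI[OF f] measurable_cong_sets[OF sets_positive_part[OF \<rho>] refl] by blast
  qed
qed

section \<open>Integration against an admissible measure\<close>

context
  fixes \<rho> :: "(real ^ 'n::finite) set \<Rightarrow> real"
  assumes adm: "admissible \<rho>"
begin

lemma admissible_signed_borel_measure: "signed_borel_measure \<rho>" "signed_borel_measure (\<lambda>A. - \<rho> A)"
  using adm by (auto simp: admissible_def signed_borel_measure_uminus)

lemma admissible_integrable:
  fixes f :: "real ^ 'n \<Rightarrow> 'b::{banach, second_countable_topology}"
  assumes "continuous_on UNIV f"
  shows "integrable (positive_part \<rho>) f" "integrable (negative_part \<rho>) f"
  using adm assms unfolding negative_part_def
  by (auto intro!: integrable_positive_part signed_borel_measure_uminus simp: admissible_def signed_support_uminus)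

lemma signed_integral_add:
  fixes f g :: "real ^ 'n \<Rightarrow> 'b::{banach, second_countable_topology}"
  assumes "continuous_on UNIV f" "continuous_on UNIV g"
  shows "signed_integral \<rho> (\<lambda>x. f x + g x) = signed_integral \<rho> f + signed_integral \<rho> g"
  using admissible_integrable[OF assms(1)] admissible_integrable[OF assms(2)]
  by (simp add: signed_integral_def)

lemma signed_integral_linear:
  assumes L: "bounded_linear L" and f: "continuous_on UNIV f"
  shows "signed_integral \<rho> (\<lambda>x. L (f x)) = L (signed_integral \<rho> f)"
  using integral_bounded_linear[OF L admissible_integrable(1)[OF f]]
    integral_bounded_linear[OF L admissible_integrable(2)[OF f]]
  by (simp add: signed_integral_def linear_diff bounded_linear.linear[OF L])

lemma finite_measure_parts: "finite_measure (positive_part \<rho>)" "finite_measure (negative_part \<rho>)"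
  using finite_measure_positive_part admissible_signed_borel_measure by (auto simp: negative_part_def)

lemma measure_parts_eq: "measure (positive_part \<rho>) UNIV = measure (negative_part \<rho>) UNIV"
  using measure_positive_part_minus_negative_part[OF admissible_signed_borel_measure(1), of UNIV] adm
  by (simp add: admissible_def)

lemma space_parts: "space (positive_part \<rho>) = UNIV" "space (negative_part \<rho>) = UNIV"
  using space_positive_part admissible_signed_borel_measure by (auto simp: negative_part_def)

lemma signed_integral_const:
  fixes c :: "'b::{banach, second_countable_topology}"
  shows "signed_integral \<rho> (\<lambda>x. c) = 0"
proof -
  interpret P: finite_measure "positive_part \<rho>" by (rule finite_measure_parts)
  interpret N: finite_measure "negative_part \<rho>" by (rule finite_measure_parts)
  show ?thesis using measure_parts_eq by (simp add: signed_integral_def space_parts)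
qed

lemma signed_integral_cong_support:
  fixes f g :: "real ^ 'n \<Rightarrow> 'b::{banach, second_countable_topology}"
  assumes f: "continuous_on UNIV f" and g: "continuous_on UNIV g"
    and eq: "\<And>x. x \<in> signed_support \<rho> \<Longrightarrow> f x = g x"
  shows "signed_integral \<rho> f = signed_integral \<rho> g"
proof -
  have "AE x in positive_part \<rho>. f x = g x"
    using AE_positive_part_support[OF admissible_signed_borel_measure(1)]
    by (rule eventually_mono) (rule eq)
  moreover have "AE x in negative_part \<rho>. f x = g x"
    using AE_positive_part_support[OF admissible_signed_borel_measure(2)]
    unfolding negative_part_def signed_support_uminus by (rule eventually_mono) (rule eq)
  ultimately show ?thesis
    using admissible_integrable[OF f] admissible_integrable[OF g]
    by (auto simp: signed_integral_def intro!: arg_cong2[where f = "(-)"] integral_cong_AE)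
qed

end

text \<open>The fixed point is the barycenter of the total variation of \<open>\<rho>\<close>.\<close>

lemma fixed_point_if_push_forward_uminus:
  fixes L :: "real ^ 'n::finite \<Rightarrow> real ^ 'n"
  assumes adm: "admissible \<rho>" and L: "bounded_linear L" and T: "\<And>x. T x = L x + z"
    and R: "R \<in> borel \<rightarrow>\<^sub>M borel" and inv: "\<And>x. T (R x) = x" "\<And>x. R (T x) = x"
    and push: "\<And>A. A \<in> sets borel \<Longrightarrow> push_forward T \<rho> A = - \<rho> A"
  shows "\<exists>b. T b = b"
proof -
  note \<rho> = admissible_signed_borel_measure[OF adm]
  let ?P = "positive_part \<rho>" and ?N = "negative_part \<rho>"
  interpret P: finite_measure ?P by (rule finite_measure_parts[OF adm])
  interpret N: finite_measure ?N by (rule finite_measure_parts[OF adm])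
  have Tc: "continuous_on UNIV T"
    unfolding T using L by (intro continuous_on_add continuous_on_const linear_continuous_on)
  then have Tm: "T \<in> borel \<rightarrow>\<^sub>M borel" by (rule borel_measurable_continuous_onI)
  have Tm': "T \<in> ?P \<rightarrow>\<^sub>M borel" "T \<in> ?N \<rightarrow>\<^sub>M borel"
    using Tm measurable_cong_sets[OF sets_positive_part[OF \<rho>(1)] refl]
      measurable_cong_sets[OF sets_positive_part[OF \<rho>(2)] refl]
    unfolding negative_part_def by blast+
  \<comment> \<open>The negative part is the positive part of the sign-reversed measure, so
    \<open>T\<close> carries each Jordan part onto the other.\<close>
  have "distr ?P borel T = ?N"
    using positive_part_push_forward[OF \<rho>(1) Tm R inv] positive_part_cong[of "push_forward T \<rho>" "\<lambda>A. - \<rho> A"] push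
    by (simp add: negative_part_def)
  then have 1: "(LINT x|?N. x) = (LINT x|?P. T x)"
    using integral_distr[OF Tm'(1), of "\<lambda>x. x"] by simp
  have "distr ?N borel T = ?P"
    using negative_part_push_forward[OF \<rho>(1) Tm R inv] positive_part_cong[of "\<lambda>A. - push_forward T \<rho> A" "\<lambda>A. \<rho> A"] push
    by (simp add: negative_part_def)
  then have 2: "(LINT x|?P. x) = (LINT x|?N. T x)"
    using integral_distr[OF Tm'(2), of "\<lambda>x. x"] by simp
  define m where "m = measure ?P UNIV"
  have m': "measure ?N UNIV = m" using measure_parts_eq[OF adm] by (simp add: m_def)
  note id = admissible_integrable[OF adm continuous_on_id]
  \<comment> \<open>Otherwise both Jordan parts vanish, and so does the first moment, against
    admissibility.\<close>
  have "m \<noteq> 0"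
  proof
    assume "m = 0"
    have "(LINT x|M. x) = 0" if "finite_measure M" "measure M UNIV = 0" "space M = UNIV" for M :: "(real ^ 'n) measure"
    proof -
      interpret M: finite_measure M by (rule that)
      have "AE x in M. x = 0"
        using that sets.top[of M] by (intro AE_I'[of UNIV]) (auto simp: null_sets_def M.emeasure_eq_measure)
      then show ?thesis by (rule integral_eq_zero_AE)
    qed
    then have "signed_integral \<rho> (\<lambda>x. x) = 0"
      using \<open>m = 0\<close> m' finite_measure_parts[OF adm] space_parts[OF adm] by (simp add: signed_integral_def m_def)
    then show False using adm by (simp add: admissible_def)
  qed
  \<comment> \<open>The first moment of the total variation, whose mass is \<open>2 * m\<close>.
    Exchanging the Jordan parts preserves their sum, so \<open>c\<close> satisfies a fixed point
    equation, which becomes \<open>T b = b\<close> after division by the mass.\<close>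
  define c where "c = (LINT x|?P. x) + (LINT x|?N. x)"
  have TP: "(LINT x|?P. T x) = L (LINT x|?P. x) + m *\<^sub>R z"
    using id integral_bounded_linear[OF L id(1)] integrable_bounded_linear[OF L id(1)]
    by (simp add: T m_def space_parts[OF adm])
  have TN: "(LINT x|?N. T x) = L (LINT x|?N. x) + m *\<^sub>R z"
    using id integral_bounded_linear[OF L id(2)] integrable_bounded_linear[OF L id(2)]
    by (simp add: T m' space_parts[OF adm])
  have "c = (LINT x|?N. T x) + (LINT x|?P. T x)" unfolding c_def by (simp only: 1[symmetric] 2[symmetric])
  also have "\<dots> = L c + (2 * m) *\<^sub>R z"
    unfolding TP TN c_def mult_2 scaleR_left_distrib linear_add[OF bounded_linear.linear[OF L]]
    by (simp only: add_ac)
  finally have "c = L c + (2 * m) *\<^sub>R z" .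
  then have "inverse (2 * m) *\<^sub>R c = inverse (2 * m) *\<^sub>R (L c + (2 * m) *\<^sub>R z)" by simp
  also have "\<dots> = L (inverse (2 * m) *\<^sub>R c) + z"
    using \<open>m \<noteq> 0\<close> by (simp add: scaleR_right_distrib linear_scale[OF bounded_linear.linear[OF L]])
  finally show ?thesis by (intro exI[of _ "inverse (2 * m) *\<^sub>R c"]) (simp add: T)
qed

section \<open>Minimality of extremals\<close>

text \<open>The chain rule for line gradients asks for a C^1 outer function, so truncations and
  cutoffs are built from powers q > 1 of the positive part.\<close>

lemma has_derivative_max_powr:
  fixes q :: real assumes "q > 1"
  shows "((\<lambda>t. max 0 t powr q) has_real_derivative q * max 0 t powr (q - 1)) (at t)"
proof -
  consider "t > 0" | "t < 0" | "t = 0" by linarith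
  then show ?thesis
  proof cases
    case 1
    have "((\<lambda>t. t powr q) has_real_derivative q * t powr (q - 1)) (at t)"
      using 1 by (auto intro!: derivative_eq_intros)
    then have "((\<lambda>t. max 0 t powr q) has_real_derivative q * t powr (q - 1)) (at t)"
      by (rule has_field_derivative_transform_within_open[where S = "{0<..}"]) (use 1 in auto)
    then show ?thesis using 1 by (simp add: max_def)
  next
    case 2
    have "((\<lambda>t. 0) has_real_derivative 0) (at t)" by simp
    then have "((\<lambda>t. max 0 t powr q) has_real_derivative 0) (at t)"
      by (rule has_field_derivative_transform_within_open[where S = "{..<0}"]) (use 2 in auto)
    then show ?thesis using 2 by (simp add: max_def)
  next
    case 3
    have "((\<lambda>h. \<bar>h\<bar> powr (q - 1)) \<longlongrightarrow> 0 powr (q - 1)) (at (0::real))"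
      using assms by (intro tendsto_powr2 tendsto_const) (auto intro!: tendsto_eq_intros)
    then have lim: "((\<lambda>h. \<bar>h\<bar> powr (q - 1)) \<longlongrightarrow> 0) (at (0::real))" by simp
    have "((\<lambda>h. max 0 h powr q / h) \<longlongrightarrow> 0) (at 0)"
    proof (rule Lim_null_comparison[OF always_eventually lim], rule allI)
      fix h :: real
      show "norm (max 0 h powr q / h) \<le> \<bar>h\<bar> powr (q - 1)"
        by (cases "h > 0") (auto simp: max_def powr_diff intro!: divide_nonneg_nonpos)
    qed
    then show ?thesis using 3 by (simp add: DERIV_def)
  qed
qed

lemma continuous_max_powr:
  fixes q :: real assumes "q > 0" shows "continuous_on UNIV (\<lambda>t. c * max 0 t powr q)"
  using assms by (intro continuous_on_mult continuous_on_const continuous_on_powr' continuous_on_max continuous_on_id) auto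

lemma line_gradient_inner_self:
  "line_gradient (\<lambda>x :: 'a::euclidean_space. (x - b) \<bullet> (x - b)) (\<lambda>x. 2 *\<^sub>R (x - b))"
  by (rule line_gradient_C1) (auto intro!: derivative_eq_intros continuous_intros simp: inner_commute)

lemma line_gradient_inner: "line_gradient (\<lambda>x :: 'a::euclidean_space. x \<bullet> w) (\<lambda>x. w)"
  by (rule line_gradient_C1) (auto intro!: derivative_eq_intros simp: inner_commute)

text \<open>The linear function \<open>x \<bullet> w\<close>, cut off outside a ball containing the support.\<close>

lemma exists_D1p_nonzero_integral:
  fixes \<rho> :: "(real ^ 'n::finite) set \<Rightarrow> real"
  assumes p: "real CARD('n) < p" and adm: "admissible \<rho>"
  shows "\<exists>u \<in> D1p p. signed_integral \<rho> u \<noteq> 0"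
proof -
  have p0: "p > 0" using p by (meson le_less_trans of_nat_0_le_iff)
  define w where "w = signed_integral \<rho> (\<lambda>y. y)"
  have w: "w \<noteq> 0" using adm by (simp add: w_def admissible_def)
  have "bounded (signed_support \<rho>)" using adm by (simp add: admissible_def compact_imp_bounded)
  then obtain R where R: "R > 0" "\<And>x. x \<in> signed_support \<rho> \<Longrightarrow> norm x \<le> R"
    unfolding bounded_pos by blast
  define f where "f t = max 0 t powr 2" for t :: real
  define f' where "f' t = 2 * max 0 t powr (2 - 1)" for t :: real
  have f: "(f has_real_derivative f' t) (at t)" for t
    unfolding f_def f'_def by (rule has_derivative_max_powr) simp
  have cf': "continuous_on UNIV f'" unfolding f'_def by (rule continuous_max_powr) simp
  define A where "A x = (x :: real ^ 'n) \<bullet> x" for x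
  have A: "line_gradient A (\<lambda>x. 2 *\<^sub>R x)"
    using line_gradient_inner_self[of 0] by (simp add: A_def[abs_def])
  define B where "B x = f (A x - R\<^sup>2)" for x
  have B: "line_gradient B (\<lambda>x. f' (A x - R\<^sup>2) *\<^sub>R 2 *\<^sub>R x)"
    unfolding B_def
  proof (rule line_gradient_chain[OF A, of "\<lambda>t. f (t - R\<^sup>2)" "\<lambda>t. f' (t - R\<^sup>2)"])
    show "((\<lambda>t. f (t - R\<^sup>2)) has_real_derivative f' (y - R\<^sup>2)) (at y)" for y
    proof -
      have "((\<lambda>t. t - R\<^sup>2) has_real_derivative 1) (at y)" by (auto intro!: derivative_eq_intros)
      from DERIV_chain2[OF f this] show ?thesis by simp
    qed
    show "continuous_on UNIV (\<lambda>t. f' (t - R\<^sup>2))"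
      by (rule continuous_on_compose2[OF cf']) (auto intro!: continuous_intros)
  qed
  \<comment> \<open>The cutoff: \<open>B\<close> is 0 on the ball of radius \<open>R\<close>, where
    \<open>C\<close> is 1, and it exceeds 1 beyond radius \<open>R + 1\<close>, where
    \<open>C\<close> and \<open>f' (1 - B x)\<close> are 0, because (R + 1)^2 > R^2 + 1.\<close>
  define C where "C x = f (1 - B x)" for x
  have C: "line_gradient C (\<lambda>x. (- f' (1 - B x)) *\<^sub>R f' (A x - R\<^sup>2) *\<^sub>R 2 *\<^sub>R x)"
    unfolding C_def
  proof (rule line_gradient_chain[OF B, of "\<lambda>t. f (1 - t)" "\<lambda>t. - f' (1 - t)"])
    show "((\<lambda>t. f (1 - t)) has_real_derivative - f' (1 - y)) (at y)" for y
    proof -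
      have "((\<lambda>t. 1 - t) has_real_derivative -1) (at y)" by (auto intro!: derivative_eq_intros)
      from DERIV_chain2[OF f this] show ?thesis by simp
    qed
    show "continuous_on UNIV (\<lambda>t. - f' (1 - t))"
      by (intro continuous_on_minus continuous_on_compose2[OF cf']) (auto intro!: continuous_intros)
  qed
  define u where "u x = C x * (x \<bullet> w)" for x
  define G where "G x = C x *\<^sub>R w + (x \<bullet> w) *\<^sub>R (- f' (1 - B x)) *\<^sub>R f' (A x - R\<^sup>2) *\<^sub>R 2 *\<^sub>R x" for x
  have u: "line_gradient u G"
    unfolding u_def G_def by (rule line_gradient_mult[OF C line_gradient_inner])
  have cA: "continuous_on UNIV A" and cB: "continuous_on UNIV B" and cC: "continuous_on UNIV C"
    using line_gradientD(1)[OF A] line_gradientD(1)[OF B] line_gradientD(1)[OF C] .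
  have "continuous_on UNIV (\<lambda>x. f' (1 - B x))" "continuous_on UNIV (\<lambda>x. f' (A x - R\<^sup>2))"
    by (rule continuous_on_compose2[OF cf'], auto intro!: continuous_on_diff cA cB)+
  then have cG: "continuous_on UNIV G"
    unfolding G_def by (intro continuous_on_add continuous_on_scaleR continuous_on_const continuous_on_inner
        continuous_on_id cC continuous_on_minus)
  have "integrable lborel (\<lambda>x. norm (G x) powr p)"
  proof (rule integrable_continuous_compact_support[where R = "R + 1"])
    show "continuous_on UNIV (\<lambda>x. norm (G x) powr p)"
      using cG p0 by (intro continuous_on_powr' continuous_on_norm continuous_on_const) auto
    fix x :: "real ^ 'n" assume x: "R + 1 < norm x"
    have "(R + 1)\<^sup>2 < (norm x)\<^sup>2" using x R(1) by (intro power_strict_mono) auto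
    then have "A x - R\<^sup>2 > 1" using R(1) by (simp add: A_def power2_norm_eq_inner power2_sum)
    then have "B x > 1" unfolding B_def f_def using less_1_mult[of "A x - R\<^sup>2" "A x - R\<^sup>2"] by (simp add: power2_eq_square)
    then show "norm (G x) powr p = 0" by (simp add: G_def C_def f_def f'_def)
  qed
  then have "u \<in> D1p p" using D1p_iff[OF p] u by blast
  moreover have "signed_integral \<rho> u = w \<bullet> w"
  proof -
    have lin: "continuous_on UNIV (\<lambda>x :: real ^ 'n. x \<bullet> w)"
      by (intro continuous_on_inner continuous_on_id continuous_on_const)
    have "signed_integral \<rho> u = signed_integral \<rho> (\<lambda>x. x \<bullet> w)"
    proof (rule signed_integral_cong_support[OF adm line_gradientD(1)[OF u] lin])
      fix x assume "x \<in> signed_support \<rho>"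
      then have "(norm x)\<^sup>2 \<le> R\<^sup>2" using R by (intro power_mono) auto
      then have "A x - R\<^sup>2 \<le> 0" by (simp add: A_def power2_norm_eq_inner)
      then have "B x = 0" by (simp add: B_def f_def max_def)
      then show "u x = x \<bullet> w" by (simp add: u_def C_def f_def)
    qed
    also have "\<dots> = w \<bullet> w"
      using signed_integral_linear[OF adm bounded_linear_inner_left continuous_on_id, of w] by (simp add: w_def)
    finally show ?thesis .
  qed
  ultimately show ?thesis using w by (intro bexI[of _ u]) auto
qed

section \<open>The Morrey constant and the minimality of extremals\<close>

lemma morrey_ratio_le_seminorm: "ereal (morrey_ratio p \<rho> u) \<le> morrey_seminorm p \<rho> u"
proof -
  have "(\<lambda>y. y) \<in> (similarities :: (real ^ 'a \<Rightarrow> real ^ 'a) set)"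
    unfolding similarities_def
    by (intro CollectI exI[of _ 1] exI[of _ "mat 1"] exI[of _ 0])
      (auto simp: orthogonal_matrix_def transpose_mat)
  then have "ereal (morrey_ratio p (push_forward (\<lambda>y. y) \<rho>) u) \<le> morrey_seminorm p \<rho> u"
    unfolding morrey_seminorm_def by (rule SUP_upper)
  then show ?thesis by (simp add: push_forward_def[abs_def])
qed

lemma grad_norm_nonneg: "grad_norm p u \<ge> 0"
  by (simp add: grad_norm_def)

lemma morrey_constant_pos:
  fixes \<rho> :: "(real ^ 'n::finite) set \<Rightarrow> real"
  assumes p: "real CARD('n) < p" and adm: "admissible \<rho>"
  shows "morrey_constant p \<rho> > 0"
proof -
  obtain u where u: "u \<in> D1p p" "signed_integral \<rho> u \<noteq> 0" using exists_D1p_nonzero_integral[OF assms] by blast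
  define r where "r = morrey_ratio p \<rho> u"
  have r: "r > 0" using u adm by (simp add: r_def morrey_ratio_def admissible_def)
  have le: "r \<le> C * grad_norm p u" if "\<forall>u \<in> D1p p. morrey_seminorm p \<rho> u \<le> ereal (C * grad_norm p u)" for C
  proof -
    have "ereal r \<le> ereal (C * grad_norm p u)"
      using morrey_ratio_le_seminorm[of p \<rho> u] that u(1) unfolding r_def by (meson order_trans)
    then show ?thesis by simp
  qed
  show ?thesis
  proof (cases "grad_norm p u = 0")
    \<comment> \<open>A function with zero gradient norm and positive ratio would rule out every
      constant; the infimum of the empty set is infinite, hence positive.\<close>
    case True
    then have "morrey_constant p \<rho> = Inf {}"
      unfolding morrey_constant_def using le r by (intro arg_cong[of _ _ Inf]) fastforce
    then show ?thesis by (simp add: top_ereal_def)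
  next
    case False
    then have g: "grad_norm p u > 0" using grad_norm_nonneg[of p u] by simp
    have "ereal (r / grad_norm p u) \<le> morrey_constant p \<rho>"
      unfolding morrey_constant_def
      using le g by (intro Inf_greatest) (auto simp: pos_divide_le_eq)
    moreover have "0 < ereal (r / grad_norm p u)" using r g by simp
    ultimately show ?thesis by (rule less_le_trans[rotated])
  qed
qed

text \<open>If the constant is infinite, then the finiteness of the seminorm of \<open>v\<close> forces its gradient
  to vanish, as \<open>\<infinity> * 0 = 0\<close> in the extended reals.\<close>

lemma extremal_grad_norm_le:
  fixes \<rho> :: "(real ^ 'n::finite) set \<Rightarrow> real"
  assumes p: "real CARD('n) < p" and adm: "admissible \<rho>" and v: "extremal p \<rho> v"
    and attained: "morrey_seminorm p \<rho> v = ereal (morrey_ratio p \<rho> v)"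
    and u: "u \<in> D1p p" "signed_integral \<rho> u = signed_integral \<rho> v"
  shows "grad_norm p v \<le> grad_norm p u"
proof (rule ccontr)
  assume "\<not> grad_norm p v \<le> grad_norm p u"
  then have less: "grad_norm p u < grad_norm p v" by simp
  define r where "r = morrey_ratio p \<rho> v"
  have r: "ereal r = morrey_constant p \<rho> * ereal (grad_norm p v)"
    using v attained by (simp add: extremal_def r_def)
  have gv: "grad_norm p v > 0" using less grad_norm_nonneg[of p u] by simp
  \<comment> \<open>The constant is finite here because its product with the positive norm of
    \<open>v\<close> is the real number \<open>r\<close>.\<close>
  obtain C where C: "morrey_constant p \<rho> = ereal C" "C > 0"
    using r gv morrey_constant_pos[OF p adm] by (cases "morrey_constant p \<rho>") auto
  have rC: "r = C * grad_norm p v" using r by (simp add: C(1))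
  have r_le: "r \<le> D * grad_norm p u" if "\<forall>u \<in> D1p p. morrey_seminorm p \<rho> u \<le> ereal (D * grad_norm p u)" for D
  proof -
    have "ereal r \<le> morrey_seminorm p \<rho> u"
      using morrey_ratio_le_seminorm[of p \<rho> u] u(2) by (simp add: r_def morrey_ratio_def)
    also have "\<dots> \<le> ereal (D * grad_norm p u)" using that u(1) by blast
    finally show ?thesis by simp
  qed
  let ?D = "{ereal C | C. \<forall>u \<in> D1p p. morrey_seminorm p \<rho> u \<le> ereal (C * grad_norm p u)}"
  have InfD: "Inf ?D = ereal C" using C(1) by (simp add: morrey_constant_def)
  show False
  proof (cases "grad_norm p u = 0")
    case True
    have "?D \<noteq> {}"
    proof
      assume "?D = {}"
      then have "Inf ?D = \<infinity>" by (simp only:) (simp add: top_ereal_def)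
      with InfD show False by simp
    qed
    then obtain D where "\<forall>u \<in> D1p p. morrey_seminorm p \<rho> u \<le> ereal (D * grad_norm p u)" by blast
    from r_le[OF this] True rC C(2) gv show False by (simp add: mult_le_0_iff)
  next
    case False
    then have gu: "grad_norm p u > 0" using grad_norm_nonneg[of p u] by simp
    \<comment> \<open>\<open>u\<close> has the same ratio as \<open>v\<close> at the identity
      similarity, so every valid constant, and with it the infimum \<open>C\<close>, is at least
      \<open>r / grad_norm p u\<close>.\<close>
    have "ereal (r / grad_norm p u) \<le> Inf ?D"
      using r_le gu by (intro Inf_greatest) (auto simp: pos_divide_le_eq)
    then have "r / grad_norm p u \<le> C" using InfD by simp
    then have "C * grad_norm p v \<le> C * grad_norm p u" using gu by (simp add: pos_divide_le_eq rC)
    then show False using C(2) less by simp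
  qed
qed

lemma extremal_energy_le:
  fixes \<rho> :: "(real ^ 'n::finite) set \<Rightarrow> real"
  assumes p: "real CARD('n) < p" and "admissible \<rho>" "extremal p \<rho> v"
    "morrey_seminorm p \<rho> v = ereal (morrey_ratio p \<rho> v)"
    and v: "line_gradient v G"
    and u: "line_gradient u H" "integrable lborel (\<lambda>x. norm (H x) powr p)"
    and eq: "signed_integral \<rho> u = signed_integral \<rho> v"
  shows "(LINT x|lborel. norm (G x) powr p) \<le> (LINT x|lborel. norm (H x) powr p)"
proof (rule ccontr)
  assume "\<not> ?thesis"
  moreover have "(LINT x|lborel. norm (H x) powr p) \<ge> 0" by simp
  moreover have "p > 0" using p by (meson le_less_trans of_nat_0_le_iff)
  ultimately have "grad_norm p u < grad_norm p v"
    unfolding grad_norm_eq[OF v] grad_norm_eq[OF u(1)] by (intro powr_less_mono2) auto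
  moreover have "u \<in> D1p p" using D1p_iff[OF p] u by blast
  ultimately show False using extremal_grad_norm_le[OF assms(1-4)] eq by fastforce
qed

section \<open>Strict convexity of the energy density\<close>

lemma powr_weighted_convex:
  fixes x y s p :: real
  assumes "x \<ge> 0" "y \<ge> 0" "0 \<le> s" "s \<le> 1" "p \<ge> 1"
  shows "((1 - s) * x + s * y) powr p \<le> (1 - s) * x powr p + s * y powr p"
proof -
  have small: "(t * z) powr p \<le> t * z powr p" if "0 \<le> t" "t \<le> 1" "z \<ge> 0" for t z :: real
  proof -
    have "t powr p \<le> t"
      using that assms(5) powr_le_one_le[of t p] by (cases "t = 0") auto
    then show ?thesis using that by (simp add: powr_mult mult_right_mono)
  qed
  consider "x = 0" | "y = 0" | "x > 0" "y > 0" using assms by linarith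
  then show ?thesis
  proof cases
    case 1 then show ?thesis using small[of s y] assms by simp
  next
    case 2 then show ?thesis using small[of "1 - s" x] assms by simp
  next
    case 3
    then show ?thesis
      using convex_onD[OF powr_convex[OF assms(5)], of s x y] assms by simp
  qed
qed

lemma norm_powr_weighted_convex:
  fixes a b :: "'a::real_normed_vector"
  assumes "0 \<le> s" "s \<le> 1" "p \<ge> 1"
  shows "norm ((1 - s) *\<^sub>R a + s *\<^sub>R b) powr p \<le> (1 - s) * norm a powr p + s * norm b powr p"
proof -
  have "norm ((1 - s) *\<^sub>R a + s *\<^sub>R b) \<le> (1 - s) * norm a + s * norm b"
    using norm_triangle_ineq[of "(1 - s) *\<^sub>R a" "s *\<^sub>R b"] assms by simp
  then have "norm ((1 - s) *\<^sub>R a + s *\<^sub>R b) powr p \<le> ((1 - s) * norm a + s * norm b) powr p"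
    using assms by (intro powr_mono2) auto
  also have "\<dots> \<le> (1 - s) * norm a powr p + s * norm b powr p"
    using assms by (intro powr_weighted_convex) auto
  finally show ?thesis .
qed

lemma powr_midpoint_strict:
  fixes x y p :: real
  assumes "0 \<le> x" "x < y" "p > 1"
  shows "((x + y) / 2) powr p < (x powr p + y powr p) / 2"
proof -
  define m where "m = (x + y) / 2"
  have m: "x < m" "m < y" "m > 0" "m - x = y - m" using assms by (auto simp: m_def field_simps)
  have cont: "continuous_on {a..b} (\<lambda>t. t powr p)" if "0 \<le> a" for a b :: real
    using that assms by (intro continuous_on_powr' continuous_on_id continuous_on_const) auto
  have der: "((\<lambda>t. t powr p) has_real_derivative p * t powr (p - 1)) (at t)" if "t > 0" for t :: real
    using that by (auto intro!: derivative_eq_intros)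
  obtain \<xi> where \<xi>: "x < \<xi>" "\<xi> < m" "m powr p - x powr p = (m - x) * (p * \<xi> powr (p - 1))"
  proof -
    have "\<exists>l z. x < z \<and> z < m \<and> ((\<lambda>t. t powr p) has_real_derivative l) (at z) \<and> m powr p - x powr p = (m - x) * l"
    proof (rule MVT[OF m(1) cont])
      show "(\<lambda>t. t powr p) differentiable (at t)" if "x < t" "t < m" for t
        using der[of t] that assms by (auto simp: real_differentiable_def)
    qed (use assms in auto)
    then obtain l z where "x < z" "z < m" "((\<lambda>t. t powr p) has_real_derivative l) (at z)" "m powr p - x powr p = (m - x) * l" by blast
    moreover have "l = p * z powr (p - 1)"
      using DERIV_unique[OF _ der[of z]] calculation assms by auto
    ultimately show thesis using that by blast
  qed
  obtain \<eta> where \<eta>: "m < \<eta>" "\<eta> < y" "y powr p - m powr p = (y - m) * (p * \<eta> powr (p - 1))"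
    using MVT2[OF m(2), of "\<lambda>t. t powr p" "\<lambda>t. p * t powr (p - 1)"] der m(3) by force
  have "\<xi> powr (p - 1) < \<eta> powr (p - 1)" using \<xi> \<eta> assms by (intro powr_less_mono2) auto
  then have "(m - x) * (p * \<xi> powr (p - 1)) < (m - x) * (p * \<eta> powr (p - 1))"
    using m assms by (intro mult_strict_left_mono) auto
  then have "m powr p - x powr p < y powr p - m powr p" using \<xi>(3) \<eta>(3) m(4) by simp
  then show ?thesis by (simp add: m_def)
qed

text \<open>Equality is forced twice: strict convexity of t^p on the half-line makes the norms
  equal, and then equality in the triangle inequality makes the vectors point in the same
  direction.\<close>

lemma norm_powr_midpoint_eq:
  fixes a b :: "'a::real_inner"
  assumes p: "p > 1" and eq: "(norm a powr p + norm b powr p) / 2 \<le> norm ((1 / 2) *\<^sub>R (a + b)) powr p"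
  shows "a = b"
proof -
  have "norm ((1 / 2) *\<^sub>R (a + b)) \<le> (norm a + norm b) / 2"
    using norm_triangle_ineq[of a b] by simp
  then have le: "norm ((1 / 2) *\<^sub>R (a + b)) powr p \<le> ((norm a + norm b) / 2) powr p"
    using p by (intro powr_mono2) auto
  have "norm a = norm b"
  proof (rule ccontr)
    assume "norm a \<noteq> norm b"
    then have "((norm a + norm b) / 2) powr p < (norm a powr p + norm b powr p) / 2"
      using powr_midpoint_strict[of "norm a" "norm b" p] powr_midpoint_strict[of "norm b" "norm a" p] p
      by (cases "norm a < norm b") (auto simp: add.commute)
    with le eq show False by simp
  qed
  then have "norm a powr p \<le> norm ((1 / 2) *\<^sub>R (a + b)) powr p" using eq by simp
  then have "norm a \<le> norm ((1 / 2) *\<^sub>R (a + b))"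
    using p by (meson le_less_trans linorder_not_le norm_ge_zero not_less_iff_gr_or_eq powr_less_mono2 zero_less_one less_trans)
  then have "2 * norm a \<le> norm (a + b)" by simp
  then have "norm (a + b) = norm a + norm b"
    using norm_triangle_ineq[of a b] \<open>norm a = norm b\<close> by simp
  then have "norm a *\<^sub>R b = norm b *\<^sub>R a" by (simp add: norm_triangle_eq)
  then show ?thesis using \<open>norm a = norm b\<close> by (cases "norm a = 0") auto
qed

text \<open>Morrey's inequality on a ball around \<open>x\<close> containing \<open>y\<close>, with
  an arbitrarily small energy bound.\<close>

lemma line_gradient_zero_imp_constant:
  fixes u :: "'a::euclidean_space \<Rightarrow> real"
  assumes u: "line_gradient u G" and zero: "AE x in lborel. G x = 0"
  shows "u x = u y"
proof (cases "x = y")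
  case False
  \<comment> \<open>A vanishing gradient has zero energy for every exponent, so any exponent above
    the dimension serves.\<close>
  define p where "p = real DIM('a) + 1"
  define r where "r = 2 * dist x y"
  define K where "K = \<bar>morrey_factor TYPE('a) p * r powr (1 - real DIM('a) / p)\<bar>"
  have p: "real DIM('a) < p" "p > 0" by (auto simp: p_def)
  have r: "r > 0" using False by (simp add: r_def)
  have "AE z in lborel. ennreal (norm (G z) powr p) * indicator (ball x r) z = 0"
    using zero by eventually_elim simp
  then have z: "(\<integral>\<^sup>+z. ennreal (norm (G z) powr p) * indicator (ball x r) z \<partial>lborel) = 0"
    by (subst nn_integral_cong_AE) auto
  have "\<bar>u x - u y\<bar> \<le> 0"
  proof (rule field_le_epsilon)
    fix e :: real assume e: "e > 0"
    define E where "E = (e / (K + 1)) powr p"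
    have K: "K \<ge> 0" by (simp add: K_def)
    have E: "E > 0" using e K by (simp add: E_def)
    have "E powr (1 / p) = e / (K + 1)" using e K p by (simp add: E_def powr_powr)
    moreover have "\<bar>u x - u y\<bar> \<le> morrey_factor TYPE('a) p * r powr (1 - real DIM('a) / p) * E powr (1 / p)"
      using r False E z by (intro morrey_ball[OF p(1) u r E, of x]) (auto simp: r_def)
    moreover have "\<dots> \<le> K * E powr (1 / p)" unfolding K_def by (intro mult_right_mono) auto
    ultimately have "\<bar>u x - u y\<bar> \<le> K * (e / (K + 1))" by simp
    also have "\<dots> \<le> e" using e K by (simp add: divide_simps)
    finally show "\<bar>u x - u y\<bar> \<le> 0 + e" by simp
  qed
  then show ?thesis by simp
qed simp

lemma integral_le_imp_AE_eq:
  fixes f g :: "'a \<Rightarrow> real"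
  assumes "integrable M f" "integrable M g" "AE x in M. f x \<le> g x" "integral\<^sup>L M g \<le> integral\<^sup>L M f"
  shows "AE x in M. f x = g x"
proof -
  have "integral\<^sup>L M f \<le> integral\<^sup>L M g" using assms by (intro integral_mono_AE)
  then have "(LINT x|M. g x - f x) = 0" using assms by simp
  moreover have "AE x in M. 0 \<le> g x - f x" using assms(3) by eventually_elim simp
  ultimately have "AE x in M. g x - f x = 0"
    using assms integral_nonneg_eq_0_iff_AE[of M "\<lambda>x. g x - f x"] by simp
  then show ?thesis by eventually_elim simp
qed

section \<open>Harnack's inequality\<close>

text \<open>The variational form of being p-harmonic outside \<open>K\<close>. It is phrased through
  the gradient \<open>G\<close> alone, so it does not change when a constant is added to the
  function.\<close>

definition minimizes_energy_off :: "real \<Rightarrow> 'a set \<Rightarrow> ('a::euclidean_space \<Rightarrow> 'a) \<Rightarrow> bool" where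
  "minimizes_energy_off p K G \<longleftrightarrow> (\<forall>\<phi> H. line_gradient \<phi> H \<longrightarrow> integrable lborel (\<lambda>x. norm (G x + H x) powr p) \<longrightarrow>
     (\<forall>x\<in>K. \<phi> x = 0) \<longrightarrow> (LINT x|lborel. norm (G x) powr p) \<le> (LINT x|lborel. norm (G x + H x) powr p))"

lemma minimizes_energy_offD:
  assumes "minimizes_energy_off p K G" "line_gradient \<phi> H" "integrable lborel (\<lambda>x. norm (G x + H x) powr p)"
    and "\<And>x. x \<in> K \<Longrightarrow> \<phi> x = 0"
  shows "(LINT x|lborel. norm (G x) powr p) \<le> (LINT x|lborel. norm (G x + H x) powr p)"
  using assms unfolding minimizes_energy_off_def by blast

lemma minimizes_energy_off_mono:
  "minimizes_energy_off p K G \<Longrightarrow> K \<subseteq> K' \<Longrightarrow> minimizes_energy_off p K' G"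
  unfolding minimizes_energy_off_def by blast

text \<open>The competitor replaces \<open>v\<close> by \<open>v - P (v - M)\<close>, where \<open>P\<close> vanishes on the negative axis and
  has slope strictly between \<open>0\<close> and \<open>1\<close> on the positive one.\<close>

lemma energy_minimizer_le:
  fixes v :: "'a::euclidean_space \<Rightarrow> real"
  assumes "p > 0" and v: "line_gradient v G" and int: "integrable lborel (\<lambda>x. norm (G x) powr p)"
    and minimal: "minimizes_energy_off p K G"
    and K: "k \<in> K" "\<And>x. x \<in> K \<Longrightarrow> v x \<le> M"
  shows "v x \<le> M"
proof -
  define m where "m t = max 0 t powr 2" for t :: real
  define m' where "m' t = 2 * max 0 t powr (2 - 1)" for t :: real
  have m: "(m has_real_derivative m' t) (at t)" for t
    unfolding m_def m'_def by (rule has_derivative_max_powr) simp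
  have m0: "m t \<ge> 0" for t by (simp add: m_def)
  have cm: "continuous_on UNIV m" "continuous_on UNIV m'"
    using continuous_max_powr[of 2 1] continuous_max_powr[of "2 - 1" 2] by (simp_all add: m_def[abs_def] m'_def[abs_def])
  \<comment> \<open>With m(t) = t^2 for t > 0, the slope of m / (1 + m) is 2t / (1 + t^2)^2, which
    is below 1 because 2t \<le> 1 + t^2 < (1 + t^2)^2.\<close>
  define P where "P t = m t / (1 + m t)" for t
  define P' where "P' t = m' t / (1 + m t)\<^sup>2" for t
  have P: "(P has_real_derivative P' t) (at t)" for t
  proof -
    have "1 + m t \<noteq> 0" using m0[of t] by linarith
    then show ?thesis
      unfolding P_def P'_def
      by (auto intro!: derivative_eq_intros m simp: power2_eq_square field_simps)
  qed
  have cP': "continuous_on UNIV P'"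
    unfolding P'_def using m0 cm
    by (intro continuous_on_divide continuous_on_power continuous_on_add continuous_on_const)
      (auto simp: add_nonneg_eq_0_iff)
  have P'_bounds: "0 \<le> P' t" "P' t < 1" for t
  proof -
    show "0 \<le> P' t" by (simp add: P'_def m'_def)
    have "m' t < (1 + m t)\<^sup>2"
    proof (cases "t > 0")
      case True
      have "0 \<le> (t - 1)\<^sup>2" by simp
      then have "2 * t \<le> 1 + t\<^sup>2" by (simp add: power2_diff)
      also have "\<dots> < (1 + t\<^sup>2)\<^sup>2" using True by (simp add: power2_eq_square algebra_simps add_pos_pos)
      finally show ?thesis using True by (simp add: m_def m'_def max_def)
    qed (simp add: m_def m'_def max_def)
    then show "P' t < 1" using m0[of t] by (simp add: P'_def)
  qed
  define d where "d x = P' (v x - M)" for x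
  have d: "0 \<le> d x" "d x < 1" for x using P'_bounds by (auto simp: d_def)
  define \<phi> where "\<phi> x = - P (v x - M)" for x
  have \<phi>: "line_gradient \<phi> (\<lambda>x. (- d x) *\<^sub>R G x)"
    unfolding \<phi>_def d_def
  proof (rule line_gradient_chain[OF v, of "\<lambda>y. - P (y - M)" "\<lambda>y. - P' (y - M)"])
    show "((\<lambda>y. - P (y - M)) has_real_derivative - P' (y - M)) (at y)" for y
    proof -
      have "((\<lambda>t. t - M) has_real_derivative 1) (at y)" by (auto intro!: derivative_eq_intros)
      from DERIV_minus[OF DERIV_chain2[OF P this]] show ?thesis by simp
    qed
    show "continuous_on UNIV (\<lambda>y. - P' (y - M))"
      by (intro continuous_on_minus continuous_on_compose2[OF cP']) (auto intro!: continuous_intros)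
  qed
  have eq: "norm (G x + (- d x) *\<^sub>R G x) powr p = (1 - d x) powr p * norm (G x) powr p" for x
  proof -
    have "G x + (- d x) *\<^sub>R G x = (1 - d x) *\<^sub>R G x" by (simp add: algebra_simps)
    then show ?thesis using d[of x] by (simp add: powr_mult)
  qed
  have le: "norm (G x + (- d x) *\<^sub>R G x) powr p \<le> norm (G x) powr p" for x
    unfolding eq using d[of x] \<open>p > 0\<close> by (intro mult_left_le_one_le powr_le1) auto
  have int': "integrable lborel (\<lambda>x. norm (G x + (- d x) *\<^sub>R G x) powr p)"
  proof (rule Bochner_Integration.integrable_bound[OF int])
    show "(\<lambda>x. norm (G x + (- d x) *\<^sub>R G x) powr p) \<in> borel_measurable lborel"
      using line_gradientD(2)[OF v] line_gradientD(2)[OF \<phi>] by simp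
    show "AE x in lborel. norm (norm (G x + (- d x) *\<^sub>R G x) powr p) \<le> norm (norm (G x) powr p)"
      using le by (intro always_eventually allI) simp
  qed
  have \<phi>K: "\<phi> x = 0" if "x \<in> K" for x
    using K(2)[OF that] by (simp add: \<phi>_def P_def m_def)
  \<comment> \<open>The competitor's gradient is \<open>(1 - d x) *\<^sub>R G x\<close> and cannot
    have larger norm, so minimality forces equality almost everywhere. Hence \<phi> has zero
    gradient; it is constant, and 0 because it vanishes at \<open>k\<close>.\<close>
  have "AE x in lborel. norm (G x + (- d x) *\<^sub>R G x) powr p = norm (G x) powr p"
    using minimizes_energy_offD[OF minimal \<phi> int' \<phi>K] le by (intro integral_le_imp_AE_eq int int') auto
  then have "AE x in lborel. (- d x) *\<^sub>R G x = 0"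
  proof eventually_elim
    case (elim x)
    show ?case
    proof (rule ccontr)
      assume "(- d x) *\<^sub>R G x \<noteq> 0"
      then have *: "d x > 0" "G x \<noteq> 0" using d(1)[of x] by (auto simp: less_le)
      then have "(1 - d x) powr p < 1 powr p" using d(2)[of x] \<open>p > 0\<close> by (intro powr_less_mono2) auto
      then have "(1 - d x) powr p * norm (G x) powr p < norm (G x) powr p" using * by simp
      with elim[unfolded eq] show False by linarith
    qed
  qed
  then have "\<phi> x = \<phi> k" by (rule line_gradient_zero_imp_constant[OF \<phi>])
  then have "P (v x - M) = 0" using \<phi>K[OF K(1)] by (simp add: \<phi>_def)
  then show ?thesis using m0[of "v x - M"] by (auto simp: P_def m_def add_nonneg_eq_0_iff max_def split: if_splits)
qed

text \<open>The competitor \<open>v - \<tau> \<psi> w powr (1 - p)\<close> with \<open>w = M + \<epsilon> - v\<close>: its gradient is a convex combination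
  \<open>(1 - s) Dv + s B\<close> wherever \<open>\<psi> > 0\<close>, so that convexity of the energy density turns minimality directly
  into the logarithmic Caccioppoli estimate.\<close>

lemma log_caccioppoli_pointwise:
  fixes G D :: "'a::real_normed_vector"
  assumes p: "p > 1" and q: "q > 0" and w: "w > 0" and \<tau>: "0 \<le> \<tau>" "\<tau> * (p - 1) * q powr p * w powr (- p) \<le> 1"
  shows "norm (G + (- \<tau>) *\<^sub>R (q powr p *\<^sub>R ((1 - p) * w powr (1 - p)) *\<^sub>R ((- 1 / w) *\<^sub>R G)
        + w powr (1 - p) *\<^sub>R (p * q powr (p - 1)) *\<^sub>R D)) powr p
      + \<tau> * (p - 1) * (q powr p * norm ((- 1 / w) *\<^sub>R G) powr p)
    \<le> norm G powr p + \<tau> * (p - 1) * ((p / (p - 1)) powr p * norm D powr p)"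
proof -
  \<comment> \<open>\<open>s\<close> is read off the coefficient of \<open>G\<close> in the
    competitor's gradient, and \<open>B\<close> is chosen so that the remaining term is
    \<open>s *\<^sub>R B\<close>. The hypothesis on \<tau> says s \<le> 1, and s |G|^p is the
    logarithmic energy density q^p |G / w|^p up to the factor \<tau> (p - 1).\<close>
  define s where "s = \<tau> * (p - 1) * q powr p * w powr (- p)"
  define B where "B = (- (w * (p / (p - 1)) / q)) *\<^sub>R D"
  have s: "0 \<le> s" "s \<le> 1" using \<tau> p by (auto simp: s_def)
  have wp: "w powr (1 - p) = w * w powr (- p)" using w powr_add[of w 1 "- p"] by simp
  have qp: "q powr (p - 1) = q powr p / q" using q powr_diff[of q p 1] by simp
  have "G + (- \<tau>) *\<^sub>R (a *\<^sub>R c *\<^sub>R ((- 1 / w) *\<^sub>R G) + e *\<^sub>R f *\<^sub>R D) =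
      (1 + \<tau> * a * c / w) *\<^sub>R G + (- (\<tau> * e * f)) *\<^sub>R D" for a c e f
    by (simp add: algebra_simps)
  then have "G + (- \<tau>) *\<^sub>R (q powr p *\<^sub>R ((1 - p) * w powr (1 - p)) *\<^sub>R ((- 1 / w) *\<^sub>R G)
        + w powr (1 - p) *\<^sub>R (p * q powr (p - 1)) *\<^sub>R D) =
      (1 + \<tau> * q powr p * ((1 - p) * w powr (1 - p)) / w) *\<^sub>R G
        + (- (\<tau> * w powr (1 - p) * (p * q powr (p - 1)))) *\<^sub>R D" .
  also have "1 + \<tau> * q powr p * ((1 - p) * w powr (1 - p)) / w = 1 - s"
    using w by (simp add: s_def wp field_simps)
  also have "(- (\<tau> * w powr (1 - p) * (p * q powr (p - 1)))) *\<^sub>R D = s *\<^sub>R B"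
    using p by (simp add: s_def B_def wp qp mult_ac)
  finally have "norm (G + (- \<tau>) *\<^sub>R (q powr p *\<^sub>R ((1 - p) * w powr (1 - p)) *\<^sub>R ((- 1 / w) *\<^sub>R G)
        + w powr (1 - p) *\<^sub>R (p * q powr (p - 1)) *\<^sub>R D)) powr p \<le> (1 - s) * norm G powr p + s * norm B powr p"
    using norm_powr_weighted_convex[OF s, of p G B] p by simp
  moreover have "s * norm G powr p = \<tau> * (p - 1) * (q powr p * norm ((- 1 / w) *\<^sub>R G) powr p)"
    using w by (simp add: s_def powr_divide powr_minus divide_simps)
  moreover have "s * norm B powr p = \<tau> * (p - 1) * ((p / (p - 1)) powr p * norm D powr p)"
    using w q p by (simp add: s_def B_def powr_mult powr_divide powr_minus divide_simps)
  ultimately show ?thesis by (simp add: algebra_simps)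
qed


text \<open>The cutoff \<open>q\<close> is positive exactly where \<open>r < \<bar>x - b\<bar> < 20 r\<close>. The balls of radius \<open>6 r\<close> centered
  at distance \<open>8 r\<close> from \<open>b\<close> stay in \<open>2 r < \<bar>x - b\<bar> < 14 r\<close>, and one of them contains any two given
  points of the sphere of radius \<open>4 r\<close> that are seen from \<open>b\<close> under an angle of at most \<open>\<pi> / 2\<close>.\<close>

lemma log_caccioppoli:
  fixes v :: "'a::euclidean_space \<Rightarrow> real"
  assumes p: "p > 1" and r: "r > 0" and \<epsilon>: "\<epsilon> > 0"
    and v: "line_gradient v G" and int: "integrable lborel (\<lambda>x. norm (G x) powr p)"
    and minimal: "minimizes_energy_off p (cball b r) G"
    and M: "\<forall>x. r \<le> norm (x - b) \<longrightarrow> v x \<le> M"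
  shows "\<exists>u Gu. line_gradient u Gu \<and> (\<forall>x. r \<le> norm (x - b) \<longrightarrow> u x = ln (M + \<epsilon> - v x)) \<and>
    (\<forall>c \<rho>. (\<forall>x\<in>ball c \<rho>. 2 * r < norm (x - b) \<and> norm (x - b) < 14 * r) \<longrightarrow>
      (\<integral>\<^sup>+x. ennreal (norm (Gu x) powr p) * indicator (ball c \<rho>) x \<partial>lborel) \<le>
      ennreal ((p / (p - 1) * (16040 / 612) / r) powr p * measure lborel (ball b (20 * r))))"
proof -
  \<comment> \<open>a positive \<open>C\<^sup>1\<close> extension of \<open>\<epsilon> - t\<close> from the negative axis to the whole line\<close>
  define W where "W t = \<epsilon> - t + max 0 t powr 2 / \<epsilon>" for t
  define W' where "W' t = -1 + 2 * max 0 t powr (2 - 1) / \<epsilon>" for t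
  have W: "(W has_real_derivative W' t) (at t)" for t
  proof -
    have "((\<lambda>t. \<epsilon> - t) has_real_derivative -1) (at t)" by (auto intro!: derivative_eq_intros)
    then show ?thesis
      unfolding W_def W'_def by (intro DERIV_add DERIV_cdivide has_derivative_max_powr) simp_all
  qed
  have Wpos: "W t > 0" for t
  proof (cases "t > 0")
    case True
    have "\<epsilon> * W t = \<epsilon>\<^sup>2 - \<epsilon> * t + t\<^sup>2"
      using \<epsilon> True by (simp add: W_def max_def field_simps power2_eq_square)
    also have "\<dots> = (\<epsilon> - t / 2)\<^sup>2 + 3 / 4 * t\<^sup>2" by (simp add: power2_eq_square field_simps)
    also have "\<dots> > 0" using True by (intro add_nonneg_pos) auto
    finally show ?thesis using \<epsilon> by (simp add: zero_less_mult_iff)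
  qed (use \<epsilon> in \<open>simp add: W_def max_def\<close>)
  have cW: "continuous_on UNIV W" using W by (auto intro!: continuous_at_imp_continuous_on DERIV_isCont)
  have cW': "continuous_on UNIV W'"
    unfolding W'_def using continuous_max_powr[of "2 - 1" 2] \<epsilon>
    by (intro continuous_on_add continuous_on_const continuous_on_divide) auto
  define u where "u x = ln (W (v x - M))" for x
  define Gu where "Gu x = (W' (v x - M) / W (v x - M)) *\<^sub>R G x" for x
  have u: "line_gradient u Gu"
    unfolding u_def Gu_def
  proof (rule line_gradient_chain[OF v, of "\<lambda>y. ln (W (y - M))" "\<lambda>y. W' (y - M) / W (y - M)"])
    show "((\<lambda>y. ln (W (y - M))) has_real_derivative W' (y - M) / W (y - M)) (at y)" for y
    proof -
      have "((\<lambda>t. t - M) has_real_derivative 1) (at y)" by (auto intro!: derivative_eq_intros)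
      from DERIV_chain2[OF DERIV_ln_divide[OF Wpos] DERIV_chain2[OF W this]] show ?thesis by simp
    qed
    show "continuous_on UNIV (\<lambda>y. W' (y - M) / W (y - M))"
    proof (intro continuous_on_divide)
      show "continuous_on UNIV (\<lambda>y. W' (y - M))" "continuous_on UNIV (\<lambda>y. W (y - M))"
        by (rule continuous_on_compose2[OF cW'] continuous_on_compose2[OF cW], auto intro!: continuous_intros)+
    qed (use Wpos in \<open>auto simp: less_imp_neq[symmetric]\<close>)
  qed
  define A where "A x = (x - b) \<bullet> (x - b)" for x
  have Anorm: "A x = (norm (x - b))\<^sup>2" for x by (simp add: A_def power2_norm_eq_inner)
  \<comment> \<open>A polynomial in the squared distance, positive between the radii r and 20 r; by
    the chain rule its gradient \<open>D\<close> has the scalar factor 401 r^2 - 2 A.\<close>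
  define q where "q x = (A x - r\<^sup>2) * (400 * r\<^sup>2 - A x)" for x
  define D where "D x = (401 * r\<^sup>2 - 2 * A x) *\<^sub>R 2 *\<^sub>R (x - b)" for x
  have q: "line_gradient q D"
    unfolding q_def D_def
    by (rule line_gradient_chain[OF line_gradient_inner_self[of b, folded A_def],
        of "\<lambda>y. (y - r\<^sup>2) * (400 * r\<^sup>2 - y)" "\<lambda>y. 401 * r\<^sup>2 - 2 * y"])
      (auto intro!: derivative_eq_intros continuous_intros simp: algebra_simps)
  define \<psi> where "\<psi> x = max 0 (q x) powr p" for x
  have \<psi>: "line_gradient \<psi> (\<lambda>x. (p * max 0 (q x) powr (p - 1)) *\<^sub>R D x)"
    unfolding \<psi>_def
    by (rule line_gradient_chain[OF q has_derivative_max_powr[OF p] continuous_max_powr]) (use p in simp)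
  \<comment> \<open>This exponential is w^(1-p) where v \<le> M; written through \<open>u\<close>,
    it has a multiple of \<open>Gu\<close> as its gradient.\<close>
  have e: "line_gradient (\<lambda>x. exp ((1 - p) * u x)) (\<lambda>x. ((1 - p) * exp ((1 - p) * u x)) *\<^sub>R Gu x)"
    by (rule line_gradient_chain[OF u]) (auto intro!: derivative_eq_intros continuous_intros)
  \<comment> \<open>\<open>Q\<close> bounds q^p where q > 0, since both factors of q are at most 400
    r^2 there. Together with w \<ge> \<epsilon> this makes \<tau> small enough for the weight s of
    the convex combination to be at most 1.\<close>
  define Q where "Q = (160000 * r ^ 4) powr p"
  define \<tau> where "\<tau> = \<epsilon> powr p / ((p - 1) * (Q + 1))"
  have Q: "Q \<ge> 0" by (simp add: Q_def)
  have \<tau>: "\<tau> > 0" using \<epsilon> p Q by (simp add: \<tau>_def)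
  define \<phi> where "\<phi> x = (- \<tau>) * (\<psi> x * exp ((1 - p) * u x))" for x
  define H where "H x = (- \<tau>) *\<^sub>R (\<psi> x *\<^sub>R ((1 - p) * exp ((1 - p) * u x)) *\<^sub>R Gu x
      + exp ((1 - p) * u x) *\<^sub>R (p * max 0 (q x) powr (p - 1)) *\<^sub>R D x)" for x
  have \<phi>: "line_gradient \<phi> H"
    unfolding \<phi>_def H_def by (rule line_gradient_scale[OF line_gradient_mult[OF \<psi> e]])
  have q_pos: "r < norm (x - b) \<and> norm (x - b) < 20 * r" if "q x > 0" for x
  proof -
    have "0 < r\<^sup>2" using r by simp
    moreover have "(0 < A x - r\<^sup>2 \<and> 0 < 400 * r\<^sup>2 - A x) \<or> (A x - r\<^sup>2 < 0 \<and> 400 * r\<^sup>2 - A x < 0)"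
      using that by (simp add: q_def zero_less_mult_iff)
    ultimately have "r\<^sup>2 < A x \<and> A x < 400 * r\<^sup>2" by linarith
    then have "r\<^sup>2 < (norm (x - b))\<^sup>2" "(norm (x - b))\<^sup>2 < (20 * r)\<^sup>2"
      by (simp_all add: Anorm power_mult_distrib)
    then show ?thesis
      using r power2_less_imp_less[of r "norm (x - b)"] power2_less_imp_less[of "norm (x - b)" "20 * r"] by auto
  qed
  define \<kappa> where "\<kappa> = (p / (p - 1)) powr p"
  \<comment> \<open>Where q > 0, the gradient of q has norm at most 401 r^2 times 2 times 20 r,
    which is 16040 r^3.\<close>
  define Dmax where "Dmax x = (16040 * r ^ 3) powr p * indicator (ball b (20 * r)) x" for x
  have pointwise: "norm (G x + H x) powr p + \<tau> * (p - 1) * (\<psi> x * norm (Gu x) powr p)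
      \<le> norm (G x) powr p + \<tau> * (p - 1) * (\<kappa> * Dmax x)" for x
  proof (cases "q x > 0")
    case False
    then have "\<psi> x = 0" "H x = 0" by (simp_all add: \<psi>_def H_def max_def)
    moreover have "\<tau> * (p - 1) * (\<kappa> * Dmax x) \<ge> 0" using \<tau> p by (simp add: \<kappa>_def Dmax_def)
    ultimately show ?thesis by simp
  next
    case True
    note x = q_pos[OF True]
    have vM: "v x \<le> M" using M x by simp
    define w where "w = M + \<epsilon> - v x"
    have w: "w \<ge> \<epsilon>" "w > 0" using vM \<epsilon> by (auto simp: w_def)
    have Ww: "W (v x - M) = w" "W' (v x - M) = -1" using vM by (simp_all add: W_def W'_def w_def max_def)
    have Gu': "Gu x = (- 1 / w) *\<^sub>R G x" by (simp add: Gu_def Ww)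
    have uw: "exp ((1 - p) * u x) = w powr (1 - p)" using w by (simp add: u_def Ww powr_def)
    have "r\<^sup>2 < (norm (x - b))\<^sup>2" "(norm (x - b))\<^sup>2 < (20 * r)\<^sup>2"
      using x r power_strict_mono[of r "norm (x - b)" 2] power_strict_mono[of "norm (x - b)" "20 * r" 2] by simp_all
    then have A: "r\<^sup>2 < A x" "A x < 400 * r\<^sup>2" by (simp_all add: Anorm power_mult_distrib)
    have "q x \<le> (400 * r\<^sup>2) * (400 * r\<^sup>2)"
      unfolding q_def using A by (intro mult_mono) auto
    also have "\<dots> = 160000 * r ^ 4" by (simp add: power2_eq_square power4_eq_xxxx)
    finally have qQ: "q x powr p \<le> Q" unfolding Q_def using True p by (intro powr_mono2) auto
    have "\<tau> * (p - 1) * q x powr p * w powr (- p) \<le> \<tau> * (p - 1) * (Q + 1) * \<epsilon> powr (- p)"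
      using qQ w \<epsilon> \<tau> p Q by (intro mult_mono powr_mono2') auto
    also have "\<dots> = 1" using p Q \<epsilon> by (simp add: \<tau>_def powr_minus)
    finally have small: "\<tau> * (p - 1) * q x powr p * w powr (- p) \<le> 1" .
    have "norm (D x) = \<bar>401 * r\<^sup>2 - 2 * A x\<bar> * (2 * norm (x - b))"
      unfolding D_def norm_scaleR by (simp only: abs_numeral)
    also have "\<dots> \<le> (401 * r\<^sup>2) * (2 * (20 * r))"
      using A x by (intro mult_mono) auto
    also have "\<dots> = 16040 * r ^ 3" by (simp add: power2_eq_square power3_eq_cube)
    finally have "norm (D x) powr p \<le> (16040 * r ^ 3) powr p" using p by (intro powr_mono2) auto
    then have "norm (D x) powr p \<le> Dmax x" using x by (simp add: Dmax_def dist_norm norm_minus_commute)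
    then have "\<tau> * (p - 1) * (\<kappa> * norm (D x) powr p) \<le> \<tau> * (p - 1) * (\<kappa> * Dmax x)"
      using \<tau> p by (intro mult_left_mono) (auto simp: \<kappa>_def)
    moreover have "norm (G x + H x) powr p + \<tau> * (p - 1) * (\<psi> x * norm (Gu x) powr p)
        \<le> norm (G x) powr p + \<tau> * (p - 1) * (\<kappa> * norm (D x) powr p)"
      using log_caccioppoli_pointwise[OF p True w(2) less_imp_le[OF \<tau>] small, of "G x" "D x"] True
      by (simp add: H_def \<psi>_def uw Gu' \<kappa>_def max_def)
    ultimately show ?thesis by simp
  qed
  have meas [measurable]: "G \<in> borel_measurable borel" "H \<in> borel_measurable borel"
    "Gu \<in> borel_measurable borel" "\<psi> \<in> borel_measurable borel"
    using line_gradientD(2)[OF v] line_gradientD(2)[OF \<phi>] line_gradientD(2)[OF u]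
      line_gradientD(1)[OF \<psi>] by (auto intro: borel_measurable_continuous_onI)
  have fin: "emeasure lborel (ball b (20 * r)) < \<infinity>" by (rule emeasure_lborel_ball_finite)
  have intD: "integrable lborel Dmax"
    unfolding Dmax_def using fin by (intro integrable_mult_right integrable_real_indicator) auto
  have intR: "integrable lborel (\<lambda>x. norm (G x) powr p + \<tau> * (p - 1) * (\<kappa> * Dmax x))"
    using int intD by simp
  have \<psi>0: "\<psi> x \<ge> 0" for x by (simp add: \<psi>_def)
  have k: "\<tau> * (p - 1) > 0" using \<tau> p by simp
  have int1: "integrable lborel (\<lambda>x. norm (G x + H x) powr p)"
  proof (rule Bochner_Integration.integrable_bound[OF intR])
    show "AE x in lborel. norm (norm (G x + H x) powr p) \<le> norm (norm (G x) powr p + \<tau> * (p - 1) * (\<kappa> * Dmax x))"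
    proof (rule always_eventually, rule allI)
      fix x
      have "0 \<le> \<tau> * (p - 1) * (\<psi> x * norm (Gu x) powr p)" using k \<psi>0[of x] by simp
      with pointwise[of x] show "norm (norm (G x + H x) powr p) \<le> norm (norm (G x) powr p + \<tau> * (p - 1) * (\<kappa> * Dmax x))"
        by simp
    qed
  qed simp
  have int2: "integrable lborel (\<lambda>x. \<tau> * (p - 1) * (\<psi> x * norm (Gu x) powr p))"
  proof (rule Bochner_Integration.integrable_bound[OF intR])
    show "AE x in lborel. norm (\<tau> * (p - 1) * (\<psi> x * norm (Gu x) powr p)) \<le> norm (norm (G x) powr p + \<tau> * (p - 1) * (\<kappa> * Dmax x))"
    proof (rule always_eventually, rule allI)
      fix x
      have "0 \<le> \<tau> * (p - 1) * (\<psi> x * norm (Gu x) powr p)" using k \<psi>0[of x] by simp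
      moreover have "0 \<le> norm (G x + H x) powr p" by simp
      ultimately have "norm (\<tau> * (p - 1) * (\<psi> x * norm (Gu x) powr p)) \<le> norm (G x) powr p + \<tau> * (p - 1) * (\<kappa> * Dmax x)"
        using pointwise[of x] by (simp only: real_norm_def abs_of_nonneg)
      then show "norm (\<tau> * (p - 1) * (\<psi> x * norm (Gu x) powr p)) \<le> norm (norm (G x) powr p + \<tau> * (p - 1) * (\<kappa> * Dmax x))"
        by simp
    qed
  qed simp
  have \<phi>0: "\<phi> x = 0" if "x \<in> cball b r" for x
    using q_pos[of x] that norm_minus_commute[of x b] by (cases "q x > 0") (auto simp: \<phi>_def \<psi>_def max_def dist_norm)
  \<comment> \<open>After integration minimality cancels the energies of v and of its competitor,
    and the common factor \<tau> (p - 1) drops out, so the resulting bound is free of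
    \<epsilon>.\<close>
  have "(LINT x|lborel. norm (G x + H x) powr p) + (LINT x|lborel. \<tau> * (p - 1) * (\<psi> x * norm (Gu x) powr p))
      \<le> (LINT x|lborel. norm (G x) powr p) + (LINT x|lborel. \<tau> * (p - 1) * (\<kappa> * Dmax x))"
  proof -
    have "(LINT x|lborel. norm (G x + H x) powr p + \<tau> * (p - 1) * (\<psi> x * norm (Gu x) powr p))
        \<le> (LINT x|lborel. norm (G x) powr p + \<tau> * (p - 1) * (\<kappa> * Dmax x))"
      using pointwise by (intro integral_mono Bochner_Integration.integrable_add int1 int2 intR)
    then show ?thesis
      using int intD by (simp only: Bochner_Integration.integral_add[OF int1 int2]) simp
  qed
  with minimizes_energy_offD[OF minimal \<phi> int1 \<phi>0]
  have "(LINT x|lborel. \<tau> * (p - 1) * (\<psi> x * norm (Gu x) powr p)) \<le> (LINT x|lborel. \<tau> * (p - 1) * (\<kappa> * Dmax x))"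
    by linarith
  then have "\<tau> * (p - 1) * (LINT x|lborel. \<psi> x * norm (Gu x) powr p) \<le> \<tau> * (p - 1) * (LINT x|lborel. \<kappa> * Dmax x)"
    by (simp only: integral_mult_right_zero)
  then have main: "(LINT x|lborel. \<psi> x * norm (Gu x) powr p) \<le> \<kappa> * ((16040 * r ^ 3) powr p * measure lborel (ball b (20 * r)))"
    unfolding mult_le_cancel_left_pos[OF k] by (simp add: Dmax_def)
  have int3: "integrable lborel (\<lambda>x. \<psi> x * norm (Gu x) powr p)"
  proof -
    have "inverse a * (a * y) = y" if "a > 0" for a y :: real using that by simp
    note cancel = this[OF k]
    show ?thesis using integrable_mult_right[OF int2, of "inverse (\<tau> * (p - 1))"] unfolding cancel by simp
  qed
  show ?thesis
  proof (intro exI conjI allI impI)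
    show "line_gradient u Gu" by (rule u)
    show "u x = ln (M + \<epsilon> - v x)" if "r \<le> norm (x - b)" for x
      using M[rule_format, OF that] by (simp add: u_def W_def max_def algebra_simps)
    fix c \<rho> assume inner: "\<forall>x\<in>ball c \<rho>. 2 * r < norm (x - b) \<and> norm (x - b) < 14 * r"
    \<comment> \<open>Between the radii 2r and 14r the factors of q exceed 4r^2 - r^2 = 3r^2 and
      400r^2 - 196r^2 = 204r^2, whose product is 612 r^4.\<close>
    define m where "m = (612 * r ^ 4) powr p"
    have m: "m > 0" using r by (simp add: m_def)
    have \<psi>m: "m \<le> \<psi> x" if "x \<in> ball c \<rho>" for x
    proof -
      have "(2 * r)\<^sup>2 < (norm (x - b))\<^sup>2" "(norm (x - b))\<^sup>2 < (14 * r)\<^sup>2"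
        using inner[rule_format, OF that] r power_strict_mono[of "2 * r" "norm (x - b)" 2]
          power_strict_mono[of "norm (x - b)" "14 * r" 2] by simp_all
      then have "4 * r\<^sup>2 < A x" "A x < 196 * r\<^sup>2" by (simp_all add: Anorm power_mult_distrib)
      then have "(3 * r\<^sup>2) * (204 * r\<^sup>2) \<le> q x" unfolding q_def by (intro mult_mono) auto
      then have "612 * r ^ 4 \<le> q x" by (simp add: power2_eq_square power4_eq_xxxx)
      then show ?thesis unfolding m_def \<psi>_def using r p by (intro powr_mono2) auto
    qed
    have "(\<integral>\<^sup>+x. ennreal (norm (Gu x) powr p) * indicator (ball c \<rho>) x \<partial>lborel) \<le>
        (\<integral>\<^sup>+x. ennreal (inverse m * (\<psi> x * norm (Gu x) powr p)) \<partial>lborel)"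
    proof (intro nn_integral_mono)
      fix x
      show "ennreal (norm (Gu x) powr p) * indicator (ball c \<rho>) x \<le> ennreal (inverse m * (\<psi> x * norm (Gu x) powr p))"
      proof (cases "x \<in> ball c \<rho>")
        case True
        have "m * norm (Gu x) powr p \<le> \<psi> x * norm (Gu x) powr p" using \<psi>m[OF True] by (intro mult_right_mono) auto
        then have "norm (Gu x) powr p \<le> inverse m * (\<psi> x * norm (Gu x) powr p)" using m by (simp add: field_simps)
        then show ?thesis using True by (simp add: ennreal_leI)
      qed simp
    qed
    also have "\<dots> = ennreal (LINT x|lborel. inverse m * (\<psi> x * norm (Gu x) powr p))"
      using m \<psi>0 int3 by (intro nn_integral_eq_integral integrable_mult_right) auto
    also have "\<dots> = ennreal (inverse m * (LINT x|lborel. \<psi> x * norm (Gu x) powr p))" by simp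
    also have "\<dots> \<le> ennreal (inverse m * (\<kappa> * ((16040 * r ^ 3) powr p * measure lborel (ball b (20 * r)))))"
      using main m by (intro ennreal_leI mult_left_mono) auto
    also have "inverse m * (\<kappa> * ((16040 * r ^ 3) powr p * measure lborel (ball b (20 * r)))) =
        (p / (p - 1) * (16040 * r ^ 3) / (612 * r ^ 4)) powr p * measure lborel (ball b (20 * r))"
    proof -
      have "inverse (m0 powr p) * (k0 powr p * (d0 powr p * \<mu>)) = (k0 * d0 / m0) powr p * \<mu>"
        if "m0 > 0" "k0 \<ge> 0" "d0 \<ge> 0" for m0 k0 d0 \<mu> :: real
        using that by (simp add: powr_mult powr_divide divide_simps)
      note rearrange = this
      show ?thesis unfolding m_def \<kappa>_def by (rule rearrange) (use r p in auto)
    qed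
    also have "p / (p - 1) * (16040 * r ^ 3) / (612 * r ^ 4) = p / (p - 1) * (16040 / 612) / r"
    proof -
      have "a * (16040 * r ^ 3) / (612 * r ^ 4) = a * (16040 / 612) / r" for a
        using r by (simp add: field_simps power3_eq_cube power4_eq_xxxx)
      then show ?thesis .
    qed
    finally show "(\<integral>\<^sup>+x. ennreal (norm (Gu x) powr p) * indicator (ball c \<rho>) x \<partial>lborel) \<le>
      ennreal ((p / (p - 1) * (16040 / 612) / r) powr p * measure lborel (ball b (20 * r)))" .
  qed
qed

text \<open>The order of the quantifiers is the point: one \<Lambda> serves all \<open>r\<close>,
  \<open>M\<close> and \<epsilon>. The energy of the logarithm is at most K r^(n-p), and the radius
  6r of the ball supplies the factor (6r)^(1-n/p), so r disappears.\<close>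

lemma harnack_ball:
  fixes v :: "'a::euclidean_space \<Rightarrow> real"
  assumes p: "real DIM('a) < p" and R: "R > 0"
    and v: "line_gradient v G" and int: "integrable lborel (\<lambda>x. norm (G x) powr p)"
    and minimal: "minimizes_energy_off p (cball b R) G"
  shows "\<exists>\<Lambda>. \<forall>r M \<epsilon> e. R \<le> r \<longrightarrow> \<epsilon> > 0 \<longrightarrow> (\<forall>x. r \<le> norm (x - b) \<longrightarrow> v x \<le> M) \<longrightarrow> norm e = 1 \<longrightarrow>
    (\<forall>x\<in>ball (b + (8 * r) *\<^sub>R e) (6 * r). \<forall>y\<in>ball (b + (8 * r) *\<^sub>R e) (6 * r).
      \<bar>ln (M + \<epsilon> - v x) - ln (M + \<epsilon> - v y)\<bar> \<le> \<Lambda>)"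
proof -
  let ?n = "real DIM('a)"
  have n: "?n \<ge> 1" using DIM_positive[where 'a = 'a] by linarith
  have p1: "p > 1" using p n by linarith
  define \<omega> where "\<omega> = measure lborel (ball (0::'a) 1)"
  have \<omega>: "\<omega> > 0" by (simp add: \<omega>_def content_ball_pos)
  define K where "K = (p / (p - 1) * (16040 / 612)) powr p * (\<omega> * 20 ^ DIM('a))"
  have K: "K > 0" using \<omega> p1 by (simp add: K_def)
  define \<Lambda> where "\<Lambda> = morrey_factor TYPE('a) p * 6 powr (1 - ?n / p) * K powr (1 / p)"
  have "\<bar>ln (M + \<epsilon> - v x) - ln (M + \<epsilon> - v y)\<bar> \<le> \<Lambda>"
    if r: "R \<le> r" and \<epsilon>: "\<epsilon> > 0" and M: "\<forall>x. r \<le> norm (x - b) \<longrightarrow> v x \<le> M" and e: "norm e = 1"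
      and xy: "x \<in> ball (b + (8 * r) *\<^sub>R e) (6 * r)" "y \<in> ball (b + (8 * r) *\<^sub>R e) (6 * r)"
    for r M \<epsilon> e x y
  proof -
    have r0: "r > 0" using r R by simp
    have min': "minimizes_energy_off p (cball b r) G"
      by (rule minimizes_energy_off_mono[OF minimal]) (use r in auto)
    obtain u Gu where u: "line_gradient u Gu" "\<forall>x. r \<le> norm (x - b) \<longrightarrow> u x = ln (M + \<epsilon> - v x)"
      and energy: "\<forall>c \<rho>. (\<forall>x\<in>ball c \<rho>. 2 * r < norm (x - b) \<and> norm (x - b) < 14 * r) \<longrightarrow>
        (\<integral>\<^sup>+x. ennreal (norm (Gu x) powr p) * indicator (ball c \<rho>) x \<partial>lborel) \<le>
        ennreal ((p / (p - 1) * (16040 / 612) / r) powr p * measure lborel (ball b (20 * r)))"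
      using log_caccioppoli[OF p1 r0 \<epsilon> v int min' M] by (elim exE conjE)
    have inside: "2 * r < norm (z - b) \<and> norm (z - b) < 14 * r" if "z \<in> ball (b + (8 * r) *\<^sub>R e) (6 * r)" for z
    proof -
      have d: "norm ((b + (8 * r) *\<^sub>R e) - z) < 6 * r" using that by (simp add: dist_norm)
      have e8: "norm ((8 * r) *\<^sub>R e) = 8 * r" using e r0 by simp
      have "norm ((8 * r) *\<^sub>R e) \<le> norm ((b + (8 * r) *\<^sub>R e) - z) + norm (z - b)"
        using norm_triangle_ineq[of "(b + (8 * r) *\<^sub>R e) - z" "z - b"] by (simp add: algebra_simps)
      moreover have "norm (z - b) \<le> norm ((8 * r) *\<^sub>R e) + norm ((b + (8 * r) *\<^sub>R e) - z)"
        using norm_triangle_ineq4[of "(8 * r) *\<^sub>R e" "(b + (8 * r) *\<^sub>R e) - z"] by (simp add: algebra_simps)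
      ultimately show ?thesis using d unfolding e8 by linarith
    qed
    define E where "E = (p / (p - 1) * (16040 / 612) / r) powr p * measure lborel (ball b (20 * r))"
    have "measure lborel (ball b (20 * r)) = \<omega> * (20 * r) ^ DIM('a)"
      using content_ball[of "20 * r" b] content_ball[of 1 "0::'a"] r0 by (simp add: \<omega>_def)
    then have "E = K * (r powr (- p) * r powr ?n)"
    proof -
      have "(a / r) powr p * (\<omega> * (20 * r) ^ DIM('a)) = a powr p * (\<omega> * 20 ^ DIM('a)) * (r powr (- p) * r powr ?n)"
        if "a > 0" for a
        using that r0 by (simp add: powr_divide powr_minus powr_realpow power_mult_distrib divide_simps)
      note rearrange = this
      assume "measure lborel (ball b (20 * r)) = \<omega> * (20 * r) ^ DIM('a)"
      then show ?thesis unfolding E_def K_def by (simp only:) (rule rearrange, use p1 in simp)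
    qed
    then have EK: "E = K * r powr (?n - p)" by (simp add: powr_add[symmetric])
    have E: "E > 0" using K r0 by (simp add: EK)
    have "E powr (1 / p) = K powr (1 / p) * r powr ((?n - p) / p)"
      using K r0 by (simp add: EK powr_mult powr_powr)
    moreover have "r powr (1 - ?n / p) * r powr ((?n - p) / p) = 1"
      using r0 p1 by (simp add: powr_add[symmetric] diff_divide_distrib)
    ultimately have scale: "(6 * r) powr (1 - ?n / p) * E powr (1 / p) = 6 powr (1 - ?n / p) * K powr (1 / p)"
      using r0 by (simp add: powr_mult)
    have "\<bar>u x - u y\<bar> \<le> morrey_factor TYPE('a) p * (6 * r) powr (1 - ?n / p) * E powr (1 / p)"
    proof (rule morrey_ball[OF p u(1) _ E _ xy])
      show "(\<integral>\<^sup>+x. ennreal (norm (Gu x) powr p) * indicator (ball (b + (8 * r) *\<^sub>R e) (6 * r)) x \<partial>lborel) \<le> ennreal E"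
        using energy inside unfolding E_def by blast
    qed (use r0 in simp)
    also have "\<dots> = \<Lambda>" unfolding \<Lambda>_def mult.assoc scale ..
    finally show ?thesis
      using u(2)[rule_format, of x] u(2)[rule_format, of y] inside[OF xy(1)] inside[OF xy(2)] r0 by simp
  qed
  then show ?thesis by (intro exI[of _ \<Lambda>]) blast
qed

text \<open>The center is taken on the bisector, in the direction of X + Z. For an angle of at most
  \<pi> / 2 the norm of X + Z is at least sqrt(32) r, which keeps both points close to the
  center.\<close>

lemma sphere_points_in_common_ball:
  fixes X Z :: "'a::euclidean_space"
  assumes r: "r > 0" and X: "norm X = 4 * r" and Z: "norm Z = 4 * r" and XZ: "0 \<le> X \<bullet> Z"
  obtains e where "norm e = 1" "norm (X - (8 * r) *\<^sub>R e) < 6 * r" "norm (Z - (8 * r) *\<^sub>R e) < 6 * r"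
proof -
  define N where "N = norm (X + Z)"
  have XX: "X \<bullet> X = 16 * r\<^sup>2" "Z \<bullet> Z = 16 * r\<^sup>2"
    using X Z by (simp_all add: power2_norm_eq_inner[symmetric] power_mult_distrib)
  have N2: "N\<^sup>2 = 32 * r\<^sup>2 + 2 * (X \<bullet> Z)"
    by (simp add: N_def power2_norm_eq_inner inner_add_left inner_add_right XX inner_commute[of Z X])
  \<comment> \<open>The rational 11/2 lies below sqrt(32) and is the threshold for radius 6: the
    squared distance 80 r^2 - 8 r N becomes 36 r^2 at N = 11/2 r.\<close>
  have "(11 / 2 * r)\<^sup>2 = 121 / 4 * r\<^sup>2" "r\<^sup>2 > 0" using r by (simp_all add: power2_eq_square)
  then have "(11 / 2 * r)\<^sup>2 < N\<^sup>2" using N2 XZ by linarith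
  then have N: "11 / 2 * r < N" by (rule power2_less_imp_less) (simp add: N_def)
  have N0: "N > 0" using N r by simp
  define e where "e = (1 / N) *\<^sub>R (X + Z)"
  have e: "norm e = 1" using N0 by (simp add: e_def N_def)
  have dot: "Y \<bullet> e = N / 2" if "Y \<bullet> (X + Z) = N\<^sup>2 / 2" for Y
    using that N0 by (simp add: e_def power2_eq_square)
  have close: "norm (Y - (8 * r) *\<^sub>R e) < 6 * r" if Y: "Y \<bullet> Y = 16 * r\<^sup>2" "Y \<bullet> (X + Z) = N\<^sup>2 / 2" for Y
  proof -
    have ee: "e \<bullet> e = 1" using e by (simp add: norm_eq_1)
    have "(norm (Y - (8 * r) *\<^sub>R e))\<^sup>2 = Y \<bullet> Y - 16 * r * (Y \<bullet> e) + 64 * r\<^sup>2 * (e \<bullet> e)"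
      unfolding power2_norm_eq_inner
      by (simp add: inner_diff_left inner_diff_right inner_commute[of e Y] power2_eq_square algebra_simps)
    also have "\<dots> = 80 * r\<^sup>2 - 8 * r * N" unfolding dot[OF Y(2)] Y(1) ee by simp
    also have "\<dots> < 80 * r\<^sup>2 - 8 * r * (11 / 2 * r)"
      using N r by (intro diff_strict_left_mono mult_strict_left_mono) auto
    also have "\<dots> = (6 * r)\<^sup>2" by (simp add: power2_eq_square)
    finally show ?thesis by (rule power2_less_imp_less) (use r in simp)
  qed
  show thesis
  proof (rule that[OF e])
    show "norm (X - (8 * r) *\<^sub>R e) < 6 * r" by (rule close) (simp_all add: inner_add_right XX N2)
    show "norm (Z - (8 * r) *\<^sub>R e) < 6 * r" by (rule close) (simp_all add: inner_add_right XX N2 inner_commute[of Z X])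
  qed
qed

text \<open>The bisector serves unless the points are antipodal; then any orthogonal direction does,
  which exists since the dimension is at least two. Harnack's inequality thus passes between any two
  points of a sphere in two steps.\<close>

lemma exists_sphere_point_between:
  fixes X Y :: "'a::euclidean_space"
  assumes dim: "2 \<le> DIM('a)" and R: "R > 0" and X: "norm X = R" and Y: "norm Y = R"
  obtains Z where "norm Z = R" "0 \<le> X \<bullet> Z" "0 \<le> Z \<bullet> Y"
proof (cases "X + Y = 0")
  case True
  obtain z where z: "z \<noteq> 0" "orthogonal X z" using orthogonal_to_vector_exists[OF dim, of X] by blast
  have "Y = - X" using True by (simp add: eq_neg_iff_add_eq_0 add.commute)
  with z R show thesis
    by (intro that[of "(R / norm z) *\<^sub>R z"]) (auto simp: orthogonal_def inner_commute)
next
  case False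
  have "X \<bullet> X = R\<^sup>2" "Y \<bullet> Y = R\<^sup>2" using X Y by (simp_all add: power2_norm_eq_inner[symmetric])
  moreover have "- (R * R) \<le> X \<bullet> Y" using Cauchy_Schwarz_ineq2[of X Y] X Y by (simp add: abs_le_iff)
  ultimately have "0 \<le> X \<bullet> (X + Y)" "0 \<le> (X + Y) \<bullet> Y"
    by (simp_all add: inner_add_right inner_add_left power2_eq_square)
  with False R show thesis
    by (intro that[of "(R / norm (X + Y)) *\<^sub>R (X + Y)"]) auto
qed

lemma harnack_sphere:
  fixes v :: "'a::euclidean_space \<Rightarrow> real"
  assumes dim: "2 \<le> DIM('a)" and p: "real DIM('a) < p" and R: "R > 0"
    and v: "line_gradient v G" and int: "integrable lborel (\<lambda>x. norm (G x) powr p)"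
    and minimal: "minimizes_energy_off p (cball b R) G"
  shows "\<exists>\<Lambda>. \<forall>r M \<epsilon> x y. R \<le> r \<longrightarrow> \<epsilon> > 0 \<longrightarrow> (\<forall>x. r \<le> norm (x - b) \<longrightarrow> v x \<le> M) \<longrightarrow>
    norm (x - b) = 4 * r \<longrightarrow> norm (y - b) = 4 * r \<longrightarrow> \<bar>ln (M + \<epsilon> - v x) - ln (M + \<epsilon> - v y)\<bar> \<le> \<Lambda>"
proof -
  obtain \<Lambda> where \<Lambda>: "\<forall>r M \<epsilon> e. R \<le> r \<longrightarrow> \<epsilon> > 0 \<longrightarrow> (\<forall>x. r \<le> norm (x - b) \<longrightarrow> v x \<le> M) \<longrightarrow> norm e = 1 \<longrightarrow>
    (\<forall>x\<in>ball (b + (8 * r) *\<^sub>R e) (6 * r). \<forall>y\<in>ball (b + (8 * r) *\<^sub>R e) (6 * r).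
      \<bar>ln (M + \<epsilon> - v x) - ln (M + \<epsilon> - v y)\<bar> \<le> \<Lambda>)"
    using harnack_ball[OF p R v int minimal] by (rule exE)
  have "\<bar>ln (M + \<epsilon> - v x) - ln (M + \<epsilon> - v y)\<bar> \<le> 2 * \<Lambda>"
    if r: "R \<le> r" and \<epsilon>: "\<epsilon> > 0" and M: "\<forall>x. r \<le> norm (x - b) \<longrightarrow> v x \<le> M"
      and x: "norm (x - b) = 4 * r" and y: "norm (y - b) = 4 * r" for r M \<epsilon> x y
  proof -
    have r0: "r > 0" using r R by simp
    have near: "\<bar>ln (M + \<epsilon> - v (b + X)) - ln (M + \<epsilon> - v (b + Z))\<bar> \<le> \<Lambda>"
      if XZ: "norm X = 4 * r" "norm Z = 4 * r" "0 \<le> X \<bullet> Z" for X Z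
    proof -
      obtain e where e: "norm e = 1" "norm (X - (8 * r) *\<^sub>R e) < 6 * r" "norm (Z - (8 * r) *\<^sub>R e) < 6 * r"
        using sphere_points_in_common_ball[OF r0 XZ] by blast
      show ?thesis
      proof (rule \<Lambda>[rule_format, OF r \<epsilon> _ e(1)])
        show "v x \<le> M" if "r \<le> norm (x - b)" for x using M that by blast
        show "b + X \<in> ball (b + (8 * r) *\<^sub>R e) (6 * r)" "b + Z \<in> ball (b + (8 * r) *\<^sub>R e) (6 * r)"
          using e(2,3) by (simp_all add: dist_norm norm_minus_commute)
      qed
    qed
    obtain Z where Z: "norm Z = 4 * r" "0 \<le> (x - b) \<bullet> Z" "0 \<le> Z \<bullet> (y - b)"
      using exists_sphere_point_between[OF dim _ x y] r0 by auto
    from near[OF x Z(1,2)] near[OF Z(1) y Z(3)] show ?thesis by simp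
  qed
  then show ?thesis by (intro exI[of _ "2 * \<Lambda>"]) blast
qed

text \<open>On each sphere around \<open>b\<close> the maximum and the minimum of \<open>v\<close> are opposite, so Harnack's
  inequality for \<open>M - v\<close> improves a bound \<open>M\<close> for \<open>\<bar>v\<bar>\<close> by a fixed factor.\<close>

proposition odd_minimizer_tendsto_0:
  fixes v :: "'a::euclidean_space \<Rightarrow> real"
  assumes dim: "2 \<le> DIM('a)" and p: "real DIM('a) < p" and R: "R > 0"
    and v: "line_gradient v G" and int: "integrable lborel (\<lambda>x. norm (G x) powr p)"
    and minimal: "minimizes_energy_off p (cball b R) G"
    and odd: "\<And>x. v (T x) = - v x" and T: "\<And>x. norm (T x - b) = norm (x - b)"
  shows "(v \<longlongrightarrow> 0) at_infinity"
proof -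
  have p0: "p > 0" using p by (meson le_less_trans of_nat_0_le_iff)
  obtain \<Lambda> where \<Lambda>: "\<forall>r M \<epsilon> x y. R \<le> r \<longrightarrow> \<epsilon> > 0 \<longrightarrow> (\<forall>x. r \<le> norm (x - b) \<longrightarrow> v x \<le> M) \<longrightarrow>
    norm (x - b) = 4 * r \<longrightarrow> norm (y - b) = 4 * r \<longrightarrow> \<bar>ln (M + \<epsilon> - v x) - ln (M + \<epsilon> - v y)\<bar> \<le> \<Lambda>"
    using harnack_sphere[OF dim p R v int minimal] by (rule exE)
  define C where "C = exp \<bar>\<Lambda>\<bar>"
  have C: "C \<ge> 1" by (simp add: C_def)
  \<comment> \<open>Solving M - v \<le> C (M + v) for v gives v \<ge> - (C - 1) / (C + 1) M.\<close>
  define \<theta> where "\<theta> = (C - 1) / (C + 1)"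
  have \<theta>: "0 \<le> \<theta>" "\<theta> < 1" using C by (auto simp: \<theta>_def)
  have lower: "- (\<theta> * M) \<le> v x"
    if r: "R \<le> r" "4 * r \<le> norm (x - b)" and M: "\<And>x. r \<le> norm (x - b) \<Longrightarrow> \<bar>v x\<bar> \<le> M" for r M x
  proof -
    have le: "\<bar>v x\<bar> \<le> M" using M[of x] r R by simp
    have "M - v x \<le> C * (M + v x)"
    proof (rule field_le_epsilon)
      fix d :: real assume "d > 0"
      \<comment> \<open>A positive \<epsilon> keeps the logarithms defined where |v| attains M; it
        contributes (C - 1) \<epsilon>, which is at most \<open>d\<close>.\<close>
      define \<epsilon> where "\<epsilon> = d / C"
      have \<epsilon>: "\<epsilon> > 0" using \<open>d > 0\<close> C by (simp add: \<epsilon>_def)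
      \<comment> \<open>Chosen so that \<open>x\<close> and \<open>T x\<close> both lie on the
        sphere of radius \<open>4 * r'\<close>, on which \<open>harnack_sphere\<close> compares
        values.\<close>
      define r' where "r' = norm (x - b) / 4"
      have r': "R \<le> r'" "norm (x - b) = 4 * r'" "norm (T x - b) = 4 * r'" using r T by (auto simp: r'_def)
      have "v y \<le> M" if "r' \<le> norm (y - b)" for y
        using M[of y] that r by (auto simp: r'_def)
      then have "\<bar>ln (M + \<epsilon> - v x) - ln (M + \<epsilon> - v (T x))\<bar> \<le> \<Lambda>"
        using \<Lambda> r' \<epsilon> by blast
      then have "ln (M + \<epsilon> - v x) \<le> \<bar>\<Lambda>\<bar> + ln (M + \<epsilon> + v x)"
        by (simp add: odd)
      then have "exp (ln (M + \<epsilon> - v x)) \<le> exp (\<bar>\<Lambda>\<bar> + ln (M + \<epsilon> + v x))" by simp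
      then have "M + \<epsilon> - v x \<le> C * (M + \<epsilon> + v x)"
        using le \<epsilon> by (simp add: exp_add C_def)
      then show "M - v x \<le> C * (M + v x) + d" using \<epsilon> C by (simp add: \<epsilon>_def distrib_left)
    qed
    then have "- ((C - 1) * M) \<le> (C + 1) * v x" by (simp add: algebra_simps)
    then show ?thesis using C by (simp add: \<theta>_def divide_simps mult.commute)
  qed
  have step: "\<bar>v x\<bar> \<le> \<theta> * M"
    if "R \<le> r" "4 * r \<le> norm (x - b)" and "\<And>x. r \<le> norm (x - b) \<Longrightarrow> \<bar>v x\<bar> \<le> M" for r M x
    using lower[OF that] lower[OF that(1) _ that(3), of "T x"] that(2) by (simp add: odd T abs_le_iff)
  have "bounded (v ` cball b R)"
    using line_gradientD(1)[OF v]
    by (intro compact_imp_bounded compact_continuous_image) (auto intro: continuous_on_subset)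
  then obtain M where M: "\<forall>y\<in>v ` cball b R. norm y \<le> M" unfolding bounded_iff by blast
  have upper: "v x \<le> M" for x
  proof (rule energy_minimizer_le[OF p0 v int minimal])
    show "b \<in> cball b R" using R by simp
    show "v y \<le> M" if "y \<in> cball b R" for y using M that by (auto simp: abs_le_iff)
  qed
  have M0: "\<bar>v x\<bar> \<le> M" for x using upper[of x] upper[of "T x"] by (simp add: odd abs_le_iff)
  have decay: "\<bar>v x\<bar> \<le> \<theta> ^ k * M" if "4 ^ k * R \<le> norm (x - b)" for k x
    using that
  proof (induction k arbitrary: x)
    case (Suc k)
    have "R \<le> 4 ^ k * R" using R by simp
    from step[OF this _ Suc.IH, of x] Suc.prems show ?case by (simp add: mult.assoc)
  qed (simp add: M0)
  show ?thesis
    unfolding Lim_at_infinity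
  proof (intro allI impI)
    fix e :: real assume "e > 0"
    have "(\<lambda>k. \<theta> ^ k * M) \<longlonglongrightarrow> 0 * M"
      using \<theta> by (intro tendsto_mult_right LIMSEQ_realpow_zero) auto
    then have "eventually (\<lambda>k. \<theta> ^ k * M < e) sequentially"
      using \<open>e > 0\<close> by (intro order_tendstoD(2)) auto
    then obtain k where k: "\<theta> ^ k * M < e" by (auto simp: eventually_sequentially)
    have "dist (v x) 0 < e" if "4 ^ k * R + norm b \<le> norm x" for x
      using decay[of k x] k that norm_triangle_ineq2[of x b] by simp
    then show "\<exists>B. \<forall>x. B \<le> norm x \<longrightarrow> dist (v x) 0 < e" by blast
  qed
qed

section \<open>Symmetry of extremals\<close>

lemma extremal_symmetric_gradient:
  fixes v :: "real ^ 'n::finite \<Rightarrow> real"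
  assumes p: "real CARD('n) < p" "p > 1" and adm: "admissible \<rho>" and ex: "extremal p \<rho> v"
    and attained: "morrey_seminorm p \<rho> v = ereal (morrey_ratio p \<rho> v)"
    and v: "line_gradient v G" "integrable lborel (\<lambda>x. norm (G x) powr p)"
    and w: "line_gradient w H" "integrable lborel (\<lambda>x. norm (H x) powr p)"
    and same_energy: "(LINT x|lborel. norm (H x) powr p) = (LINT x|lborel. norm (G x) powr p)"
    and same_integral: "signed_integral \<rho> w = signed_integral \<rho> v"
  shows "v x - w x = v y - w y"
proof -
  define u where "u x = (1 / 2) * (v x + w x)" for x
  define K where "K x = (1 / 2) *\<^sub>R (G x + H x)" for x
  have u: "line_gradient u K"
    unfolding u_def K_def by (rule line_gradient_scale[OF line_gradient_add[OF v(1) w(1)]])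
  note cv = line_gradientD(1)[OF v(1)] and cw = line_gradientD(1)[OF w(1)]
  have le: "norm (K x) powr p \<le> (norm (G x) powr p + norm (H x) powr p) / 2" for x
    using norm_powr_weighted_convex[of "1 / 2" p "G x" "H x"] p
    by (simp add: K_def scaleR_add_right)
  have int_avg: "integrable lborel (\<lambda>x. (norm (G x) powr p + norm (H x) powr p) / 2)"
    using v(2) w(2) by simp
  have intK: "integrable lborel (\<lambda>x. norm (K x) powr p)"
  proof (rule Bochner_Integration.integrable_bound[OF int_avg])
    show "(\<lambda>x. norm (K x) powr p) \<in> borel_measurable lborel" using line_gradientD(2)[OF u] by simp
    show "AE x in lborel. norm (norm (K x) powr p) \<le> norm ((norm (G x) powr p + norm (H x) powr p) / 2)"
      using le by (intro always_eventually allI) simp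
  qed
  have "signed_integral \<rho> u = (1 / 2) * signed_integral \<rho> (\<lambda>x. v x + w x)"
    unfolding u_def by (rule signed_integral_linear[OF adm bounded_linear_mult_right]) (intro continuous_on_add cv cw)
  also have "\<dots> = signed_integral \<rho> v" using signed_integral_add[OF adm cv cw] same_integral by simp
  finally have "(LINT x|lborel. norm (G x) powr p) \<le> (LINT x|lborel. norm (K x) powr p)"
    by (rule extremal_energy_le[OF p(1) adm ex attained v(1) u intK])
  moreover have "(LINT x|lborel. (norm (G x) powr p + norm (H x) powr p) / 2) = (LINT x|lborel. norm (G x) powr p)"
    using v(2) w(2) same_energy by simp
  ultimately have "AE x in lborel. norm (K x) powr p = (norm (G x) powr p + norm (H x) powr p) / 2"
    using le by (intro integral_le_imp_AE_eq intK int_avg) auto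
  then have "AE x in lborel. G x + (-1) *\<^sub>R H x = 0"
  proof eventually_elim
    case (elim x)
    then have "G x = H x" using norm_powr_midpoint_eq[OF p(2), of "G x" "H x"] by (simp add: K_def)
    then show ?case by simp
  qed
  then have "v x + (-1) * w x = v y + (-1) * w y"
    by (rule line_gradient_zero_imp_constant[OF line_gradient_add[OF v(1) line_gradient_scale[OF w(1)]]])
  then show ?thesis by simp
qed

theorem proposition4p7:
  fixes p :: real
    and \<rho> :: "(real ^ 'n::finite) set \<Rightarrow> real"
    and v :: "real ^ 'n \<Rightarrow> real"
    and T :: "real ^ 'n \<Rightarrow> real ^ 'n"
  assumes "CARD('n) \<ge> 2"
    and "real CARD('n) < p"
    and "admissible \<rho>"
    and "extremal p \<rho> v"
    and "morrey_seminorm p \<rho> v =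
           ereal (\<bar>signed_integral \<rho> v\<bar> /
             norm (signed_integral \<rho> (\<lambda>y. y)) powr (1 - real CARD('n) / p))"
    and "T \<in> similarities"
    and "\<And>A. A \<in> sets borel \<Longrightarrow> push_forward T \<rho> A = - \<rho> A"
  shows "(\<forall>x y. v x + v (T x) = v y + v (T y)) \<and>
         (\<forall>y. (v \<longlongrightarrow> (v y + v (T y)) / 2) at_infinity)"
proof -
  note p = assms(2) and adm = assms(3) and ex = assms(4) and push = assms(7)
  have p1: "p > 1" using assms(1,2) by linarith
  have attained: "morrey_seminorm p \<rho> v = ereal (morrey_ratio p \<rho> v)"
    using assms(5) by (simp add: morrey_ratio_def)
  obtain c Q z where c: "c > 0" and Q: "orthogonal_matrix Q" and Tc: "\<And>x. T x = c *\<^sub>R (Q *v x) + z"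
    using assms(6) unfolding similarities_def by auto
  define Q' where "Q' = transpose Q"
  have Q': "orthogonal_matrix Q'" "Q ** Q' = mat 1" "Q' ** Q = mat 1"
    using Q by (simp_all add: Q'_def orthogonal_matrix_def orthogonal_matrix_transpose)
  define L where "L = (\<lambda>x. Q *v x)"
  have orth: "orthogonal_transformation L"
    using Q by (simp add: L_def orthogonal_transformation_matrix)
  have blL: "bounded_linear L" by (simp add: L_def)
  have normL: "norm (L x) = norm x" for x by (rule orthogonal_transformation_norm[OF orth])
  have adjL: "norm (adjoint L x) = norm x" for x
  proof -
    have "orthogonal_transformation (\<lambda>x. Q' *v x)"
      using Q'(1) by (simp add: orthogonal_transformation_matrix)
    moreover have "adjoint L = (\<lambda>x. Q' *v x)" unfolding L_def Q'_def by (rule adjoint_matrix)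
    ultimately show ?thesis by (simp add: orthogonal_transformation_norm)
  qed
  have QQ: "Q *v (Q' *v x) = x" "Q' *v (Q *v x) = x" for x
    by (simp_all add: Q' matrix_vector_mul_assoc)
  define S where "S x = (1 / c) *\<^sub>R (Q' *v (x - z))" for x
  have inv: "T (S x) = x" "S (T x) = x" for x
    using c by (simp_all add: Tc S_def matrix_vector_mult_scaleR QQ)
  have contT: "continuous_on UNIV T"
    unfolding Tc using blL[unfolded L_def] by (intro continuous_intros linear_continuous_on)
  have "continuous_on UNIV S"
    unfolding S_def by (intro continuous_on_scaleR continuous_on_const
        continuous_on_compose2[OF linear_continuous_on[of "\<lambda>x. Q' *v x" UNIV]] continuous_on_diff continuous_on_id) auto
  then have Tm: "T \<in> borel \<rightarrow>\<^sub>M borel" and Sm: "S \<in> borel \<rightarrow>\<^sub>M borel"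
    using contT by (auto intro: borel_measurable_continuous_onI)
  have pushed: "signed_integral \<rho> (\<lambda>x. f (T x)) = - signed_integral \<rho> f" if "continuous_on UNIV f"
    for f :: "real ^ 'n \<Rightarrow> 'b::{banach, second_countable_topology}"
  proof -
    have "signed_integral \<rho> (\<lambda>x. f (T x)) = signed_integral (push_forward T \<rho>) f"
      using admissible_signed_borel_measure(1)[OF adm] Tm Sm inv borel_measurable_continuous_onI[OF that]
      by (rule signed_integral_push_forward[symmetric])
    also have "\<dots> = - signed_integral \<rho> f"
      by (simp add: signed_integral_cong[OF push] signed_integral_uminus_measure)
    finally show ?thesis .
  qed
  \<comment> \<open>Since \<rho> has total mass 0, the translation part of \<open>T\<close> does not
    move the first moment. So \<open>T\<close> scales the length of that nonzero vector by
    \<open>c\<close>, while the symmetry only changes its sign.\<close>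
  have "c = 1"
  proof -
    define w where "w = signed_integral \<rho> (\<lambda>y. y)"
    have w: "w \<noteq> 0" using adm by (simp add: w_def admissible_def)
    have bl: "bounded_linear (\<lambda>y. c *\<^sub>R L y)" by (rule bounded_linear_compose[OF bounded_linear_scaleR_right blL])
    have "- w = signed_integral \<rho> (\<lambda>x. c *\<^sub>R L x + z)"
      using pushed[OF continuous_on_id] by (simp add: w_def Tc L_def)
    also have "\<dots> = signed_integral \<rho> (\<lambda>x. c *\<^sub>R L x) + signed_integral \<rho> (\<lambda>x. z)"
      by (rule signed_integral_add[OF adm linear_continuous_on[OF bl] continuous_on_const])
    also have "\<dots> = c *\<^sub>R L w"
      using signed_integral_linear[OF adm bl continuous_on_id] signed_integral_const[OF adm, of z] by (simp add: w_def)
    finally have "norm (- w) = norm (c *\<^sub>R L w)" by simp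
    then have "norm w = c * norm w" using c normL[of w] by simp
    then show ?thesis using w by simp
  qed
  then have T: "T x = L x + z" for x by (simp add: Tc L_def)
  obtain G where v: "line_gradient v G" "integrable lborel (\<lambda>x. norm (G x) powr p)"
    using ex D1p_iff[OF p] unfolding extremal_def by blast
  note cv = line_gradientD(1)[OF v(1)]
  have sum: "v x + v (T x) = v y + v (T y)" for x y
  proof -
    define w where "w x = (-1) * v (T x)" for x
    define H where "H x = (-1) *\<^sub>R adjoint L (G (T x))" for x
    have w: "line_gradient w H"
      unfolding w_def H_def T by (rule line_gradient_scale[OF line_gradient_isometry[OF v(1) orth]])
    have normH: "norm (H x) powr p = norm (G (T x)) powr p" for x by (simp add: H_def adjL)
    have distr: "distr lborel borel T = lborel" unfolding T[abs_def] by (rule distr_lborel_isometry[OF orth])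
    have Gm: "(\<lambda>x. norm (G x) powr p) \<in> borel_measurable borel" using line_gradientD(2)[OF v(1)] by simp
    have intH: "integrable lborel (\<lambda>x. norm (H x) powr p)"
      using integrable_distr_eq[of T lborel borel "\<lambda>x. norm (G x) powr p"] Tm Gm v(2) by (simp add: distr normH)
    have "(LINT x|lborel. norm (H x) powr p) = (LINT x|lborel. norm (G x) powr p)"
      using integral_distr[of T lborel borel "\<lambda>x. norm (G x) powr p"] Tm Gm by (simp add: distr normH)
    moreover have "signed_integral \<rho> w = signed_integral \<rho> v"
    proof -
      have "signed_integral \<rho> w = (-1) * signed_integral \<rho> (\<lambda>x. v (T x))"
        unfolding w_def by (rule signed_integral_linear[OF adm bounded_linear_mult_right])
          (rule continuous_on_compose2[OF cv contT], simp)
      then show ?thesis using pushed[OF cv] by simp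
    qed
    ultimately have "v x - w x = v y - w y"
      by (rule extremal_symmetric_gradient[OF p p1 adm ex attained v w intH])
    then show ?thesis by (simp add: w_def)
  qed
  have "(v \<longlongrightarrow> (v y + v (T y)) / 2) at_infinity" for y
  proof -
    define m where "m = (v y + v (T y)) / 2"
    define V where "V x = v x - m" for x
    have V: "line_gradient V G"
    proof -
      have "((\<lambda>t. t - m) has_real_derivative 1) (at t)" for t by (auto intro!: derivative_eq_intros)
      from line_gradient_chain[OF v(1) this] show ?thesis by (simp add: V_def[abs_def])
    qed
    obtain b where b: "T b = b"
      using fixed_point_if_push_forward_uminus[OF adm blL T Sm inv push] by blast
    have Tb: "norm (T x - b) = norm (x - b)" for x
    proof -
      have "T x - T b = L (x - b)" by (simp add: T linear_diff[OF bounded_linear.linear[OF blL]])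
      then show ?thesis using b normL by simp
    qed
    have "bounded (signed_support \<rho>)" using adm by (simp add: admissible_def compact_imp_bounded)
    then obtain R0 where R0: "signed_support \<rho> \<subseteq> cball b R0" by (auto simp: bounded_any_center[of _ b] subset_iff)
    define R where "R = max R0 1"
    have R: "R > 0" "signed_support \<rho> \<subseteq> cball b R" using R0 by (auto simp: R_def subset_iff)
    \<comment> \<open>A perturbation that vanishes on a ball containing the support leaves the
      integral against \<rho> unchanged, so the perturbed function is an admissible competitor for
      the extremal \<open>v\<close>.\<close>
    have "minimizes_energy_off p (cball b R) G"
      unfolding minimizes_energy_off_def
    proof (intro allI impI)
      fix \<phi> H
      assume \<phi>: "line_gradient \<phi> H" and int: "integrable lborel (\<lambda>x. norm (G x + H x) powr p)"
        and zero: "\<forall>x\<in>cball b R. \<phi> x = 0"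
      note c\<phi> = line_gradientD(1)[OF \<phi>]
      have "signed_integral \<rho> \<phi> = signed_integral \<rho> (\<lambda>x. 0)"
        using zero R(2) by (intro signed_integral_cong_support[OF adm c\<phi> continuous_on_const]) auto
      then have "signed_integral \<rho> (\<lambda>x. v x + \<phi> x) = signed_integral \<rho> v"
        using signed_integral_add[OF adm cv c\<phi>] signed_integral_const[OF adm, of "0::real"] by simp
      then show "(LINT x|lborel. norm (G x) powr p) \<le> (LINT x|lborel. norm (G x + H x) powr p)"
        by (rule extremal_energy_le[OF p adm ex attained v(1) line_gradient_add[OF v(1) \<phi>] int])
    qed
    moreover have "V (T x) = - V x" for x
    proof -
      have "2 * m = v y + v (T y)" by (simp add: m_def)
      with sum[of x y] show ?thesis unfolding V_def by linarith
    qed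
    ultimately have "(V \<longlongrightarrow> 0) at_infinity"
      using assms(1) p R(1) V v(2) Tb by (intro odd_minimizer_tendsto_0[of p R V G b T]) auto
    then have "((\<lambda>x. V x + m) \<longlongrightarrow> 0 + m) at_infinity" by (intro tendsto_add tendsto_const)
    then show ?thesis by (simp add: V_def m_def)
  qed
  with sum show ?thesis by blast
qed

end
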